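(* Let $u_0=u(\cdot;a_0,E_0,c_0)$ be a non-constant periodic traveling wave profile of $u_t=u_{xxx}+f(u)_x$ as described in the context. Assume that the Jacobian $\{T,M,P\}_{a,E,c}=\det\frac{\partial(T,M,P)}{\partial(a,E,c)}$ is non-zero at $(a_0,E_0,c_0)$, and that the matrix $\frac{\partial(\dot u)}{\partial(a,E,s)}\big|_{(a,E,s)=(a_0,E_0,0)}$ is nonsingular, where $\dot u=\dot u(a,E,s)\in\mathcal P$ denotes the class modulo translation of the wave $u(\cdot;a,E,c_0-s)$. Then there exists a nonzero constant $\Gamma_0$ such that, in a neighborhood of $(\mu,\kappa)=(0,0)$, the periodic Evans function $D(\mu,\kappa)$ associated with the linearization about $u_0$ satisfies $$D(\mu,\kappa)=\Gamma_0\,\widetilde P(-\mu,\kappa;a_0,E_0,0)+\mathcal O\left(|\mu|^4+\kappa^4\right),$$ where $$\widetilde P(\mu,\kappa;a,E,s)=\det\left(\mu\,\frac{\partial(M\omega,P\omega,\omega)}{\partial(a,E,s)}-\frac{i\kappa}{T}\,\frac{\partial(a-sM\omega,\,-sP\omega-2E,\,-s\omega)}{\partial(a,E,s)}\right).$$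
   Context: **Profiles.** Let $f:\mathbb R\to\mathbb R$ be a (sufficiently smooth) nonlinearity, $F'=f$, $F(0)=0$, and $V(u;a,c)=F(u)-au-\frac c2u^2$. Traveling waves $u(x+ct)$ of $u_t=u_{xxx}+f(u)_x$ have profiles satisfying $u_{xxx}+f(u)_x-cu_x=0$, which integrates to $\frac{u_x^2}{2}=E-V(u;a,c)$ with constants $a,E$. Parameters $(a,E,c)$ are considered in an open set of $\mathbb R^3$ (containing $(a_0,E_0,c_0)$) on which there are simple roots $u_-<u_+$ of $E=V(\cdot;a,c)$ with $V(u;a,c)<E$ for $u\in(u_-,u_+)$; $u(\cdot;a,E,c)$ denotes the corresponding non-constant periodic profile, normalized by $u(0)=u_-$. **Period, mass, momentum.** The following are $C^1$ functions of $(a,E,c)$: $T(a,E,c)=\sqrt2\int_{u_-}^{u_+}\frac{du}{\sqrt{E-V(u;a,c)}}$ (the period of $u(\cdot;a,E,c)$), $M(a,E,c)=\int_0^T u(x)\,dx$, $P(a,E,c)=\int_0^T u(x)^2\,dx$. Put $\omega=1/T$. **Variables $(a,E,s)$.** With $c_0$ fixed, in expressions involving $(a,E,s)$ the functions $T,M,P,\omega$ are evaluated at $(a,E,c)=(a,E,c_0-s)$, and $\frac{\partial(g_1,g_2,g_3)}{\partial(a,E,s)}$ denotes the $3\times3$ Jacobian matrix. **The space $\mathcal P$.** $\mathcal T$ is the set of periodic traveling wave profiles (all translates of the $u(\cdot;a,E,c)$) and $\mathcal P=\mathcal T/\mathcal R$ is its quotient by translations ($u\,\mathcal R\,v$ iff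 $v=u(\cdot-\xi)$ for some $\xi\in\mathbb R$); $\mathcal P$ is locally a three-dimensional manifold. Nonsingularity of $\frac{\partial(\dot u)}{\partial(a,E,s)}$ at $(a_0,E_0,0)$ means that the differential at $(a_0,E_0,0)$ of the map $(a,E,s)\mapsto\dot u(a,E,s)\in\mathcal P$ is invertible, so that waves in $\mathcal P$ near $\dot u_0$ are coordinatized by $(a,E,s)$. **Evans function.** Let $T_0=T(a_0,E_0,c_0)$ and $\mathcal L[u_0]=-\partial_x^2-f'(u_0)+c_0$. The spectral problem $\partial_x\mathcal L[u_0]v=\mu v$ is written as a first order system $Y_x=\mathbf H(x,\mu)Y$, $Y=(v,v_x,v_{xx})^{\mathsf T}$. Let $\Phi(x,\mu)$ be the matrix solution with $\Phi(0,\mu)=\mathbf I$ and $\mathbb M(\mu)=\Phi(T_0,\mu)$ the monodromy matrix. The periodic Evans function is $D(\mu,\kappa)=\det(\mathbb M(\mu)-e^{i\kappa}\mathbf I)$ for $(\mu,\kappa)\in\mathbb C\times\mathbb R$. *)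

theory Defs
  imports "HOL-Analysis.Analysis" "HOL-Library.Landau_Symbols"
begin

section \<open>Periodic travelling wave profiles\<close>

definition Ck :: "nat \<Rightarrow> (real \<Rightarrow> real) \<Rightarrow> bool" where
  "Ck k g \<longleftrightarrow> (\<forall>j<k. \<forall>x. ((deriv ^^ j) g) differentiable (at x))
     \<and> continuous_on UNIV ((deriv ^^ k) g)"

text \<open>A point \<open>p\<close> of the parameter space \<open>real ^ 3\<close> is \<open>(a, E, c)\<close>,
  i.e. \<open>p $ 1 = a\<close>, \<open>p $ 2 = E\<close>, \<open>p $ 3 = c\<close>.\<close>

definition potential :: "(real \<Rightarrow> real) \<Rightarrow> real \<Rightarrow> real \<Rightarrow> real \<Rightarrow> real" where
  "potential F y a c = F y - a * y - c / 2 * y\<^sup>2"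

definition simple_root :: "(real \<Rightarrow> real) \<Rightarrow> real ^ 3 \<Rightarrow> real \<Rightarrow> bool" where
  "simple_root F p r \<longleftrightarrow> potential F r (p $ 1) (p $ 3) = p $ 2
     \<and> deriv (\<lambda>y. potential F y (p $ 1) (p $ 3)) r \<noteq> 0"

text \<open>The profile equation \<open>u_xxx + f(u)_x - c u_x = 0\<close> together with its first integral
  \<open>u_x\<^sup>2 / 2 = E - V(u; a, c)\<close>; the latter alone would also admit profiles that rest at a
  turning point.\<close>

definition periodic_profile ::
  "(real \<Rightarrow> real) \<Rightarrow> (real \<Rightarrow> real) \<Rightarrow> real ^ 3 \<Rightarrow> (real \<Rightarrow> real) \<Rightarrow> bool" where
  "periodic_profile f F p w \<longleftrightarrow>
     Ck 3 w
     \<and> (\<forall>x. (deriv ^^ 3) w x + deriv (\<lambda>y. f (w y)) x - p $ 3 * deriv w x = 0)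
     \<and> (\<forall>x. (deriv w x)\<^sup>2 / 2 = p $ 2 - potential F (w x) (p $ 1) (p $ 3))
     \<and> (\<exists>L>0. \<forall>x. w (x + L) = w x)
     \<and> \<not> (\<exists>k. \<forall>x. w x = k)"

text \<open>\<open>um\<close> and \<open>up\<close> select the roots \<open>u\<^sub>-\<close> and \<open>u\<^sub>+\<close>. Their continuity excludes selections that
  jump between different potential wells at the same energy.\<close>

definition wave_family ::
  "(real \<Rightarrow> real) \<Rightarrow> (real \<Rightarrow> real) \<Rightarrow> (real ^ 3) set \<Rightarrow> (real ^ 3 \<Rightarrow> real) \<Rightarrow> (real ^ 3 \<Rightarrow> real)
     \<Rightarrow> (real ^ 3 \<Rightarrow> real \<Rightarrow> real) \<Rightarrow> bool" where
  "wave_family f F \<Omega> um up u \<longleftrightarrow>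
     open \<Omega> \<and> continuous_on \<Omega> um \<and> continuous_on \<Omega> up
     \<and> (\<forall>p\<in>\<Omega>. um p < up p \<and> simple_root F p (um p) \<and> simple_root F p (up p)
          \<and> (\<forall>y\<in>{um p<..<up p}. potential F y (p $ 1) (p $ 3) < p $ 2)
          \<and> periodic_profile f F p (u p) \<and> u p 0 = um p)"

text \<open>The integrand is singular at both end points, where it takes the value \<open>1 / 0 = 0\<close>; this does
  not affect the (absolutely convergent) integral.\<close>

definition wave_period ::
  "(real \<Rightarrow> real) \<Rightarrow> (real ^ 3 \<Rightarrow> real) \<Rightarrow> (real ^ 3 \<Rightarrow> real) \<Rightarrow> real ^ 3 \<Rightarrow> real" where
  "wave_period F um up p =
     sqrt 2 * integral {um p..up p} (\<lambda>y. 1 / sqrt (p $ 2 - potential F y (p $ 1) (p $ 3)))"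

definition wave_mass ::
  "(real ^ 3 \<Rightarrow> real) \<Rightarrow> (real ^ 3 \<Rightarrow> real \<Rightarrow> real) \<Rightarrow> real ^ 3 \<Rightarrow> real" where
  "wave_mass T u p = integral {0..T p} (\<lambda>x. u p x)"

definition wave_momentum ::
  "(real ^ 3 \<Rightarrow> real) \<Rightarrow> (real ^ 3 \<Rightarrow> real \<Rightarrow> real) \<Rightarrow> real ^ 3 \<Rightarrow> real" where
  "wave_momentum T u p = integral {0..T p} (\<lambda>x. (u p x)\<^sup>2)"


section \<open>Waves modulo translation\<close>

definition translation_rel :: "((real \<Rightarrow> real) \<times> (real \<Rightarrow> real)) set" where
  "translation_rel = {(v, w). \<exists>\<xi>. w = (\<lambda>x. v (x - \<xi>))}"

definition profile_set :: "(real ^ 3) set \<Rightarrow> (real ^ 3 \<Rightarrow> real \<Rightarrow> real) \<Rightarrow> (real \<Rightarrow> real) set" where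
  "profile_set \<Omega> u = {w. \<exists>p\<in>\<Omega>. \<exists>\<xi>. w = (\<lambda>x. u p (x - \<xi>))}"

definition profile_space ::
  "(real ^ 3) set \<Rightarrow> (real ^ 3 \<Rightarrow> real \<Rightarrow> real) \<Rightarrow> (real \<Rightarrow> real) set set" where
  "profile_space \<Omega> u = profile_set \<Omega> u // translation_rel"

text \<open>A point \<open>q\<close> with coordinates \<open>(a, E, s)\<close> corresponds to \<open>(a, E, c) = (a, E, c0 - s)\<close>.\<close>

definition speed_shift :: "real \<Rightarrow> real ^ 3 \<Rightarrow> real ^ 3" where
  "speed_shift c0 q = vector [q $ 1, q $ 2, c0 - q $ 3]"

definition wave_class ::
  "real \<Rightarrow> (real ^ 3 \<Rightarrow> real \<Rightarrow> real) \<Rightarrow> real ^ 3 \<Rightarrow> (real \<Rightarrow> real) set" where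
  "wave_class c0 u q = translation_rel `` {u (speed_shift c0 q)}"

text \<open>Differential of a map \<open>\<phi>\<close> into a space \<open>Q\<close> of translation classes. If \<open>v\<close> is a lift of \<open>\<phi>\<close> that
  is differentiable at \<open>q0\<close> with derivative \<open>h \<mapsto> W h\<close>, the differential of \<open>\<phi>\<close> at \<open>q0\<close> sends \<open>h\<close> to
  the class of \<open>W h\<close> modulo the tangent line of the translation orbit, which is spanned by
  \<open>(v q0)_x\<close>; another lift changes \<open>W h\<close> by a multiple of \<open>(v q0)_x\<close>. Domain and target have the same
  dimension 3, so that a linear map is invertible iff its kernel is zero.\<close>

definition nonsingular_differential ::
  "(real \<Rightarrow> real) set set \<Rightarrow> (real ^ 3 \<Rightarrow> (real \<Rightarrow> real) set) \<Rightarrow> real ^ 3 \<Rightarrow> bool" where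
  "nonsingular_differential Q \<phi> q0 \<longleftrightarrow>
     (\<exists>v W. (\<forall>\<^sub>F q in nhds q0. \<phi> q \<in> Q \<and> v q \<in> \<phi> q)
        \<and> (\<forall>x. ((\<lambda>q. v q x) has_derivative (\<lambda>h. W h x)) (at q0))
        \<and> (\<forall>h. (\<exists>k. \<forall>x. W h x = k * deriv (v q0) x) \<longrightarrow> h = 0))"


section \<open>The linearized modulation determinant\<close>

definition modulation_density ::
  "real \<Rightarrow> (real ^ 3 \<Rightarrow> real) \<Rightarrow> (real ^ 3 \<Rightarrow> real) \<Rightarrow> (real ^ 3 \<Rightarrow> real) \<Rightarrow> real ^ 3 \<Rightarrow> real ^ 3" where
  "modulation_density c0 T M P q =
     (let p = speed_shift c0 q; \<omega> = 1 / T p in vector [M p * \<omega>, P p * \<omega>, \<omega>])"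

definition modulation_flux ::
  "real \<Rightarrow> (real ^ 3 \<Rightarrow> real) \<Rightarrow> (real ^ 3 \<Rightarrow> real) \<Rightarrow> (real ^ 3 \<Rightarrow> real) \<Rightarrow> real ^ 3 \<Rightarrow> real ^ 3" where
  "modulation_flux c0 T M P q =
     (let p = speed_shift c0 q; \<omega> = 1 / T p; a = q $ 1; E = q $ 2; s = q $ 3
      in vector [a - s * M p * \<omega>, - s * P p * \<omega> - 2 * E, - s * \<omega>])"

definition modulation_det ::
  "real \<Rightarrow> (real ^ 3 \<Rightarrow> real) \<Rightarrow> (real ^ 3 \<Rightarrow> real) \<Rightarrow> (real ^ 3 \<Rightarrow> real)
     \<Rightarrow> complex \<Rightarrow> real \<Rightarrow> real ^ 3 \<Rightarrow> complex" where
  "modulation_det c0 T M P \<mu> \<kappa> q =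
     det (\<chi> i j. \<mu> * of_real (jacobian (modulation_density c0 T M P) (at q) $ i $ j)
        - \<i> * of_real \<kappa> / of_real (T (speed_shift c0 q))
            * of_real (jacobian (modulation_flux c0 T M P) (at q) $ i $ j) :: complex ^ 3 ^ 3)"


section \<open>The periodic Evans function\<close>

text \<open>Companion matrix, in the variables \<open>(v, v_x, v_xx)\<close>, of
  \<open>- v_xxx - (f'(u0) v)_x + c0 v_x = \<mu> v\<close>, which is \<open>\<partial>_x L[u0] v = \<mu> v\<close> written out.\<close>

definition spectral_matrix ::
  "(real \<Rightarrow> real) \<Rightarrow> (real \<Rightarrow> real) \<Rightarrow> real \<Rightarrow> real \<Rightarrow> complex \<Rightarrow> complex ^ 3 ^ 3" where
  "spectral_matrix f u0 c0 x \<mu> =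
     vector [vector [0, 1, 0],
             vector [0, 0, 1],
             vector [- \<mu> - of_real (deriv (\<lambda>y. deriv f (u0 y)) x),
                     of_real (c0 - deriv f (u0 x)), 0]]"

definition is_fundamental_solution ::
  "(real \<Rightarrow> complex \<Rightarrow> complex ^ 3 ^ 3) \<Rightarrow> (real \<Rightarrow> complex \<Rightarrow> complex ^ 3 ^ 3) \<Rightarrow> bool" where
  "is_fundamental_solution H \<Phi> \<longleftrightarrow>
     (\<forall>\<mu>. \<Phi> 0 \<mu> = mat 1
        \<and> (\<forall>x. ((\<lambda>y. \<Phi> y \<mu>) has_vector_derivative (H x \<mu> ** \<Phi> x \<mu>)) (at x)))"

definition evans_function ::
  "(real \<Rightarrow> complex \<Rightarrow> complex ^ 3 ^ 3) \<Rightarrow> real \<Rightarrow> complex \<Rightarrow> real \<Rightarrow> complex" where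
  "evans_function \<Phi> T0 \<mu> \<kappa> = det (\<Phi> T0 \<mu> - mat (exp (\<i> * of_real \<kappa>)))"

end

theory Submission
  imports Defs
begin

text \<open>
  The functions \<open>u_x\<close>, \<open>u_a\<close>, \<open>u_E\<close> solve the linearized equation at \<open>\<mu> = 0\<close>, and \<open>u_x - \<mu> u_c\<close> solves it
  up to \<open>O(\<mu>\<^sup>2)\<close>. A solution \<open>v\<close> of \<open>(L[u0] v)_x = \<mu> v\<close> is determined at a turning point, where
  \<open>u0_x = 0\<close>, by \<open>v_x\<close> together with the fluxes \<open>L[u0] v\<close> and \<open>u0 L[u0] v - u0_xx v + u0_x v_x\<close>, whose
  increments over a period are \<open>\<mu> \<integral> v\<close> and \<open>\<mu> \<integral> u0 v\<close>. In these coordinates the rows and columns of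
  \<open>\<Phi>(T0, \<mu>) - exp(\<i> \<kappa>)\<close> have definite orders in \<open>(\<mu>, \<kappa>)\<close>, its leading entries are the derivatives of
  \<open>T\<close>, \<open>M\<close>, \<open>P\<close>, and the determinant of the leading part is that of the modulation system up to row and
  column operations, with \<open>\<Gamma>0 = T0\<^sup>4 / 2\<close>.
  \<open>T\<close>, \<open>M\<close>, \<open>P\<close> are differentiable because, by Gronwall's inequality, the profiles depend differentiably
  on the parameters, uniformly on compact intervals.
\<close>

section \<open>Gronwall estimates and implicit differentiation\<close>

text \<open>Expanded directly, the determinant would require the monodromy matrix to third order in
  \<open>mu\<close>. The two conservation laws lower this: the flux increments over a period carry
  an explicit factor \<open>mu\<close>, so an approximation of \<open>v\<close> with error
  \<open>O(mu^j)\<close> yields increments with error \<open>O(mu^(j+1))\<close>. For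
  \<open>u_x - mu u_c\<close> the first-order increments vanish altogether, because
  \<open>u_x\<close> and \<open>u0 u_x\<close> are derivatives of periodic functions. Gronwall
  bounds uniform in \<open>|mu| \<le> 1\<close> take the place of a power series in
  \<open>mu\<close>.

  The other obstacle is regularity: \<open>f\<close> is only \<open>C^2\<close> and the period is
  given by a singular integral. Hence all parameter derivatives are taken at the single point
  \<open>p0\<close>, with remainders uniform in \<open>x\<close>, and the period is treated as a
  turning time to which implicit differentiation applies. The solutions of the variational equation
  are built from \<open>\<Phi>\<close> itself at eigenvalue zero.

  The coordinate changes have determinants \<open>1\<close> and \<open>-1\<close>, so the size of
  \<open>\<Gamma>0\<close> stems from the modulation side alone: its rows carry the factors
  \<open>\<omega>\<close>, \<open>2 \<omega>\<close> and \<open>\<omega>^2\<close>, with product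
  \<open>2 / T0^4\<close>.\<close>

lemma mvt_within:
  fixes f :: "real \<Rightarrow> real"
  assumes "a < b"
    and "\<And>x. x \<in> {a..b} \<Longrightarrow> (f has_real_derivative f' x) (at x within {a..b})"
  shows "\<exists>x\<in>{a<..<b}. f b - f a = (b - a) * f' x"
proof -
  have "\<exists>x\<in>{a<..<b}. f b - f a = (b - a) *\<^sub>R f' x"
    using assms mvt_simple[of a b f "\<lambda>x t. t *\<^sub>R f' x"]
    by (simp add: has_real_derivative_iff_has_vector_derivative has_vector_derivative_def)
  then show ?thesis by simp
qed

text \<open>The quantity \<open>exp (- k x) |z x|^2 - d^2 x\<close> does not increase:
  Cauchy-Schwarz bounds the derivative of \<open>|z|^2\<close> by
  \<open>2 |K| |z|^2 + 2 d |z|\<close>, and \<open>2 d |z| \<le> |z|^2 + d^2\<close>, whence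
  \<open>k = 2 |K| + 1\<close>. Squares are used because the norm need not be differentiable where
  \<open>z\<close> vanishes.\<close>

lemma gronwall_sq:
  fixes z :: "real \<Rightarrow> 'a::real_inner"
  assumes der: "\<And>x. x \<in> {0..b} \<Longrightarrow> (z has_vector_derivative z' x) (at x within {0..b})"
    and bd: "\<And>x. x \<in> {0..b} \<Longrightarrow> norm (z' x) \<le> K * norm (z x) + d"
    and "0 \<le> d" and x: "x \<in> {0..b}"
  shows "(norm (z x))\<^sup>2 \<le> exp ((2 * \<bar>K\<bar> + 1) * b) * ((norm (z 0))\<^sup>2 + b * d\<^sup>2)"
proof -
  define k where "k = 2 * \<bar>K\<bar> + 1"
  have k: "k > 0" unfolding k_def by linarith
  define G where "G = (\<lambda>x. exp (- k * x) * (z x \<bullet> z x) - d\<^sup>2 * x)"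
  define G' where "G' = (\<lambda>x. exp (- k * x) * (2 * (z x \<bullet> z' x) - k * (z x \<bullet> z x)) - d\<^sup>2)"
  have dG: "(G has_real_derivative G' x) (at x within {0..b})" if "x \<in> {0..b}" for x
  proof -
    have "((\<lambda>x. z x \<bullet> z x) has_real_derivative (z x \<bullet> z' x + z' x \<bullet> z x)) (at x within {0..b})"
      unfolding has_real_derivative_iff_has_vector_derivative
      using has_derivative_inner[OF der[OF that, unfolded has_vector_derivative_def]
                          der[OF that, unfolded has_vector_derivative_def]]
      by (simp add: has_vector_derivative_def algebra_simps)
    then show ?thesis unfolding G_def G'_def
      by (auto intro!: derivative_eq_intros simp: inner_commute algebra_simps)
  qed
  have G'0: "G' x \<le> 0" if "x \<in> {0..b}" for x
  proof -
    have "2 * (z x \<bullet> z' x) \<le> 2 * (norm (z x) * norm (z' x))"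
      using norm_cauchy_schwarz by simp
    also have "\<dots> \<le> 2 * (norm (z x) * (\<bar>K\<bar> * norm (z x) + d))"
      using bd[OF that]
      by (intro mult_left_mono) (auto intro!: order.trans[OF bd[OF that]] mult_right_mono)
    also have "\<dots> \<le> k * (z x \<bullet> z x) + d\<^sup>2"
      using sum_squares_bound[of "norm (z x)" d]
      by (simp add: k_def dot_square_norm power2_eq_square algebra_simps)
    finally have 1: "2 * (z x \<bullet> z' x) - k * (z x \<bullet> z x) \<le> d\<^sup>2" by simp
    have "exp (- k * x) * (2 * (z x \<bullet> z' x) - k * (z x \<bullet> z x)) \<le> exp (- k * x) * d\<^sup>2"
      using 1 by (intro mult_left_mono) auto
    also have "\<dots> \<le> 1 * d\<^sup>2"
      using k that by (intro mult_right_mono) auto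
    finally show ?thesis unfolding G'_def by simp
  qed
  have "G x \<le> G 0"
  proof (cases "x = 0")
    case False
    with x have "0 < x" by auto
    have "\<exists>y\<in>{0<..<x}. G x - G 0 = (x - 0) * G' y"
      using dG x by (intro mvt_within \<open>0 < x\<close>) (auto intro: DERIV_subset[of _ _ _ "{0..b}"])
    then obtain y where "y \<in> {0<..<x}" "G x - G 0 = x * G' y" by auto
    moreover have "G' y \<le> 0" using G'0 x \<open>y \<in> {0<..<x}\<close> by auto
    ultimately show ?thesis using \<open>0 < x\<close>
      by (smt (verit) mult_nonneg_nonpos)
  qed auto
  then have "exp (- k * x) * (norm (z x))\<^sup>2 \<le> (norm (z 0))\<^sup>2 + d\<^sup>2 * x"
    by (simp add: G_def dot_square_norm)
  also have "\<dots> \<le> (norm (z 0))\<^sup>2 + b * d\<^sup>2"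
    using x mult_right_mono[of x b "d\<^sup>2"] by (subst mult.commute[of "d\<^sup>2" x]) auto
  finally have 2: "exp (- k * x) * (norm (z x))\<^sup>2 \<le> (norm (z 0))\<^sup>2 + b * d\<^sup>2" .
  have "(norm (z x))\<^sup>2 = exp (k * x) * (exp (- k * x) * (norm (z x))\<^sup>2)"
    by (simp add: exp_minus field_simps)
  also have "\<dots> \<le> exp (k * x) * ((norm (z 0))\<^sup>2 + b * d\<^sup>2)"
    using 2 by (intro mult_left_mono) auto
  also have "\<dots> \<le> exp (k * b) * ((norm (z 0))\<^sup>2 + b * d\<^sup>2)"
    using k x by (intro mult_right_mono) auto
  finally show ?thesis unfolding k_def .
qed

text \<open>The square root of the previous bound, made linear in \<open>norm (z 0) + d\<close> at
  the price of a larger constant. Linearity is what matters later, when \<open>d\<close> is a power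
  of \<open>norm (p - p0)\<close> or of \<open>norm \<mu>\<close>.\<close>

lemma gronwall_norm:
  fixes z :: "real \<Rightarrow> 'a::real_inner"
  assumes der: "\<And>x. x \<in> {0..b} \<Longrightarrow> (z has_vector_derivative z' x) (at x within {0..b})"
    and bd: "\<And>x. x \<in> {0..b} \<Longrightarrow> norm (z' x) \<le> K * norm (z x) + d"
    and "0 \<le> d" and x: "x \<in> {0..b}"
  shows "norm (z x) \<le> exp ((2 * \<bar>K\<bar> + 1) * b) * (1 + b) * (norm (z 0) + d)"
proof (rule power2_le_imp_le)
  have b: "b \<ge> 0" using x by auto
  let ?e = "exp ((2 * \<bar>K\<bar> + 1) * b)"
  have "(norm (z x))\<^sup>2 \<le> ?e * ((norm (z 0))\<^sup>2 + b * d\<^sup>2)"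
    by (rule gronwall_sq[OF der bd \<open>0 \<le> d\<close> x])
  also have "\<dots> \<le> ?e\<^sup>2 * ((1 + b)\<^sup>2 * (norm (z 0) + d)\<^sup>2)"
  proof (rule mult_mono)
    have "?e \<ge> 1" using b by simp
    then show "?e \<le> ?e\<^sup>2" by (simp add: power2_eq_square)
    have "(norm (z 0))\<^sup>2 + b * d\<^sup>2 \<le> (1 + b) * (norm (z 0) + d)\<^sup>2"
      using b \<open>0 \<le> d\<close> by (simp add: power2_eq_square algebra_simps)
    also have "\<dots> \<le> (1 + b)\<^sup>2 * (norm (z 0) + d)\<^sup>2"
      using b by (intro mult_right_mono) (auto simp: power2_eq_square)
    finally show "(norm (z 0))\<^sup>2 + b * d\<^sup>2 \<le> (1 + b)\<^sup>2 * (norm (z 0) + d)\<^sup>2" .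
  qed (use b in auto)
  finally show "(norm (z x))\<^sup>2 \<le> (?e * (1 + b) * (norm (z 0) + d))\<^sup>2"
    by (simp add: power_mult_distrib mult.assoc)
  show "0 \<le> ?e * (1 + b) * (norm (z 0) + d)"
    using b \<open>0 \<le> d\<close> by auto
qed

text \<open>A Caratheodory-type chain rule: the factor \<open>k\<close> only needs a limit at
  \<open>p0\<close>. It gives derivatives of quantities known solely through an implicit
  relation.\<close>

lemma has_derivative_of_difference_quotient:
  fixes g n k :: "'a::real_normed_vector \<Rightarrow> real"
  assumes n: "(n has_derivative n') (at p0)"
    and k: "(k \<longlongrightarrow> k0) (at p0)"
    and eq: "\<forall>\<^sub>F p in at p0. g p - g p0 = k p * (n p - n p0)"
  shows "(g has_derivative (\<lambda>h. k0 * n' h)) (at p0)"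
proof -
  have "bounded_linear n'" using n by (rule has_derivative_bounded_linear)
  then obtain B where B: "\<And>h. norm (n' h) \<le> norm h * B" using bounded_linear.bounded by blast
  have rn: "((\<lambda>p. ((n p - n p0) - n' (p - p0)) / norm (p - p0)) \<longlongrightarrow> 0) (at p0)"
    using n unfolding has_derivative_at2 by (simp add: divide_inverse mult.commute algebra_simps)
  have 1: "((\<lambda>p. k p * (((n p - n p0) - n' (p - p0)) / norm (p - p0))) \<longlongrightarrow> k0 * 0) (at p0)"
    by (intro tendsto_mult k rn)
  have 2: "((\<lambda>p. (k p - k0) * (n' (p - p0) / norm (p - p0))) \<longlongrightarrow> 0) (at p0)"
  proof (rule Lim_null_comparison)
    show "((\<lambda>p. norm (k p - k0) * B) \<longlongrightarrow> 0) (at p0)"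
      using tendsto_mult_left_zero[OF tendsto_norm_zero[OF LIM_zero[OF k]]] by auto
    have "norm ((k p - k0) * (n' (p - p0) / norm (p - p0))) \<le> norm (k p - k0) * B"
      if "p \<noteq> p0" for p
      using B[of "p - p0"] that
      unfolding norm_mult by (intro mult_left_mono) (auto simp: divide_simps mult.commute)
    then show "\<forall>\<^sub>F p in at p0. norm ((k p - k0) * (n' (p - p0) / norm (p - p0))) \<le> norm (k p - k0) * B"
      by (auto simp: eventually_at_filter)
  qed
  have 3: "((\<lambda>p. k p * (((n p - n p0) - n' (p - p0)) / norm (p - p0))
      + (k p - k0) * (n' (p - p0) / norm (p - p0))) \<longlongrightarrow> 0) (at p0)"
    using tendsto_add[OF 1 2] by simp
  have "((\<lambda>p. ((g p - g p0) - k0 * n' (p - p0)) / norm (p - p0)) \<longlongrightarrow> 0) (at p0)"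
  proof (rule Lim_transform_eventually[OF 3])
    show "\<forall>\<^sub>F p in at p0. k p * (((n p - n p0) - n' (p - p0)) / norm (p - p0))
      + (k p - k0) * (n' (p - p0) / norm (p - p0)) = ((g p - g p0) - k0 * n' (p - p0)) / norm (p - p0)"
      using eq
    proof eventually_elim
      case (elim p)
      have "k p * ((X - Y) / N) + (k p - k0) * (Y / N) = (k p * X - k0 * Y) / N" for X Y N
        by (simp add: diff_divide_distrib right_diff_distrib left_diff_distrib)
      then show ?case unfolding elim .
    qed
  qed
  then show ?thesis
    unfolding has_derivative_at2
    using bounded_linear_mult_right[THEN bounded_linear_compose, OF \<open>bounded_linear n'\<close>]
    by (simp add: divide_inverse mult.commute algebra_simps)
qed

lemma has_derivative_from_remainder:
  fixes g :: "'a::real_normed_vector \<Rightarrow> real"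
  assumes bl: "bounded_linear g'"
    and e: "((\<lambda>p. e p / norm (p - p0)) \<longlongrightarrow> 0) (at p0)"
    and bd: "\<forall>\<^sub>F p in at p0. \<bar>g p - g p0 - g' (p - p0)\<bar> \<le> e p"
  shows "(g has_derivative g') (at p0)"
proof -
  have "((\<lambda>p. (g p - g p0 - g' (p - p0)) / norm (p - p0)) \<longlongrightarrow> 0) (at p0)"
  proof (rule Lim_null_comparison[OF _ e])
    show "\<forall>\<^sub>F p in at p0. norm ((g p - g p0 - g' (p - p0)) / norm (p - p0)) \<le> e p / norm (p - p0)"
      using bd by eventually_elim (auto simp: divide_right_mono)
  qed
  then show ?thesis
    unfolding has_derivative_at2 using bl
    by (simp add: divide_inverse mult.commute algebra_simps)
qed

text \<open>The factor \<open>k p\<close> is \<open>z' p\<close> at an intermediate point of the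
  mean value theorem in the second argument. This point is squeezed to \<open>\<tau> p0\<close>
  together with \<open>\<tau> p\<close>. The hypothesis \<open>lim\<close> is quantified over all
  such \<open>\<xi>\<close> because the intermediate point is not explicit.\<close>

lemma diagonal_quotient:
  fixes z z' :: "'a::real_normed_vector \<Rightarrow> real \<Rightarrow> real"
  assumes dz: "\<forall>\<^sub>F p in at p0. \<forall>x\<in>{0..b}. (z p has_real_derivative z' p x) (at x within {0..b})"
    and lim: "\<And>\<xi>. (\<xi> \<longlongrightarrow> \<tau> p0) (at p0) \<Longrightarrow> ((\<lambda>p. z' p (\<xi> p)) \<longlongrightarrow> l) (at p0)"
    and \<tau>: "(\<tau> \<longlongrightarrow> \<tau> p0) (at p0)" and in_b: "\<tau> p0 \<in> {0<..<b}"
  obtains k where "(k \<longlongrightarrow> l) (at p0)"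
    "\<forall>\<^sub>F p in at p0. z p (\<tau> p) - z p (\<tau> p0) = k p * (\<tau> p - \<tau> p0)"
proof -
  have ev: "\<forall>\<^sub>F p in at p0. \<exists>\<xi>. \<bar>\<xi> - \<tau> p0\<bar> \<le> \<bar>\<tau> p - \<tau> p0\<bar>
      \<and> z p (\<tau> p) - z p (\<tau> p0) = z' p \<xi> * (\<tau> p - \<tau> p0)"
  proof -
    have "\<forall>\<^sub>F p in at p0. 0 < \<tau> p" "\<forall>\<^sub>F p in at p0. \<tau> p < b"
      using order_tendstoD(1)[OF \<tau>, of 0] order_tendstoD(2)[OF \<tau>, of b] in_b by simp_all
    with dz show ?thesis
    proof eventually_elim
      case (elim p)
      have mv: "\<exists>\<xi>\<in>{x<..<y}. z p y - z p x = (y - x) * z' p \<xi>"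
        if "x < y" "0 < x" "y < b" for x y
        using elim(1) that by (intro mvt_within) (auto intro: DERIV_subset[of _ _ _ "{0..b}"])
      consider "\<tau> p = \<tau> p0" | "\<tau> p < \<tau> p0" | "\<tau> p0 < \<tau> p" by linarith
      then show ?case
      proof cases
        case 2
        with mv[of "\<tau> p" "\<tau> p0"] in_b elim obtain \<xi> where
          "\<xi> \<in> {\<tau> p<..<\<tau> p0}" "z p (\<tau> p0) - z p (\<tau> p) = (\<tau> p0 - \<tau> p) * z' p \<xi>" by auto
        then show ?thesis by (intro exI[of _ \<xi>]) (auto simp: algebra_simps)
      next
        case 3
        with mv[of "\<tau> p0" "\<tau> p"] in_b elim obtain \<xi> where
          "\<xi> \<in> {\<tau> p0<..<\<tau> p}" "z p (\<tau> p) - z p (\<tau> p0) = (\<tau> p - \<tau> p0) * z' p \<xi>" by auto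
        then show ?thesis by (intro exI[of _ \<xi>]) (auto simp: algebra_simps)
      qed auto
    qed
  qed
  define \<xi> where "\<xi> = (\<lambda>p. SOME \<xi>. \<bar>\<xi> - \<tau> p0\<bar> \<le> \<bar>\<tau> p - \<tau> p0\<bar>
      \<and> z p (\<tau> p) - z p (\<tau> p0) = z' p \<xi> * (\<tau> p - \<tau> p0))"
  have ev2: "\<forall>\<^sub>F p in at p0. \<bar>\<xi> p - \<tau> p0\<bar> \<le> \<bar>\<tau> p - \<tau> p0\<bar>
      \<and> z p (\<tau> p) - z p (\<tau> p0) = z' p (\<xi> p) * (\<tau> p - \<tau> p0)"
    using ev unfolding \<xi>_def by eventually_elim (rule someI_ex)
  have "((\<lambda>p. \<xi> p - \<tau> p0) \<longlongrightarrow> 0) (at p0)"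
  proof (rule Lim_null_comparison)
    show "\<forall>\<^sub>F p in at p0. norm (\<xi> p - \<tau> p0) \<le> \<bar>\<tau> p - \<tau> p0\<bar>"
      using ev2 by eventually_elim auto
    show "((\<lambda>p. \<bar>\<tau> p - \<tau> p0\<bar>) \<longlongrightarrow> 0) (at p0)"
      by (intro tendsto_rabs_zero LIM_zero \<tau>)
  qed
  then have "(\<xi> \<longlongrightarrow> \<tau> p0) (at p0)" by (rule LIM_zero_cancel)
  from lim[OF this] show thesis
    by (rule that) (use ev2 in \<open>auto elim: eventually_mono\<close>)
qed

text \<open>Unlike the joint chain rule, this needs \<open>z\<close> to be differentiable in \<open>p\<close> only at \<open>p0\<close> and for the
  fixed second argument \<open>\<tau> p0\<close>.\<close>

lemma has_derivative_diagonal: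
  fixes z z' :: "'a::real_normed_vector \<Rightarrow> real \<Rightarrow> real"
  assumes dz: "\<forall>\<^sub>F p in at p0. \<forall>x\<in>{0..b}. (z p has_real_derivative z' p x) (at x within {0..b})"
    and lim: "\<And>\<xi>. (\<xi> \<longlongrightarrow> \<tau> p0) (at p0) \<Longrightarrow> ((\<lambda>p. z' p (\<xi> p)) \<longlongrightarrow> l) (at p0)"
    and zp: "((\<lambda>p. z p (\<tau> p0)) has_derivative d) (at p0)"
    and \<tau>: "(\<tau> has_derivative \<tau>') (at p0)" and in_b: "\<tau> p0 \<in> {0<..<b}"
  shows "((\<lambda>p. z p (\<tau> p)) has_derivative (\<lambda>h. d h + l * \<tau>' h)) (at p0)"
proof -
  have "(\<tau> \<longlongrightarrow> \<tau> p0) (at p0)"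
    using has_derivative_continuous[OF \<tau>] by (simp add: continuous_at)
  from diagonal_quotient[OF dz lim this in_b] obtain k where k: "(k \<longlongrightarrow> l) (at p0)"
    "\<forall>\<^sub>F p in at p0. z p (\<tau> p) - z p (\<tau> p0) = k p * (\<tau> p - \<tau> p0)" .
  have "((\<lambda>p. z p (\<tau> p) - z p (\<tau> p0)) has_derivative (\<lambda>h. l * \<tau>' h)) (at p0)"
    by (rule has_derivative_of_difference_quotient[OF \<tau> k(1)]) (use k(2) in simp)
  from has_derivative_add[OF zp this] show ?thesis by simp
qed

text \<open>Since \<open>z p (\<tau> p) = 0 = z p0 (\<tau> p0)\<close>, the increment of
  \<open>\<tau>\<close> is \<open>- 1 / k p\<close> times the increment of \<open>z\<close> at the
  fixed argument \<open>\<tau> p0\<close>. The zero \<open>\<tau>\<close> is given and continuous at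
  \<open>p0\<close>; only its differentiability is derived.\<close>

lemma has_derivative_implicit_zero:
  fixes z z' :: "'a::real_normed_vector \<Rightarrow> real \<Rightarrow> real"
  assumes dz: "\<forall>\<^sub>F p in at p0. \<forall>x\<in>{0..b}. (z p has_real_derivative z' p x) (at x within {0..b})"
    and lim: "\<And>\<xi>. (\<xi> \<longlongrightarrow> \<tau> p0) (at p0) \<Longrightarrow> ((\<lambda>p. z' p (\<xi> p)) \<longlongrightarrow> l) (at p0)"
    and zp: "((\<lambda>p. z p (\<tau> p0)) has_derivative d) (at p0)"
    and \<tau>: "(\<tau> \<longlongrightarrow> \<tau> p0) (at p0)" and in_b: "\<tau> p0 \<in> {0<..<b}"
    and zero: "z p0 (\<tau> p0) = 0" "\<forall>\<^sub>F p in at p0. z p (\<tau> p) = 0" and "l \<noteq> 0"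
  shows "(\<tau> has_derivative (\<lambda>h. - d h / l)) (at p0)"
proof -
  from diagonal_quotient[OF dz lim \<tau> in_b] obtain k where k: "(k \<longlongrightarrow> l) (at p0)"
    "\<forall>\<^sub>F p in at p0. z p (\<tau> p) - z p (\<tau> p0) = k p * (\<tau> p - \<tau> p0)" .
  have "((\<lambda>p. - 1 / k p) \<longlongrightarrow> - 1 / l) (at p0)"
    by (intro tendsto_intros k \<open>l \<noteq> 0\<close>)
  moreover have "\<forall>\<^sub>F p in at p0. \<tau> p - \<tau> p0 = - 1 / k p * (z p (\<tau> p0) - z p0 (\<tau> p0))"
    using k(2) zero(2) tendsto_imp_eventually_ne[OF k(1) \<open>l \<noteq> 0\<close>]
    by eventually_elim (simp add: zero(1) field_simps)
  ultimately show ?thesis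
    using has_derivative_of_difference_quotient[OF zp, of "\<lambda>p. - 1 / k p" "- 1 / l" \<tau>] by simp
qed

section \<open>Geometry of a single profile\<close>

locale wave_setting =
  fixes f F :: "real \<Rightarrow> real" and \<Omega> :: "(real ^ 3) set"
    and um up :: "real ^ 3 \<Rightarrow> real" and u :: "real ^ 3 \<Rightarrow> real \<Rightarrow> real"
  assumes f_smooth: "Ck 2 f"
    and F_deriv: "\<And>y. (F has_real_derivative f y) (at y)"
    and family: "wave_family f F \<Omega> um up u"
begin

text \<open>This is \<open>- V'\<close>, the force in the Newton form
  \<open>u_xx = accel p u\<close> of the profile equation. The energy \<open>E\<close> does not
  enter it.\<close>

definition accel :: "real ^ 3 \<Rightarrow> real \<Rightarrow> real" where
  "accel p y = p $ 1 + p $ 3 * y - f y"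

abbreviation "V p y \<equiv> potential F y (p $ 1) (p $ 3)"

lemma f_deriv: "(f has_real_derivative deriv f y) (at y)"
  using f_smooth unfolding Ck_def
  by (metis DERIV_deriv_iff_real_differentiable funpow_0 zero_less_numeral)

lemma f'_deriv: "(deriv f has_real_derivative deriv (deriv f) y) (at y)"
proof -
  have "((deriv ^^ 1) f) differentiable (at y)"
    using f_smooth unfolding Ck_def by (metis one_less_numeral_iff semiring_norm(76))
  then show ?thesis by (simp add: DERIV_deriv_iff_real_differentiable)
qed

lemma f''_cont: "continuous_on UNIV (deriv (deriv f))"
  using f_smooth unfolding Ck_def by (simp add: numeral_2_eq_2)

lemma f'_cont: "continuous_on S (deriv f)"
  using f'_deriv by (meson DERIV_isCont continuous_at_imp_continuous_on)

lemma V_deriv: "(V p has_real_derivative - accel p y) (at y)"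
  unfolding potential_def accel_def
  by (auto intro!: derivative_eq_intros F_deriv)

lemma accel_deriv: "(accel p has_real_derivative p $ 3 - deriv f y) (at y)"
  unfolding accel_def by (auto intro!: derivative_eq_intros f_deriv)

lemma accel_lipschitz:
  obtains L where "L \<ge> 0" "\<And>x y. x \<in> {l..r} \<Longrightarrow> y \<in> {l..r} \<Longrightarrow> \<bar>accel p x - accel p y\<bar> \<le> L * \<bar>x - y\<bar>"
proof -
  have "compact ((\<lambda>y. p $ 3 - deriv f y) ` {l..r})"
    by (intro compact_continuous_image continuous_intros f'_cont) auto
  then obtain B where B: "\<And>y. y \<in> {l..r} \<Longrightarrow> \<bar>p $ 3 - deriv f y\<bar> \<le> B"
    using compact_imp_bounded bounded_iff by (metis (no_types, lifting) imageI real_norm_def)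
  have "\<bar>accel p x - accel p y\<bar> \<le> \<bar>B\<bar> * \<bar>x - y\<bar>" if "x \<in> {l..r}" "y \<in> {l..r}" for x y
  proof -
    have "norm (accel p x - accel p y) \<le> \<bar>B\<bar> * norm (x - y)"
    proof (rule field_differentiable_bound[where S = "{l..r}"])
      fix z assume "z \<in> {l..r}"
      then show "norm (p $ 3 - deriv f z) \<le> \<bar>B\<bar>" using B[of z] by simp
    qed (use that in \<open>auto intro: has_field_derivative_at_within accel_deriv\<close>)
    then show ?thesis by simp
  qed
  then show thesis by (intro that[of "\<bar>B\<bar>"]) auto
qed

lemma open_params: "open \<Omega>" and um_cont: "continuous_on \<Omega> um" and up_cont: "continuous_on \<Omega> up"
  using family by (auto simp: wave_family_def)

lemma um_less_up: "p \<in> \<Omega> \<Longrightarrow> um p < up p"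
  and V_less: "p \<in> \<Omega> \<Longrightarrow> um p < y \<Longrightarrow> y < up p \<Longrightarrow> V p y < p $ 2"
  and V_um: "p \<in> \<Omega> \<Longrightarrow> V p (um p) = p $ 2"
  and V_up: "p \<in> \<Omega> \<Longrightarrow> V p (up p) = p $ 2"
  and u_0: "p \<in> \<Omega> \<Longrightarrow> u p 0 = um p"
  and profile: "p \<in> \<Omega> \<Longrightarrow> periodic_profile f F p (u p)"
  using family by (auto simp: wave_family_def simple_root_def)

lemma accel_um_nonzero: "p \<in> \<Omega> \<Longrightarrow> accel p (um p) \<noteq> 0"
  and accel_up_nonzero: "p \<in> \<Omega> \<Longrightarrow> accel p (up p) \<noteq> 0"
  using family DERIV_imp_deriv[OF V_deriv] by (auto simp: wave_family_def simple_root_def)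

text \<open>With the opposite sign \<open>V\<close> would exceed \<open>E\<close> immediately to the
  right of \<open>um p\<close>, inside the well.\<close>

lemma accel_um_pos: assumes p: "p \<in> \<Omega>" shows "accel p (um p) > 0"
proof (rule ccontr)
  assume "\<not> ?thesis"
  then have "- accel p (um p) > 0" using accel_um_nonzero[OF p] by linarith
  from DERIV_pos_inc_right[OF V_deriv this] obtain d where d: "d > 0"
    "\<And>h. 0 < h \<Longrightarrow> h < d \<Longrightarrow> V p (um p) < V p (um p + h)" by blast
  define h where "h = min d (up p - um p) / 2"
  have "0 < h" "h < d" "um p + h < up p"
    using d(1) um_less_up[OF p] by (auto simp: h_def min_def field_simps)
  with d(2)[of h] V_less[OF p, of "um p + h"] V_um[OF p] show False by auto
qed

lemma accel_up_neg: assumes p: "p \<in> \<Omega>" shows "accel p (up p) < 0"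
proof (rule ccontr)
  assume "\<not> ?thesis"
  then have "- accel p (up p) < 0" using accel_up_nonzero[OF p] by linarith
  from DERIV_neg_dec_left[OF V_deriv this] obtain d where d: "d > 0"
    "\<And>h. 0 < h \<Longrightarrow> h < d \<Longrightarrow> V p (up p) < V p (up p - h)" by blast
  define h where "h = min d (up p - um p) / 2"
  have "0 < h" "h < d" "um p < up p - h"
    using d(1) um_less_up[OF p] by (auto simp: h_def min_def field_simps)
  with d(2)[of h] V_less[OF p, of "up p - h"] V_up[OF p] show False by auto
qed

lemma u_deriv: assumes "p \<in> \<Omega>" shows "(u p has_real_derivative deriv (u p) x) (at x)"
  using profile[OF assms] unfolding periodic_profile_def Ck_def
  by (metis DERIV_deriv_iff_real_differentiable funpow_0 zero_less_numeral)

lemma energy: assumes "p \<in> \<Omega>" shows "(deriv (u p) x)\<^sup>2 / 2 = p $ 2 - V p (u p x)"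
  using profile[OF assms] unfolding periodic_profile_def by blast

text \<open>The third-order equation integrates to \<open>u_xx + f(u) - c u = k\<close>. The
  constant is identified as \<open>a\<close> by differentiating the energy relation at a point where
  \<open>u_x\<close> does not vanish; such a point exists because the profile is not
  constant.\<close>

lemma u_deriv2: assumes p: "p \<in> \<Omega>"
  shows "(deriv (u p) has_real_derivative accel p (u p x)) (at x)"
proof -
  let ?u = "u p"
  have Ck: "Ck 3 ?u" and ode: "\<And>x. (deriv ^^ 3) ?u x + deriv (\<lambda>y. f (?u y)) x - p $ 3 * deriv ?u x = 0"
    and nc: "\<not> (\<exists>k. \<forall>x. ?u x = k)"
    using profile[OF p] unfolding periodic_profile_def by blast+
  have "((deriv ^^ j) ?u) differentiable (at x)" if "j < 3" for j x
    using Ck that unfolding Ck_def by blast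
  from this[of 1] this[of 2] have d2: "(deriv ?u has_real_derivative deriv (deriv ?u) x) (at x)"
    and d3: "(deriv (deriv ?u) has_real_derivative (deriv ^^ 3) ?u x) (at x)" for x
    by (simp_all add: DERIV_deriv_iff_real_differentiable numeral_3_eq_3 numeral_2_eq_2)
  note d1 = u_deriv[OF p]
  have fu: "((\<lambda>y. f (?u y)) has_real_derivative deriv f (?u x) * deriv ?u x) (at x)" for x
    by (rule DERIV_chain2[OF f_deriv d1])
  have "\<forall>x. ((\<lambda>x. deriv (deriv ?u) x + f (?u x) - p $ 3 * ?u x) has_real_derivative 0) (at x)"
    using ode by (auto intro!: derivative_eq_intros d3 d1 fu simp: DERIV_imp_deriv[OF fu])
  from DERIV_isconst_all[OF this, of _ 0]
  obtain k where k: "\<And>x. deriv (deriv ?u) x + f (?u x) - p $ 3 * ?u x = k" by blast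
  obtain x1 where x1: "deriv ?u x1 \<noteq> 0"
    using DERIV_isconst_all[of ?u] d1 nc by metis
  have "((\<lambda>x. (deriv ?u x)\<^sup>2 / 2) has_real_derivative deriv ?u x1 * deriv (deriv ?u) x1) (at x1)"
    by (auto intro!: derivative_eq_intros d2)
  moreover have "((\<lambda>x. p $ 2 - V p (?u x)) has_real_derivative 0 - (- accel p (?u x1)) * deriv ?u x1) (at x1)"
    by (intro DERIV_diff DERIV_const DERIV_chain2[OF V_deriv d1])
  ultimately have "deriv ?u x1 * deriv (deriv ?u) x1 = accel p (?u x1) * deriv ?u x1"
    using energy[OF p] by (auto dest: DERIV_unique)
  with x1 k[of x1] have "k = p $ 1" by (auto simp: accel_def)
  with k[of x] have "deriv (deriv ?u) x = accel p (?u x)" by (simp add: accel_def)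
  with d2[of x] show ?thesis by simp
qed

lemma u_cont: "p \<in> \<Omega> \<Longrightarrow> continuous_on S (u p)"
  using u_deriv by (meson DERIV_isCont continuous_at_imp_continuous_on)

lemma u'_cont: "p \<in> \<Omega> \<Longrightarrow> continuous_on S (deriv (u p))"
  using u_deriv2 by (meson DERIV_isCont continuous_at_imp_continuous_on)

lemma u'_0: "p \<in> \<Omega> \<Longrightarrow> deriv (u p) 0 = 0"
  using energy[of p 0] by (simp add: u_0 V_um)

lemma V_u_le: "p \<in> \<Omega> \<Longrightarrow> V p (u p x) \<le> p $ 2"
  using energy[of p x] by (smt (verit) divide_nonneg_pos zero_le_power2)

lemma u_connected: "p \<in> \<Omega> \<Longrightarrow> connected (range (u p))"
  by (intro connected_continuous_image u_cont) auto

text \<open>The range of the profile is an interval containing \<open>um p\<close>, and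
  \<open>V \<le> E\<close> on it. As \<open>V\<close> exceeds \<open>E\<close> just below
  \<open>um p\<close>, the range cannot extend to that side.\<close>

lemma u_ge_um: assumes p: "p \<in> \<Omega>" shows "um p \<le> u p x"
proof (rule ccontr)
  assume "\<not> um p \<le> u p x"
  have "- accel p (um p) < 0" using accel_um_pos[OF p] by simp
  from DERIV_neg_dec_left[OF V_deriv this] obtain d where d: "d > 0"
    "\<And>h. 0 < h \<Longrightarrow> h < d \<Longrightarrow> V p (um p) < V p (um p - h)" by blast
  define h where "h = min (d / 2) (um p - u p x)"
  have h: "0 < h" "h < d" "um p - h \<in> {u p x..um p}"
    using d(1) \<open>\<not> um p \<le> u p x\<close> by (auto simp: h_def min_def)
  have "{u p x..um p} \<subseteq> range (u p)"
    using u_0[OF p] by (intro connected_contains_Icc u_connected[OF p]) (auto intro: range_eqI[of _ _ 0])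
  with h obtain y where "um p - h = u p y" by blast
  with d(2)[OF h(1,2)] V_u_le[OF p, of y] V_um[OF p] show False by simp
qed

lemma u_le_up: assumes p: "p \<in> \<Omega>" shows "u p x \<le> up p"
proof (rule ccontr)
  assume *: "\<not> u p x \<le> up p"
  have "- accel p (up p) > 0" using accel_up_neg[OF p] by simp
  from DERIV_pos_inc_right[OF V_deriv this] obtain d where d: "d > 0"
    "\<And>h. 0 < h \<Longrightarrow> h < d \<Longrightarrow> V p (up p) < V p (up p + h)" by blast
  define h where "h = min (d / 2) (u p x - up p)"
  have h: "0 < h" "h < d" "up p + h \<in> {um p..u p x}"
    using d(1) * um_less_up[OF p] by (auto simp: h_def min_def)
  have "{um p..u p x} \<subseteq> range (u p)"
    using u_0[OF p] by (intro connected_contains_Icc u_connected[OF p]) (auto intro: range_eqI[of _ _ 0])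
  with h obtain y where "up p + h = u p y" by blast
  with d(2)[OF h(1,2)] V_u_le[OF p, of y] V_up[OF p] show False by simp
qed

text \<open>Periodicity provides a positive zero of \<open>u_x\<close>, so there is a first one. Up
  to it the profile increases, and there the energy relation gives \<open>V = E\<close>; above
  \<open>um p\<close> and up to \<open>up p\<close> this level is attained only at
  \<open>up p\<close>.\<close>

lemma first_turning_point:
  assumes p: "p \<in> \<Omega>"
  obtains \<tau> where "\<tau> > 0" "\<And>x. 0 < x \<Longrightarrow> x < \<tau> \<Longrightarrow> deriv (u p) x > 0" "deriv (u p) \<tau> = 0" "u p \<tau> = up p"
proof -
  let ?u' = "deriv (u p)"
  have "accel p (u p 0) > 0" using accel_um_pos[OF p] by (simp add: u_0[OF p])
  from DERIV_pos_inc_right[OF u_deriv2[OF p] this] obtain d where d: "d > 0"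
    "\<And>h. 0 < h \<Longrightarrow> h < d \<Longrightarrow> ?u' h > 0" using u'_0[OF p] by auto
  \<comment> \<open>The lower bound \<open>d / 2\<close> removes the zero at \<open>x = 0\<close>
    and keeps the set closed; on \<open>(0, d)\<close> the derivative is positive, so no positive
    zero is lost.\<close>
  define S where "S = {x. d / 2 \<le> x \<and> ?u' x = 0}"
  obtain L where L: "L > 0" "\<And>x. u p (x + L) = u p x"
    using profile[OF p] unfolding periodic_profile_def by blast
  have "((\<lambda>x. u p (x + L)) has_real_derivative ?u' (0 + L)) (at 0)"
    using u_deriv[OF p, of "0 + L"] DERIV_shift by blast
  then have "?u' L = 0"
    using L(2) u_deriv[OF p, of 0] u'_0[OF p] by (auto dest: DERIV_unique)
  then have "L \<in> S" using d(2)[of L] L(1) by (cases "L < d") (auto simp: S_def)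
  have "closed S" unfolding S_def
    by (intro closed_Collect_conj closed_Collect_le closed_Collect_eq continuous_intros u'_cont[OF p])
  have bdd: "bdd_below S" by (rule bdd_belowI[of _ "d / 2"]) (simp add: S_def)
  define \<tau> where "\<tau> = Inf S"
  have "\<tau> \<in> S" unfolding \<tau>_def using \<open>L \<in> S\<close> bdd \<open>closed S\<close> by (intro closed_contains_Inf) auto
  then have \<tau>: "\<tau> > 0" "?u' \<tau> = 0" using d(1) by (auto simp: S_def)
  have min: "\<tau> \<le> x" if "x \<in> S" for x unfolding \<tau>_def by (intro cInf_lower that bdd)
  have pos: "?u' x > 0" if "0 < x" "x < \<tau>" for x
  proof (rule ccontr)
    assume neg: "\<not> deriv (u p) x > 0"
    then have "d / 2 \<le> x" using d that by force
    moreover have "?u' (d / 2) > 0" using d by auto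
    ultimately obtain y where "d / 2 \<le> y" "y \<le> x" "?u' y = 0"
      using IVT2'[of ?u' x 0 "d / 2"] u'_cont[OF p] neg by auto
    then show False using min[of y] that by (auto simp: S_def)
  qed
  have "u p 0 < u p \<tau>"
    using \<tau>(1) pos u_deriv[OF p] u_cont[OF p]
    by (intro DERIV_pos_imp_increasing_open[OF \<tau>(1)]) blast+
  moreover have "V p (u p \<tau>) = p $ 2" using energy[OF p, of \<tau>] \<tau>(2) by simp
  ultimately have "u p \<tau> = up p"
    using V_less[OF p, of "u p \<tau>"] u_le_up[OF p, of \<tau>] u_0[OF p] by force
  with \<tau> pos show thesis by (intro that[of \<tau>]) auto
qed

text \<open>Substitution \<open>y = u(x)\<close> on the rising half of the wave: the inverse
  \<open>g\<close> has derivative \<open>1 / (sqrt 2 * sqrt (E - V))\<close>. The fundamental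
  theorem is used in the form that asks for continuity on the closed interval and differentiability
  only inside, since \<open>g\<close> has infinite slope at the turning values.\<close>

lemma wave_period_eq:
  assumes p: "p \<in> \<Omega>" and \<tau>: "\<tau> > 0" "\<And>x. 0 < x \<Longrightarrow> x < \<tau> \<Longrightarrow> deriv (u p) x > 0" "u p \<tau> = up p"
  shows "wave_period F um up p = 2 * \<tau>"
proof -
  have mono: "u p x < u p y" if "0 \<le> x" "x < y" "y \<le> \<tau>" for x y
    using that \<tau> u_deriv[OF p] u_cont[OF p]
    by (intro DERIV_pos_imp_increasing_open[OF \<open>x < y\<close>]) (meson dual_order.strict_trans1 dual_order.strict_trans2)+
  have inj: "inj_on (u p) {0..\<tau>}"
    by (intro linorder_inj_onI) (use mono in fastforce)+
  have img: "u p ` {0..\<tau>} = {um p..up p}"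
  proof
    show "u p ` {0..\<tau>} \<subseteq> {um p..up p}" using u_ge_um[OF p] u_le_up[OF p] by auto
    show "{um p..up p} \<subseteq> u p ` {0..\<tau>}"
      using \<tau> IVT'[of "u p" 0 _ \<tau>] u_cont[OF p] u_0[OF p] by (force simp: image_iff)
  qed
  define g where "g = inv_into {0..\<tau>} (u p)"
  have g: "g y \<in> {0..\<tau>}" "u p (g y) = y" if "y \<in> {um p..up p}" for y
    using that unfolding g_def img[symmetric] by (auto intro: inv_into_into f_inv_into_f simp del: atLeastAtMost_iff)
  have gcont: "continuous_on {um p..up p} g"
    unfolding g_def img[symmetric]
    by (intro continuous_on_inv u_cont[OF p]) (auto intro: inv_into_f_f[OF inj])
  have "((\<lambda>y. 1 / sqrt 2 * (1 / sqrt (p $ 2 - V p y))) has_integral (g (up p) - g (um p))) {um p..up p}"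
  proof (rule fundamental_theorem_of_calculus_interior[OF _ gcont])
    fix y assume y: "y \<in> {um p<..<up p}"
    then have gy: "g y \<in> {0..\<tau>}" "u p (g y) = y" using g by auto
    have "g y \<noteq> 0" "g y \<noteq> \<tau>" using gy(2) y u_0[OF p] \<tau>(3) by auto
    with gy have pos: "deriv (u p) (g y) > 0" by (intro \<tau>) auto
    have "(deriv (u p) (g y))\<^sup>2 = 2 * (p $ 2 - V p y)" using energy[OF p, of "g y"] gy by auto
    then have eq: "deriv (u p) (g y) = sqrt 2 * sqrt (p $ 2 - V p y)"
      using pos real_sqrt_unique[of "deriv (u p) (g y)"] unfolding real_sqrt_mult[symmetric] by simp
    have "isCont g y"
      using y gcont by (auto intro!: continuous_on_interior[OF gcont])
    then have "(g has_real_derivative inverse (deriv (u p) (g y))) (at y)"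
      using y pos g(2) by (intro DERIV_inverse_function[OF u_deriv[OF p], of _ _ "um p" "up p"]) auto
    then show "(g has_vector_derivative 1 / sqrt 2 * (1 / sqrt (p $ 2 - V p y))) (at y)"
      unfolding eq by (simp add: has_real_derivative_iff_has_vector_derivative divide_inverse)
  qed (use um_less_up[OF p] in auto)
  moreover have "g (up p) = \<tau>" "g (um p) = 0"
    unfolding g_def using inj \<tau> u_0[OF p] by (auto simp flip: \<tau>(3) u_0[OF p] intro!: inv_into_f_f)
  ultimately have "((\<lambda>y. sqrt 2 * (1 / sqrt 2 * (1 / sqrt (p $ 2 - V p y)))) has_integral sqrt 2 * \<tau>) {um p..up p}"
    by (intro has_integral_mult_right) auto
  then have "integral {um p..up p} (\<lambda>y. 1 / sqrt (p $ 2 - V p y)) = sqrt 2 * \<tau>"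
    by (intro integral_unique) simp
  then show ?thesis unfolding wave_period_def by simp
qed

text \<open>The profile is even about a turning point. The odd part of \<open>u\<close> and the even
  part of \<open>u_x\<close> about \<open>\<tau>\<close> satisfy a homogeneous Gronwall inequality
  with zero initial data, hence vanish; evaluation at distance \<open>\<tau>\<close> transports the
  data at \<open>0\<close> to \<open>2 * \<tau>\<close>.\<close>

lemma reflection:
  assumes p: "p \<in> \<Omega>" and \<tau>: "\<tau> > 0" "deriv (u p) \<tau> = 0"
  shows "u p (2 * \<tau>) = um p" "deriv (u p) (2 * \<tau>) = 0"
proof -
  obtain L where L: "L \<ge> 0" "\<And>x y. x \<in> {um p..up p} \<Longrightarrow> y \<in> {um p..up p} \<Longrightarrow> \<bar>accel p x - accel p y\<bar> \<le> L * \<bar>x - y\<bar>"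
    using accel_lipschitz by metis
  define z where "z x = (u p (\<tau> + x) - u p (\<tau> - x), deriv (u p) (\<tau> + x) + deriv (u p) (\<tau> - x))" for x
  define z' where "z' x = (deriv (u p) (\<tau> + x) + deriv (u p) (\<tau> - x), accel p (u p (\<tau> + x)) - accel p (u p (\<tau> - x)))" for x
  have "norm (z \<tau>) \<le> exp ((2 * \<bar>1 + L\<bar> + 1) * \<tau>) * (1 + \<tau>) * (norm (z 0) + 0)"
  proof (rule gronwall_norm)
    fix x assume "x \<in> {0..\<tau>}"
    have "((\<lambda>x. u p (\<tau> + x) - u p (\<tau> - x)) has_real_derivative deriv (u p) (\<tau> + x) * 1 - deriv (u p) (\<tau> - x) * (- 1)) (at x within {0..\<tau>})"
      by (intro DERIV_diff DERIV_chain2[OF u_deriv[OF p]]) (auto intro!: derivative_eq_intros)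
    moreover have "((\<lambda>x. deriv (u p) (\<tau> + x) + deriv (u p) (\<tau> - x)) has_real_derivative accel p (u p (\<tau> + x)) * 1 + accel p (u p (\<tau> - x)) * (- 1)) (at x within {0..\<tau>})"
      by (intro DERIV_add DERIV_chain2[OF u_deriv2[OF p]]) (auto intro!: derivative_eq_intros)
    ultimately show "(z has_vector_derivative z' x) (at x within {0..\<tau>})"
      unfolding z_def z'_def has_real_derivative_iff_has_vector_derivative
      by (intro has_vector_derivative_Pair) auto
    have "norm (z' x) \<le> \<bar>fst (z' x)\<bar> + \<bar>snd (z' x)\<bar>"
      using norm_Pair_le[of "fst (z' x)" "snd (z' x)"] by simp
    also have "\<dots> \<le> \<bar>snd (z x)\<bar> + L * \<bar>fst (z x)\<bar>"
      using L(2)[of "u p (\<tau> + x)" "u p (\<tau> - x)"] u_ge_um[OF p] u_le_up[OF p] by (simp add: z_def z'_def)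
    also have "\<dots> \<le> norm (z x) + L * norm (z x)"
      using L(1) norm_fst_le[of "fst (z x)" "snd (z x)"] norm_snd_le[of "snd (z x)" "fst (z x)"]
      by (intro add_mono mult_left_mono) auto
    finally show "norm (z' x) \<le> (1 + L) * norm (z x) + 0" by (simp add: algebra_simps)
  qed (use \<tau> in auto)
  then have "z \<tau> = 0" by (simp add: z_def \<tau>)
  then have "u p (\<tau> + \<tau>) = u p 0" "deriv (u p) (\<tau> + \<tau>) = - deriv (u p) 0"
    unfolding z_def zero_prod_def by simp_all
  then show "u p (2 * \<tau>) = um p" "deriv (u p) (2 * \<tau>) = 0"
    unfolding mult_2 u_0[OF p] u'_0[OF p] by simp_all
qed

end

section \<open>Variational equation\<close>

text \<open>The equation has no first-order term, so the Wronskian keeps its initial value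
  \<open>1\<close> and the particular solution with zero data is \<open>\<phi>2\<close> times the
  integral of \<open>\<phi>1 g\<close> minus \<open>\<phi>1\<close> times the integral of
  \<open>\<phi>2 g\<close>.\<close>

lemma variation_of_constants:
  fixes \<phi>1 \<phi>2 g q :: "real \<Rightarrow> real"
  assumes d: "\<And>x. x \<in> {0..b} \<Longrightarrow> (\<phi>1 has_real_derivative \<phi>1' x) (at x within {0..b})"
      "\<And>x. x \<in> {0..b} \<Longrightarrow> (\<phi>2 has_real_derivative \<phi>2' x) (at x within {0..b})"
      "\<And>x. x \<in> {0..b} \<Longrightarrow> (\<phi>1' has_real_derivative q x * \<phi>1 x) (at x within {0..b})"
      "\<And>x. x \<in> {0..b} \<Longrightarrow> (\<phi>2' has_real_derivative q x * \<phi>2 x) (at x within {0..b})"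
    and init: "\<phi>1 0 = 1" "\<phi>1' 0 = 0" "\<phi>2 0 = 0" "\<phi>2' 0 = 1"
    and g: "continuous_on {0..b} g"
  obtains v v' where "v 0 = 0" "v' 0 = 0"
    "\<And>x. x \<in> {0..b} \<Longrightarrow> (v has_real_derivative v' x) (at x within {0..b})"
    "\<And>x. x \<in> {0..b} \<Longrightarrow> (v' has_real_derivative q x * v x + g x) (at x within {0..b})"
proof -
  define W where "W = (\<lambda>x. \<phi>1 x * \<phi>2' x - \<phi>1' x * \<phi>2 x)"
  have W: "W x = 1" if "x \<in> {0..b}" for x
  proof -
    have "(W has_real_derivative 0) (at x within {0..b})" if "x \<in> {0..b}" for x
    proof -
      from DERIV_diff[OF DERIV_mult[OF d(1) d(4)] DERIV_mult[OF d(3) d(2)], OF that that that that]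
      show ?thesis unfolding W_def by (simp add: algebra_simps)
    qed
    then obtain c where "\<And>x. x \<in> {0..b} \<Longrightarrow> W x = c"
      using has_field_derivative_zero_constant[of "{0..b}" W] by (auto simp del: atLeastAtMost_iff)
    then have "W x = W 0" using that by auto
    then show ?thesis by (simp add: W_def init)
  qed
  have cont: "continuous_on {0..b} \<phi>1" "continuous_on {0..b} \<phi>2"
    using DERIV_continuous_on[OF d(1)] DERIV_continuous_on[OF d(2)] by blast+
  define G1 where "G1 = (\<lambda>x. integral {0..x} (\<lambda>t. \<phi>1 t * g t))"
  define G2 where "G2 = (\<lambda>x. integral {0..x} (\<lambda>t. \<phi>2 t * g t))"
  have G: "(G1 has_real_derivative \<phi>1 x * g x) (at x within {0..b})"
      "(G2 has_real_derivative \<phi>2 x * g x) (at x within {0..b})" if "x \<in> {0..b}" for x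
    unfolding G1_def G2_def
    by (intro integral_has_real_derivative continuous_intros cont g that)+
  define v where "v = (\<lambda>x. \<phi>2 x * G1 x - \<phi>1 x * G2 x)"
  define v' where "v' = (\<lambda>x. \<phi>2' x * G1 x - \<phi>1' x * G2 x)"
  show thesis
  proof (rule that)
    show "v 0 = 0" "v' 0 = 0" by (simp_all add: v_def v'_def G1_def G2_def)
    fix x assume x: "x \<in> {0..b}"
    show "(v has_real_derivative v' x) (at x within {0..b})"
      unfolding v_def v'_def
      by (auto intro!: derivative_eq_intros d G x simp: algebra_simps)
    have "(v' has_real_derivative q x * v x + W x * g x) (at x within {0..b})"
      unfolding v'_def v_def W_def
      by (auto intro!: derivative_eq_intros d G x simp: algebra_simps)
    then show "(v' has_real_derivative q x * v x + g x) (at x within {0..b})"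
      by (simp add: W[OF x])
  qed
qed

section \<open>The period as twice the first turning time\<close>

context wave_setting
begin

definition period :: "real ^ 3 \<Rightarrow> real" where
  "period p = wave_period F um up p"

text \<open>Connects the integral that defines the period with the motion: half a period is the
  first turning time. From here on the period is handled as a zero of \<open>u_x\<close>.\<close>

lemma period_facts:
  assumes "p \<in> \<Omega>"
  shows period_pos: "period p > 0" and u_period: "u p (period p) = um p"
    and u'_period: "deriv (u p) (period p) = 0"
    and u'_pos: "0 < x \<Longrightarrow> x < period p / 2 \<Longrightarrow> deriv (u p) x > 0"
    and u_half_period: "u p (period p / 2) = up p" and u'_half_period: "deriv (u p) (period p / 2) = 0"
proof -
  obtain \<tau> where \<tau>: "\<tau> > 0" "\<And>x. 0 < x \<Longrightarrow> x < \<tau> \<Longrightarrow> deriv (u p) x > 0"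
      "deriv (u p) \<tau> = 0" "u p \<tau> = up p"
    using first_turning_point[OF assms] by metis
  have "period p = 2 * \<tau>"
    unfolding period_def by (rule wave_period_eq[OF assms \<tau>(1,2,4)])
  with \<tau> reflection[OF assms \<tau>(1,3)]
  show "period p > 0" "u p (period p) = um p" "deriv (u p) (period p) = 0"
    "0 < x \<Longrightarrow> x < period p / 2 \<Longrightarrow> deriv (u p) x > 0"
    "u p (period p / 2) = up p" "deriv (u p) (period p / 2) = 0" by simp_all
qed

end

locale wave_point = wave_setting +
  fixes p0 :: "real ^ 3"
  assumes p0: "p0 \<in> \<Omega>"
begin

abbreviation "U \<equiv> u p0"
abbreviation "U' \<equiv> deriv (u p0)"
abbreviation "T0 \<equiv> period p0"

text \<open>The margin \<open>1\<close> beyond the period keeps the periods of nearby waves, and all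
  intermediate points, inside the interval on which estimates are uniform.\<close>

definition b :: real where "b = period p0 + 1"
text \<open>The potential of the linearized operator: \<open>L[u0] v = - v_xx + q v\<close>.\<close>

definition q :: "real \<Rightarrow> real" where "q x = p0 $ 3 - deriv f (U x)"
definition q' :: "real \<Rightarrow> real" where "q' x = - (deriv (deriv f) (U x) * U' x)"
definition g :: real where "g = accel p0 (um p0)"
text \<open>Obtained by differentiating \<open>V(um; a, c) = E\<close> in the direction
  \<open>h\<close>, where \<open>V'\<close> at the root is \<open>- g\<close>.\<close>

definition um' :: "real ^ 3 \<Rightarrow> real" where
  "um' h = - (h $ 1 * um p0 + h $ 3 * (um p0)\<^sup>2 / 2 + h $ 2) / g"

lemma g_pos: "g > 0" unfolding g_def by (rule accel_um_pos[OF p0])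

lemma q_deriv: "(q has_real_derivative q' x) (at x within S)"
  unfolding q_def q'_def
  by (rule has_field_derivative_at_within)
    (auto intro!: derivative_eq_intros DERIV_chain2[OF f'_deriv u_deriv[OF p0]])

lemma um_isCont: "isCont um p0" and up_isCont: "isCont up p0"
  using um_cont up_cont p0 by (simp_all add: continuous_on_eq_continuous_at[OF open_params])

lemma eventually_params: "\<forall>\<^sub>F p in at p0. p \<in> \<Omega>"
  using eventually_at_in_open'[OF open_params p0] .

lemma um'_linear: "bounded_linear um'"
  unfolding linear_conv_bounded_linear[symmetric] um'_def
  by (rule linearI) (simp_all add: add_divide_distrib diff_divide_distrib algebra_simps)

text \<open>The Caratheodory factor \<open>Q\<close> of \<open>V p0\<close> at the root writes
  \<open>Q (um p) * (um p - um p0)\<close> as an explicit function of the parameter increments.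
  Continuity of \<open>um\<close> makes \<open>Q (um p)\<close> tend to \<open>- g\<close>, which
  can be divided out.\<close>

lemma um_has_derivative: "(um has_derivative um') (at p0)"
proof -
  from V_deriv[of p0 "um p0", folded g_def] obtain Q where Q:
    "\<And>y. V p0 y - V p0 (um p0) = Q y * (y - um p0)" "isCont Q (um p0)" "Q (um p0) = - g"
    unfolding CARAT_DERIV by auto
  have um: "(um \<longlongrightarrow> um p0) (at p0)" using um_isCont by (simp add: isCont_def)
  have Qum: "((\<lambda>p. Q (um p)) \<longlongrightarrow> - g) (at p0)"
    using isCont_tendsto_compose[OF Q(2) um] by (simp add: Q(3))
  have k: "((\<lambda>p. 1 / Q (um p)) \<longlongrightarrow> 1 / (- g)) (at p0)"
    using g_pos by (intro tendsto_intros Qum) auto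
  \<comment> \<open>Here \<open>um\<close> is known only to be continuous, but its coefficient
    vanishes at \<open>p0\<close>, so the product is differentiable there. The same holds for
    \<open>n3\<close>.\<close>
  define n1 where "n1 = (\<lambda>p. (p $ 1 - p0 $ 1) * um p)"
  define n3 where "n3 = (\<lambda>p. (p $ 3 - p0 $ 3) * ((um p)\<^sup>2 / 2))"
  have n1: "(n1 has_derivative (\<lambda>h. um p0 * h $ 1)) (at p0)"
    by (rule has_derivative_of_difference_quotient[where n = "\<lambda>p. p $ 1" and k = um])
      (auto simp: n1_def intro!: um derivative_eq_intros bounded_linear_imp_has_derivative)
  have n3: "(n3 has_derivative (\<lambda>h. (um p0)\<^sup>2 / 2 * h $ 3)) (at p0)"
    by (rule has_derivative_of_difference_quotient[where n = "\<lambda>p. p $ 3" and k = "\<lambda>p. (um p)\<^sup>2 / 2"])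
      (auto simp: n3_def intro!: um tendsto_intros derivative_eq_intros bounded_linear_imp_has_derivative)
  have n2: "((\<lambda>p. p $ 2) has_derivative (\<lambda>h. h $ 2)) (at p0)"
    by (auto intro!: bounded_linear_imp_has_derivative)
  have n: "((\<lambda>p. n1 p + n3 p + p $ 2) has_derivative (\<lambda>h. um p0 * h $ 1 + (um p0)\<^sup>2 / 2 * h $ 3 + h $ 2)) (at p0)"
    by (intro has_derivative_add n1 n2 n3)
  have "(um has_derivative (\<lambda>h. 1 / (- g) * (um p0 * h $ 1 + (um p0)\<^sup>2 / 2 * h $ 3 + h $ 2))) (at p0)"
  proof (rule has_derivative_of_difference_quotient[OF n k])
    have "\<forall>\<^sub>F p in at p0. Q (um p) \<noteq> 0"
      using g_pos by (intro tendsto_imp_eventually_ne[OF Qum]) auto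
    with eventually_params
    show "\<forall>\<^sub>F p in at p0. um p - um p0 = 1 / Q (um p) * (n1 p + n3 p + p $ 2 - (n1 p0 + n3 p0 + p0 $ 2))"
    proof eventually_elim
      case (elim p)
      have "Q (um p) * (um p - um p0) = n1 p + n3 p + p $ 2 - p0 $ 2"
        using Q(1)[of "um p"] V_um[OF elim(1)] V_um[OF p0]
        by (simp add: potential_def n1_def n3_def algebra_simps)
      then show ?case using elim(2) by (simp add: n1_def n3_def field_simps)
    qed
  qed
  moreover have "(\<lambda>h. 1 / (- g) * (um p0 * h $ 1 + (um p0)\<^sup>2 / 2 * h $ 3 + h $ 2)) = um'"
    by (auto simp: um'_def fun_eq_iff field_simps)
  ultimately show ?thesis by simp
qed

lemma spectral_matrix_vec:
  "spectral_matrix f U (p0 $ 3) x \<mu> *v y =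
     vector [y $ 2, y $ 3, (- \<mu> + of_real (q' x)) * y $ 1 + of_real (q x) * y $ 2]"
proof -
  have "deriv (\<lambda>y. deriv f (U y)) x = - q' x"
    unfolding q'_def using DERIV_imp_deriv[OF DERIV_chain2[OF f'_deriv u_deriv[OF p0]]] by simp
  then show ?thesis
    by (simp add: spectral_matrix_def vec_eq_iff forall_3 matrix_vector_mult_def sum_3 q_def)
qed

lemma fundamental_solution_vec:
  assumes "is_fundamental_solution (spectral_matrix f U (p0 $ 3)) \<Phi>"
  shows "((\<lambda>x. \<Phi> x \<mu> *v y) has_vector_derivative
    (let Y = \<Phi> x \<mu> *v y in
      vector [Y $ 2, Y $ 3, (- \<mu> + of_real (q' x)) * Y $ 1 + of_real (q x) * Y $ 2])) (at x within S)"
    "\<Phi> 0 \<mu> *v y = y"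
proof -
  have \<Phi>: "\<Phi> 0 \<mu> = mat 1" "((\<lambda>x. \<Phi> x \<mu>) has_vector_derivative
      (spectral_matrix f U (p0 $ 3) x \<mu> ** \<Phi> x \<mu>)) (at x)"
    using assms unfolding is_fundamental_solution_def by blast+
  show "\<Phi> 0 \<mu> *v y = y" by (simp add: \<Phi>)
  have "linear (\<lambda>A::complex^3^3. A *v y)"
    by (auto intro!: linearI simp: matrix_vector_mult_add_rdistrib vec_eq_iff matrix_vector_mult_def
        scaleR_sum_right sum.distrib distrib_right)
  then have "bounded_linear (\<lambda>A::complex^3^3. A *v y)" by (simp add: linear_conv_bounded_linear)
  from bounded_linear.has_vector_derivative[OF this \<Phi>(2)]
  show "((\<lambda>x. \<Phi> x \<mu> *v y) has_vector_derivative
    (let Y = \<Phi> x \<mu> *v y in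
      vector [Y $ 2, Y $ 3, (- \<mu> + of_real (q' x)) * Y $ 1 + of_real (q x) * Y $ 2])) (at x within S)"
    by (auto simp: matrix_vector_mul_assoc[symmetric] spectral_matrix_vec Let_def
        intro: has_vector_derivative_at_within)
qed

text \<open>At eigenvalue zero the spectral problem says that \<open>L[u0] v = q v - v_xx\<close> is
  constant. Solutions on which this constant is zero solve the second-order equation, and they can
  be read off from \<open>\<Phi>\<close>.\<close>

lemma homogeneous_solution:
  assumes "is_fundamental_solution (spectral_matrix f U (p0 $ 3)) \<Phi>"
  obtains v v' where "v 0 = \<alpha>" "v' 0 = \<beta>"
    "\<And>x. (v has_real_derivative v' x) (at x within S)"
    "\<And>x. (v' has_real_derivative q x * v x) (at x within S)"
proof -
  \<comment> \<open>The third initial component \<open>q 0 * \<alpha>\<close> is chosen so that the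
    conserved quantity \<open>v_xx - q v\<close> starts, and therefore stays, at zero.\<close>
  define y where "y = (vector [of_real \<alpha>, of_real \<beta>, of_real (q 0 * \<alpha>)] :: complex ^ 3)"
  define Y where "Y x = \<Phi> x 0 *v y" for x
  have bl: "bounded_linear (\<lambda>Y::complex^3. Re (Y $ i))" for i
    by (intro bounded_linear_compose[OF bounded_linear_Re] bounded_linear_vec_nth)
  have dY: "(Y has_vector_derivative
      vector [Y x $ 2, Y x $ 3, of_real (q' x) * Y x $ 1 + of_real (q x) * Y x $ 2]) (at x within S)" for x S
    using fundamental_solution_vec(1)[OF assms, of 0 y] unfolding Y_def Let_def by simp
  have d: "((\<lambda>x. Re (Y x $ i)) has_real_derivative
      Re (vector [Y x $ 2, Y x $ 3, of_real (q' x) * Y x $ 1 + of_real (q x) * Y x $ 2] $ i)) (at x within S)" for x i S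
    using bounded_linear.has_vector_derivative[OF bl dY]
    unfolding has_real_derivative_iff_has_vector_derivative .
  have Y0: "Y 0 = y" unfolding Y_def by (rule fundamental_solution_vec(2)[OF assms])
  have "\<forall>x. ((\<lambda>x. Re (Y x $ 3) - q x * Re (Y x $ 1)) has_real_derivative 0) (at x)"
  proof
    fix x
    have "((\<lambda>x. Re (Y x $ 1)) has_real_derivative Re (Y x $ 2)) (at x)"
      "((\<lambda>x. Re (Y x $ 3)) has_real_derivative q' x * Re (Y x $ 1) + q x * Re (Y x $ 2)) (at x)"
      using d[of 1 x UNIV] d[of 3 x UNIV] by simp_all
    from DERIV_diff[OF this(2) DERIV_mult[OF q_deriv this(1)]]
    show "((\<lambda>x. Re (Y x $ 3) - q x * Re (Y x $ 1)) has_real_derivative 0) (at x)"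
      by (simp add: algebra_simps)
  qed
  from DERIV_isconst_all[OF this] have "Re (Y x $ 3) - q x * Re (Y x $ 1) = Re (Y 0 $ 3) - q 0 * Re (Y 0 $ 1)" for x
    by blast
  then have Y3: "Re (Y x $ 3) = q x * Re (Y x $ 1)" for x
    by (simp add: Y0 y_def)
  show thesis
  proof (rule that)
    show "Re (Y 0 $ 1) = \<alpha>" "Re (Y 0 $ 2) = \<beta>" by (simp_all add: Y0 y_def)
    fix x
    show "((\<lambda>x. Re (Y x $ 1)) has_real_derivative Re (Y x $ 2)) (at x within S)"
      using d[of 1 x S] by simp
    show "((\<lambda>x. Re (Y x $ 2)) has_real_derivative q x * Re (Y x $ 1)) (at x within S)"
      using d[of 2 x S] by (simp add: Y3)
  qed
qed

text \<open>The inhomogeneity \<open>h $ 1 + h $ 3 * U\<close> is the derivative of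
  \<open>accel\<close> in the parameters. Its two parts are solved separately with zero data, so
  that \<open>w\<close> is visibly linear in \<open>h\<close>; the energy direction enters through
  the initial value \<open>um' h\<close> alone.\<close>

lemma variational_solution:
  assumes "is_fundamental_solution (spectral_matrix f U (p0 $ 3)) \<Phi>"
  obtains w w' where
    "\<And>h x. x \<in> {0..b} \<Longrightarrow> (w h has_real_derivative w' h x) (at x within {0..b})"
    "\<And>h x. x \<in> {0..b} \<Longrightarrow> (w' h has_real_derivative q x * w h x + h $ 1 + h $ 3 * U x) (at x within {0..b})"
    "\<And>h. w h 0 = um' h" "\<And>h. w' h 0 = 0"
    "\<And>x. linear (\<lambda>h. w h x)" "\<And>x. linear (\<lambda>h. w' h x)"
proof -
  from homogeneous_solution[OF assms, where \<alpha> = 1 and \<beta> = 0 and S = "{0..b}"]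
  obtain \<phi>1 \<phi>1' where \<phi>1: "\<phi>1 0 = 1" "\<phi>1' 0 = 0"
    "\<And>x. (\<phi>1 has_real_derivative \<phi>1' x) (at x within {0..b})"
    "\<And>x. (\<phi>1' has_real_derivative q x * \<phi>1 x) (at x within {0..b})"
    by blast
  from homogeneous_solution[OF assms, where \<alpha> = 0 and \<beta> = 1 and S = "{0..b}"]
  obtain \<phi>2 \<phi>2' where \<phi>2: "\<phi>2 0 = 0" "\<phi>2' 0 = 1"
    "\<And>x. (\<phi>2 has_real_derivative \<phi>2' x) (at x within {0..b})"
    "\<And>x. (\<phi>2' has_real_derivative q x * \<phi>2 x) (at x within {0..b})"
    by blast
  note voc = variation_of_constants[OF \<phi>1(3) \<phi>2(3) \<phi>1(4) \<phi>2(4) \<phi>1(1,2) \<phi>2(1,2)]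
  from voc[OF continuous_on_const[of _ 1]]
  obtain A A' where A: "A 0 = 0" "A' 0 = 0"
    "\<And>x. x \<in> {0..b} \<Longrightarrow> (A has_real_derivative A' x) (at x within {0..b})"
    "\<And>x. x \<in> {0..b} \<Longrightarrow> (A' has_real_derivative q x * A x + 1) (at x within {0..b})"
    by blast
  from voc[OF u_cont[OF p0]]
  obtain B B' where B: "B 0 = 0" "B' 0 = 0"
    "\<And>x. x \<in> {0..b} \<Longrightarrow> (B has_real_derivative B' x) (at x within {0..b})"
    "\<And>x. x \<in> {0..b} \<Longrightarrow> (B' has_real_derivative q x * B x + U x) (at x within {0..b})"
    by blast
  define w where "w h x = um' h * \<phi>1 x + h $ 1 * A x + h $ 3 * B x" for h x
  define w' where "w' h x = um' h * \<phi>1' x + h $ 1 * A' x + h $ 3 * B' x" for h x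
  note lin = linear_add[OF bounded_linear.linear[OF um'_linear]]
    linear_scale[OF bounded_linear.linear[OF um'_linear]]
  show thesis
  proof (rule that)
    fix h x
    show "w h 0 = um' h" "w' h 0 = 0" by (simp_all add: w_def w'_def A B \<phi>1)
    show "linear (\<lambda>h. w h x)" "linear (\<lambda>h. w' h x)"
      unfolding w_def w'_def by (auto intro!: linearI simp: lin algebra_simps)
    assume "x \<in> {0..b}"
    then show "(w h has_real_derivative w' h x) (at x within {0..b})"
      "(w' h has_real_derivative q x * w h x + h $ 1 + h $ 3 * U x) (at x within {0..b})"
      unfolding w_def w'_def
      by (auto intro!: derivative_eq_intros A B \<phi>1 simp: algebra_simps)
  qed
qed

end

section \<open>Differentiability in the parameters\<close>

text \<open>\<open>w h\<close> is the derivative of \<open>u p\<close> in the direction \<open>h\<close> at \<open>p = p0\<close>.\<close>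

locale wave_variation = wave_point +
  fixes w w' :: "real ^ 3 \<Rightarrow> real \<Rightarrow> real"
  assumes w_deriv: "\<And>h x. x \<in> {0..b} \<Longrightarrow> (w h has_real_derivative w' h x) (at x within {0..b})"
    and w'_deriv: "\<And>h x. x \<in> {0..b} \<Longrightarrow>
      (w' h has_real_derivative q x * w h x + h $ 1 + h $ 3 * U x) (at x within {0..b})"
    and w_0: "\<And>h. w h 0 = um' h" and w'_0: "\<And>h. w' h 0 = 0"
    and w_linear: "\<And>x. linear (\<lambda>h. w h x)" and w'_linear: "\<And>x. linear (\<lambda>h. w' h x)"
begin

text \<open>A compact interval containing the values of all profiles near \<open>p0\<close>; on it
  the Lipschitz and Taylor constants of \<open>f\<close> do not depend on the profile.\<close>

definition J :: "real set" where "J = {um p0 - 1..up p0 + 1}"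

lemma b_pos: "b > 0" and T0_in: "T0 \<in> {0<..<b}"
  using period_pos[OF p0] by (auto simp: b_def)

lemma U_in_J: "U x \<in> J"
  using u_ge_um[OF p0, of x] u_le_up[OF p0, of x] by (auto simp: J_def)

lemma eventually_near: "\<forall>\<^sub>F p in at p0. p \<in> \<Omega> \<and> (\<forall>x. u p x \<in> J)"
proof -
  have "(um \<longlongrightarrow> um p0) (at p0)" "(up \<longlongrightarrow> up p0) (at p0)"
    using um_isCont up_isCont by (simp_all add: isCont_def)
  then have "\<forall>\<^sub>F p in at p0. um p0 - 1 < um p" "\<forall>\<^sub>F p in at p0. up p < up p0 + 1"
    by (auto intro: order_tendstoD)
  with eventually_params show ?thesis
  proof eventually_elim
    case (elim p)
    have "u p x \<in> J" for x
      using u_ge_um[OF elim(1), of x] u_le_up[OF elim(1), of x] elim(2,3) by (simp add: J_def)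
    with elim(1) show ?case by blast
  qed
qed

lemma continuous_bounded_on_J:
  assumes "continuous_on UNIV (\<phi> :: real \<Rightarrow> real)"
  obtains B where "B \<ge> 0" "\<And>y. y \<in> J \<Longrightarrow> \<bar>\<phi> y\<bar> \<le> B"
proof -
  have "compact (\<phi> ` J)"
    unfolding J_def by (intro compact_continuous_image continuous_on_subset[OF assms]) auto
  then obtain B where "\<And>y. y \<in> J \<Longrightarrow> \<bar>\<phi> y\<bar> \<le> B"
    using compact_imp_bounded bounded_iff by (metis (no_types, lifting) imageI real_norm_def)
  then have "\<bar>\<phi> y\<bar> \<le> \<bar>B\<bar>" if "y \<in> J" for y using that by fastforce
  then show thesis by (intro that[of "\<bar>B\<bar>"]) auto
qed

lemma f_taylor:
  obtains B where "B \<ge> 0"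
    "\<And>x y. x \<in> J \<Longrightarrow> y \<in> J \<Longrightarrow> \<bar>f y - f x - deriv f x * (y - x)\<bar> \<le> B * (y - x)\<^sup>2"
proof -
  obtain B where B: "B \<ge> 0" "\<And>y. y \<in> J \<Longrightarrow> \<bar>deriv (deriv f) y\<bar> \<le> B"
    using continuous_bounded_on_J[OF f''_cont] by metis
  have "\<bar>f y - f x - deriv f x * (y - x)\<bar> \<le> B * (y - x)\<^sup>2" if "x \<in> J" "y \<in> J" for x y
  proof -
    have sub: "closed_segment x y \<subseteq> J"
      using that by (intro closed_segment_subset) (auto simp: J_def)
    have lip: "\<bar>deriv f t - deriv f x\<bar> \<le> B * \<bar>y - x\<bar>" if "t \<in> closed_segment x y" for t
    proof -
      have "norm (deriv f t - deriv f x) \<le> B * norm (t - x)"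
        by (rule field_differentiable_bound[where S = "closed_segment x y" and f' = "deriv (deriv f)"])
          (use B sub that in \<open>auto intro: has_field_derivative_at_within f'_deriv\<close>)
      also have "\<dots> \<le> B * \<bar>y - x\<bar>"
        using segment_bound(1)[OF that] B(1) by (intro mult_left_mono) (auto simp: abs_minus_commute)
      finally show ?thesis by simp
    qed
    have "norm ((f y - deriv f x * y) - (f x - deriv f x * x)) \<le> (B * \<bar>y - x\<bar>) * norm (y - x)"
    proof (rule field_differentiable_bound[where S = "closed_segment x y"])
      fix t assume "t \<in> closed_segment x y"
      show "((\<lambda>t. f t - deriv f x * t) has_real_derivative deriv f t - deriv f x) (at t within closed_segment x y)"
        by (rule has_field_derivative_at_within) (auto intro!: derivative_eq_intros f_deriv)
      show "norm (deriv f t - deriv f x) \<le> B * \<bar>y - x\<bar>"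
        using lip[OF \<open>t \<in> _\<close>] by simp
    qed auto
    then show ?thesis by (simp add: power2_eq_square algebra_simps)
  qed
  with B(1) show thesis by (rule that)
qed

lemma eventually_um_lipschitz:
  obtains C where "C \<ge> 0" "\<forall>\<^sub>F p in at p0. \<bar>um p - um p0\<bar> \<le> C * norm (p - p0)"
proof -
  obtain K where K: "\<And>h. norm (um' h) \<le> norm h * K" using bounded_linear.bounded[OF um'_linear] by blast
  have "((\<lambda>p. (um p - um p0 - um' (p - p0)) / norm (p - p0)) \<longlongrightarrow> 0) (at p0)"
    using um_has_derivative unfolding has_derivative_at2 by (simp add: divide_inverse mult.commute algebra_simps)
  from tendstoD[OF this, of 1]
  have "\<forall>\<^sub>F p in at p0. \<bar>(um p - um p0 - um' (p - p0)) / norm (p - p0)\<bar> < 1"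
    by (simp add: dist_norm)
  then have "\<forall>\<^sub>F p in at p0. \<bar>um p - um p0\<bar> \<le> (\<bar>K\<bar> + 1) * norm (p - p0)"
  proof eventually_elim
    case (elim p)
    then have "\<bar>um p - um p0 - um' (p - p0)\<bar> \<le> norm (p - p0)"
      by (cases "p = p0") (auto simp: divide_simps um'_def split: if_splits)
    moreover have "\<bar>um' (p - p0)\<bar> \<le> \<bar>K\<bar> * norm (p - p0)"
      using K[of "p - p0"] abs_ge_self[of K] mult_right_mono[of K "\<bar>K\<bar>" "norm (p - p0)"] by (simp add: mult.commute)
    ultimately show ?case by (simp add: algebra_simps)
  qed
  then show thesis by (intro that[of "\<bar>K\<bar> + 1"]) auto
qed

lemma norm_pair_bounds: "\<bar>x\<bar> \<le> norm (x :: real, y :: real)" "\<bar>y\<bar> \<le> norm (x, y)" "norm (x, y) \<le> \<bar>x\<bar> + \<bar>y\<bar>"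
  using norm_fst_le[of x y] norm_snd_le[of y x] norm_Pair_le[of x y] by auto

lemma component_le: "\<bar>(h :: real ^ 3) $ i\<bar> \<le> norm h"
  using Finite_Cartesian_Product.norm_nth_le[of h i] by simp

text \<open>Gronwall for the difference of two profiles. The parameters enter the equation through
  \<open>h $ 1 + h $ 3 * u\<close>, which is bounded by a multiple of \<open>norm h\<close>, and the
  initial value through the Lipschitz bound for \<open>um\<close>.\<close>

lemma profile_lipschitz:
  obtains C where "C \<ge> 0" "\<forall>\<^sub>F p in at p0. \<forall>x\<in>{0..b}.
    \<bar>u p x - U x\<bar> \<le> C * norm (p - p0) \<and> \<bar>deriv (u p) x - U' x\<bar> \<le> C * norm (p - p0)"
proof -
  obtain L where L: "L \<ge> 0" "\<And>x y. x \<in> J \<Longrightarrow> y \<in> J \<Longrightarrow> \<bar>accel p0 x - accel p0 y\<bar> \<le> L * \<bar>x - y\<bar>"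
    using accel_lipschitz[of "um p0 - 1" "up p0 + 1" p0] unfolding J_def by metis
  obtain R where R: "R \<ge> 0" "\<And>y. y \<in> J \<Longrightarrow> \<bar>y\<bar> \<le> R"
    using continuous_bounded_on_J[OF continuous_on_id] by auto
  obtain C0 where C0: "C0 \<ge> 0" "\<forall>\<^sub>F p in at p0. \<bar>um p - um p0\<bar> \<le> C0 * norm (p - p0)"
    by (rule eventually_um_lipschitz)
  define K where "K = exp ((2 * \<bar>1 + L\<bar> + 1) * b) * (1 + b)"
  have "K \<ge> 0" using b_pos by (simp add: K_def)
  define C where "C = K * (C0 + (1 + R))"
  have "\<forall>\<^sub>F p in at p0. \<forall>x\<in>{0..b}.
    \<bar>u p x - U x\<bar> \<le> C * norm (p - p0) \<and> \<bar>deriv (u p) x - U' x\<bar> \<le> C * norm (p - p0)"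
    using eventually_near C0(2)
  proof eventually_elim
    case (elim p)
    then have p: "p \<in> \<Omega>" and inJ: "\<And>x. u p x \<in> J" by auto
    define h where "h = p - p0"
    define d where "d = (1 + R) * norm h"
    define z where "z x = (u p x - U x, deriv (u p) x - U' x)" for x
    define z' where "z' x = (deriv (u p) x - U' x, accel p (u p x) - accel p0 (U x))" for x
    have "norm (z x) \<le> C * norm (p - p0)" if "x \<in> {0..b}" for x
    proof -
      have "norm (z x) \<le> K * (norm (z 0) + d)"
        unfolding K_def
      proof (rule gronwall_norm[OF _ _ _ that])
        fix x
        have "((\<lambda>x. u p x - U x) has_real_derivative deriv (u p) x - U' x) (at x within {0..b})"
          "((\<lambda>x. deriv (u p) x - U' x) has_real_derivative accel p (u p x) - accel p0 (U x)) (at x within {0..b})"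
          by (intro DERIV_diff has_field_derivative_at_within[OF u_deriv] has_field_derivative_at_within[OF u_deriv2] p p0)+
        then show "(z has_vector_derivative z' x) (at x within {0..b})"
          unfolding z_def z'_def has_real_derivative_iff_has_vector_derivative
          by (intro has_vector_derivative_Pair)
        have "accel p (u p x) - accel p0 (U x) =
            (accel p0 (u p x) - accel p0 (U x)) + (h $ 1 + h $ 3 * u p x)"
          by (simp add: accel_def h_def algebra_simps)
        also have "\<bar>\<dots>\<bar> \<le> L * \<bar>u p x - U x\<bar> + (norm h + norm h * R)"
          by (intro order.trans[OF abs_triangle_ineq] add_mono L inJ U_in_J component_le)
             (auto simp: abs_mult intro!: mult_mono component_le R inJ)
        finally have "\<bar>accel p (u p x) - accel p0 (U x)\<bar> \<le> L * norm (z x) + d"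
          using mult_left_mono[OF norm_pair_bounds(1)[of "u p x - U x" "deriv (u p) x - U' x"] L(1)]
          unfolding z_def d_def by (simp add: algebra_simps)
        moreover have "\<bar>deriv (u p) x - U' x\<bar> \<le> norm (z x)"
          unfolding z_def by (rule norm_pair_bounds)
        ultimately show "norm (z' x) \<le> (1 + L) * norm (z x) + d"
          unfolding z'_def using norm_pair_bounds(3)[of "deriv (u p) x - U' x" "accel p (u p x) - accel p0 (U x)"]
          by (simp add: algebra_simps)
      next
        show "0 \<le> d" using R by (simp add: d_def)
      qed
      also have "norm (z 0) \<le> C0 * norm (p - p0)"
        unfolding z_def using elim(2) by (simp add: u_0 u'_0 p p0 norm_Pair)
      then have "K * norm (z 0) \<le> K * (C0 * norm (p - p0))"
        using \<open>K \<ge> 0\<close> by (rule mult_left_mono)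
      then have "K * (norm (z 0) + d) \<le> C * norm (p - p0)"
        unfolding C_def d_def h_def by (simp add: algebra_simps)
      finally show ?thesis .
    qed
    then show ?case unfolding z_def
      using norm_pair_bounds order.trans by (metis (no_types, lifting))
  qed
  moreover have "C \<ge> 0" unfolding C_def using \<open>K \<ge> 0\<close> C0 R by simp
  ultimately show thesis by (intro that)
qed

text \<open>Gronwall for the remainder after the linear term \<open>w\<close>. The Taylor remainder
  of \<open>f\<close> and the product of the speed increment with the profile increment are
  quadratic by the Lipschitz bound, while the initial error is \<open>o(norm (p - p0))\<close>
  because \<open>um\<close> is differentiable. The bound \<open>e\<close> is uniform in
  \<open>x\<close>, as is needed under the integrals for mass and momentum.\<close>

lemma profile_expansion:
  obtains e where "((\<lambda>p. e p / norm (p - p0)) \<longlongrightarrow> 0) (at p0)"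
    "\<forall>\<^sub>F p in at p0. \<forall>x\<in>{0..b}. \<bar>u p x - U x - w (p - p0) x\<bar> \<le> e p
      \<and> \<bar>deriv (u p) x - U' x - w' (p - p0) x\<bar> \<le> e p"
proof -
  obtain R where R: "R \<ge> 0" "\<And>y. y \<in> J \<Longrightarrow> \<bar>p0 $ 3 - deriv f y\<bar> \<le> R"
    by (rule continuous_bounded_on_J[of "\<lambda>y. p0 $ 3 - deriv f y"]) (auto intro!: continuous_intros f'_cont)
  obtain B where B: "B \<ge> 0"
    "\<And>x y. x \<in> J \<Longrightarrow> y \<in> J \<Longrightarrow> \<bar>f y - f x - deriv f x * (y - x)\<bar> \<le> B * (y - x)\<^sup>2"
    using f_taylor by blast
  obtain C where C: "C \<ge> 0" "\<forall>\<^sub>F p in at p0. \<forall>x\<in>{0..b}.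
    \<bar>u p x - U x\<bar> \<le> C * norm (p - p0) \<and> \<bar>deriv (u p) x - U' x\<bar> \<le> C * norm (p - p0)"
    by (rule profile_lipschitz)
  define K where "K = exp ((2 * \<bar>1 + R\<bar> + 1) * b) * (1 + b)"
  define d where "d p = (C + B * C\<^sup>2) * (norm (p - p0))\<^sup>2" for p
  define e where "e p = K * (\<bar>um p - um p0 - um' (p - p0)\<bar> + d p)" for p
  have "\<forall>\<^sub>F p in at p0. \<forall>x\<in>{0..b}. \<bar>u p x - U x - w (p - p0) x\<bar> \<le> e p
      \<and> \<bar>deriv (u p) x - U' x - w' (p - p0) x\<bar> \<le> e p"
    using eventually_near C(2)
  proof eventually_elim
    case (elim p)
    then have p: "p \<in> \<Omega>" and inJ: "\<And>x. u p x \<in> J" by auto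
    define h where "h = p - p0"
    define z where "z x = (u p x - U x - w h x, deriv (u p) x - U' x - w' h x)" for x
    define z2 where "z2 x = accel p (u p x) - accel p0 (U x) - (q x * w h x + h $ 1 + h $ 3 * U x)" for x
    define z' where "z' x = (deriv (u p) x - U' x - w' h x, z2 x)" for x
    have "norm (z x) \<le> e p" if "x \<in> {0..b}" for x
    proof -
      have "norm (z x) \<le> K * (norm (z 0) + d p)"
        unfolding K_def
      proof (rule gronwall_norm[OF _ _ _ that])
        fix x assume x: "x \<in> {0..b}"
        have "((\<lambda>x. u p x - U x - w h x) has_real_derivative deriv (u p) x - U' x - w' h x) (at x within {0..b})"
          "((\<lambda>x. deriv (u p) x - U' x - w' h x) has_real_derivative z2 x) (at x within {0..b})"
          unfolding z2_def
          by (intro DERIV_diff has_field_derivative_at_within[OF u_deriv] has_field_derivative_at_within[OF u_deriv2]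
              w_deriv w'_deriv x p p0)+
        then show "(z has_vector_derivative z' x) (at x within {0..b})"
          unfolding z_def z'_def has_real_derivative_iff_has_vector_derivative
          by (intro has_vector_derivative_Pair)
        have Cx: "\<bar>u p x - U x\<bar> \<le> C * norm h" using elim(2) x by (simp add: h_def)
        have "z2 x = q x * (u p x - U x - w h x) + h $ 3 * (u p x - U x)
            - (f (u p x) - f (U x) - deriv f (U x) * (u p x - U x))"
          by (simp add: z2_def accel_def q_def h_def algebra_simps)
        then have "\<bar>z2 x\<bar> \<le> \<bar>q x * (u p x - U x - w h x)\<bar> + \<bar>h $ 3 * (u p x - U x)\<bar>
            + \<bar>f (u p x) - f (U x) - deriv f (U x) * (u p x - U x)\<bar>"
          by linarith
        also have "\<dots> \<le> R * norm (z x) + norm h * (C * norm h) + B * (C * norm h)\<^sup>2"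
        proof (intro add_mono)
          show "\<bar>q x * (u p x - U x - w h x)\<bar> \<le> R * norm (z x)"
            unfolding abs_mult q_def z_def
            by (rule mult_mono[OF R(2)[OF U_in_J] norm_pair_bounds(1) R(1) abs_ge_zero])
          show "\<bar>h $ 3 * (u p x - U x)\<bar> \<le> norm h * (C * norm h)"
            unfolding abs_mult by (rule mult_mono[OF component_le Cx norm_ge_zero abs_ge_zero])
          have "\<bar>f (u p x) - f (U x) - deriv f (U x) * (u p x - U x)\<bar> \<le> B * (u p x - U x)\<^sup>2"
            by (intro B U_in_J inJ)
          also have "\<dots> \<le> B * (C * norm h)\<^sup>2"
            using Cx B(1) by (intro mult_left_mono) (auto simp: abs_le_square_iff[symmetric])
          finally show "\<bar>f (u p x) - f (U x) - deriv f (U x) * (u p x - U x)\<bar> \<le> B * (C * norm h)\<^sup>2" .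
        qed
        also have "\<dots> = R * norm (z x) + d p"
          by (simp add: d_def h_def power2_eq_square algebra_simps)
        finally have "\<bar>z2 x\<bar> \<le> R * norm (z x) + d p" .
        moreover have "\<bar>deriv (u p) x - U' x - w' h x\<bar> \<le> norm (z x)"
          unfolding z_def by (rule norm_pair_bounds)
        ultimately show "norm (z' x) \<le> (1 + R) * norm (z x) + d p"
          unfolding z'_def using norm_pair_bounds(3)[of "deriv (u p) x - U' x - w' h x" "z2 x"]
          by (simp add: algebra_simps)
      next
        show "0 \<le> d p" using B C by (simp add: d_def)
      qed
      also have "norm (z 0) = \<bar>um p - um p0 - um' (p - p0)\<bar>"
        by (simp add: z_def u_0 u'_0 p p0 norm_Pair w_0 w'_0 h_def)
      finally show ?thesis unfolding e_def .
    qed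
    then show ?case unfolding z_def h_def
      using norm_pair_bounds order.trans by (metis (no_types, lifting))
  qed
  moreover have "((\<lambda>p. e p / norm (p - p0)) \<longlongrightarrow> 0) (at p0)"
  proof -
    have 1: "((\<lambda>p. (um p - um p0 - um' (p - p0)) / norm (p - p0)) \<longlongrightarrow> 0) (at p0)"
      using um_has_derivative unfolding has_derivative_at2 by (simp add: divide_inverse mult.commute algebra_simps)
    have "((\<lambda>p. norm (p - p0)) \<longlongrightarrow> norm (p0 - p0)) (at p0)"
      by (intro tendsto_intros)
    then have 2: "((\<lambda>p. norm (p - p0)) \<longlongrightarrow> 0) (at p0)" by simp
    have "((\<lambda>p. K * (\<bar>(um p - um p0 - um' (p - p0)) / norm (p - p0)\<bar> + (C + B * C\<^sup>2) * norm (p - p0)))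
        \<longlongrightarrow> K * (\<bar>0\<bar> + (C + B * C\<^sup>2) * 0)) (at p0)"
      by (intro tendsto_intros 1 2)
    moreover have "\<forall>\<^sub>F p in at p0. K * (\<bar>(um p - um p0 - um' (p - p0)) / norm (p - p0)\<bar> + (C + B * C\<^sup>2) * norm (p - p0))
        = e p / norm (p - p0)"
      unfolding eventually_at_filter
      by (intro always_eventually) (auto simp: e_def d_def abs_divide field_simps power2_eq_square)
    ultimately show ?thesis by (auto intro: Lim_transform_eventually)
  qed
  ultimately show thesis by (intro that)
qed

lemma u_param: assumes x: "x \<in> {0..b}" shows "((\<lambda>p. u p x) has_derivative (\<lambda>h. w h x)) (at p0)"
  and u'_param: "((\<lambda>p. deriv (u p) x) has_derivative (\<lambda>h. w' h x)) (at p0)"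
proof -
  obtain e where e: "((\<lambda>p. e p / norm (p - p0)) \<longlongrightarrow> 0) (at p0)"
    "\<forall>\<^sub>F p in at p0. \<forall>x\<in>{0..b}. \<bar>u p x - U x - w (p - p0) x\<bar> \<le> e p
      \<and> \<bar>deriv (u p) x - U' x - w' (p - p0) x\<bar> \<le> e p"
    by (rule profile_expansion)
  from e(2) x have "\<forall>\<^sub>F p in at p0. \<bar>u p x - U x - w (p - p0) x\<bar> \<le> e p"
    "\<forall>\<^sub>F p in at p0. \<bar>deriv (u p) x - U' x - w' (p - p0) x\<bar> \<le> e p"
    by (auto elim!: eventually_mono)
  then show "((\<lambda>p. u p x) has_derivative (\<lambda>h. w h x)) (at p0)"
    "((\<lambda>p. deriv (u p) x) has_derivative (\<lambda>h. w' h x)) (at p0)"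
    by (auto intro!: has_derivative_from_remainder[OF _ e(1)] simp: linear_conv_bounded_linear[symmetric]
        w_linear w'_linear)
qed

lemma w_cont: "continuous_on {0..b} (w h)"
  using w_deriv by (rule DERIV_continuous_on)

text \<open>Differentiation under the integral for a fixed upper limit; applied below to
  \<open>\<phi> y = y\<close> and \<open>\<phi> y = y\<^sup>2\<close>.\<close>

lemma profile_integral_param:
  fixes \<phi> \<phi>' :: "real \<Rightarrow> real"
  assumes taylor: "\<And>y z. y \<in> J \<Longrightarrow> z \<in> J \<Longrightarrow> \<bar>\<phi> z - \<phi> y - \<phi>' y * (z - y)\<bar> \<le> B * (z - y)\<^sup>2"
    and cont: "continuous_on UNIV \<phi>" "continuous_on UNIV \<phi>'" and "B \<ge> 0" and x: "x \<in> {0..b}"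
  shows "((\<lambda>p. integral {0..x} (\<lambda>t. \<phi> (u p t))) has_derivative
    (\<lambda>h. integral {0..x} (\<lambda>t. \<phi>' (U t) * w h t))) (at p0)"
proof -
  obtain e where e: "((\<lambda>p. e p / norm (p - p0)) \<longlongrightarrow> 0) (at p0)"
    "\<forall>\<^sub>F p in at p0. \<forall>x\<in>{0..b}. \<bar>u p x - U x - w (p - p0) x\<bar> \<le> e p
      \<and> \<bar>deriv (u p) x - U' x - w' (p - p0) x\<bar> \<le> e p"
    by (rule profile_expansion)
  obtain C where C: "C \<ge> 0" "\<forall>\<^sub>F p in at p0. \<forall>x\<in>{0..b}.
    \<bar>u p x - U x\<bar> \<le> C * norm (p - p0) \<and> \<bar>deriv (u p) x - U' x\<bar> \<le> C * norm (p - p0)"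
    by (rule profile_lipschitz)
  obtain R where R: "R \<ge> 0" "\<And>y. y \<in> J \<Longrightarrow> \<bar>\<phi>' y\<bar> \<le> R"
    using continuous_bounded_on_J[OF cont(2)] by blast
  have phi_u: "continuous_on S (\<lambda>t. \<phi> (u p t))" "continuous_on S (\<lambda>t. \<phi>' (u p t))" if "p \<in> \<Omega>" for p S
    using continuous_on_compose2[OF cont(1) u_cont[OF that]] continuous_on_compose2[OF cont(2) u_cont[OF that]]
    by auto
  have sub: "{0..x} \<subseteq> {0..b}" using x by auto
  have wint: "(\<lambda>t. \<phi>' (U t) * w h t) integrable_on {0..x}" for h
    by (intro integrable_continuous_real continuous_on_mult phi_u p0 continuous_on_subset[OF w_cont sub])
  show ?thesis
  proof (rule has_derivative_from_remainder)
    show "bounded_linear (\<lambda>h. integral {0..x} (\<lambda>t. \<phi>' (U t) * w h t))"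
      unfolding linear_conv_bounded_linear[symmetric]
    proof (rule linearI)
      fix h k :: "real ^ 3" and r :: real
      show "integral {0..x} (\<lambda>t. \<phi>' (U t) * w (h + k) t) =
          integral {0..x} (\<lambda>t. \<phi>' (U t) * w h t) + integral {0..x} (\<lambda>t. \<phi>' (U t) * w k t)"
        by (simp add: integral_add[OF wint wint, symmetric] linear_add[OF w_linear] distrib_left)
      show "integral {0..x} (\<lambda>t. \<phi>' (U t) * w (r *\<^sub>R h) t) = r *\<^sub>R integral {0..x} (\<lambda>t. \<phi>' (U t) * w h t)"
      proof -
        have "(\<lambda>t. \<phi>' (U t) * w (r *\<^sub>R h) t) = (\<lambda>t. r * (\<phi>' (U t) * w h t))"
          by (simp add: linear_scale[OF w_linear] mult.left_commute)
        then show ?thesis by simp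
      qed
    qed
    define E where "E p = (B * (C * norm (p - p0))\<^sup>2 + R * e p) * x" for p
    have "((\<lambda>p. (B * C\<^sup>2 * norm (p - p0) + R * (e p / norm (p - p0))) * x) \<longlongrightarrow> (B * C\<^sup>2 * 0 + R * 0) * x) (at p0)"
      by (intro tendsto_intros e(1) tendsto_norm_zero LIM_zero)
    moreover have "\<forall>\<^sub>F p in at p0. (B * C\<^sup>2 * norm (p - p0) + R * (e p / norm (p - p0))) * x = E p / norm (p - p0)"
      unfolding eventually_at_filter
      by (intro always_eventually) (auto simp: E_def field_simps power2_eq_square)
    ultimately show "((\<lambda>p. E p / norm (p - p0)) \<longlongrightarrow> 0) (at p0)"
      by (auto intro: Lim_transform_eventually)
    show "\<forall>\<^sub>F p in at p0. \<bar>integral {0..x} (\<lambda>t. \<phi> (u p t)) - integral {0..x} (\<lambda>t. \<phi> (U t))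
        - integral {0..x} (\<lambda>t. \<phi>' (U t) * w (p - p0) t)\<bar> \<le> E p"
      using eventually_near e(2) C(2)
    proof eventually_elim
      case (elim p)
      then have p: "p \<in> \<Omega>" and inJ: "\<And>x. u p x \<in> J" by auto
      let ?r = "\<lambda>t. \<phi> (u p t) - \<phi> (U t) - \<phi>' (U t) * w (p - p0) t"
      have "integral {0..x} (\<lambda>t. \<phi> (u p t)) - integral {0..x} (\<lambda>t. \<phi> (U t))
        - integral {0..x} (\<lambda>t. \<phi>' (U t) * w (p - p0) t) = integral {0..x} ?r"
        by (subst integral_diff, (intro integrable_diff integrable_continuous_real phi_u p p0 wint)+)+ simp
      also have "norm (integral {0..x} ?r) \<le> (B * (C * norm (p - p0))\<^sup>2 + R * e p) * (x - 0)"
      proof (rule integral_bound)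
        show "continuous_on {0..x} ?r"
          by (intro continuous_intros phi_u p p0 continuous_on_subset[OF w_cont sub])
        fix t assume "t \<in> {0..x}"
        then have t: "t \<in> {0..b}" using x by auto
        have "?r t = (\<phi> (u p t) - \<phi> (U t) - \<phi>' (U t) * (u p t - U t)) + \<phi>' (U t) * (u p t - U t - w (p - p0) t)"
          by (simp add: algebra_simps)
        moreover have "\<bar>\<phi> (u p t) - \<phi> (U t) - \<phi>' (U t) * (u p t - U t)\<bar> \<le> B * (C * norm (p - p0))\<^sup>2"
        proof -
          have "\<bar>\<phi> (u p t) - \<phi> (U t) - \<phi>' (U t) * (u p t - U t)\<bar> \<le> B * (u p t - U t)\<^sup>2"
            by (intro taylor U_in_J inJ)
          also have "\<dots> \<le> B * (C * norm (p - p0))\<^sup>2"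
            using elim(3) t \<open>B \<ge> 0\<close> C(1)
            by (intro mult_left_mono) (auto simp: abs_le_square_iff[symmetric])
          finally show ?thesis .
        qed
        moreover have "\<bar>\<phi>' (U t) * (u p t - U t - w (p - p0) t)\<bar> \<le> R * e p"
          unfolding abs_mult using elim(2) t R(1) by (intro mult_mono R(2)[OF U_in_J]) auto
        ultimately show "norm (?r t) \<le> B * (C * norm (p - p0))\<^sup>2 + R * e p"
          unfolding real_norm_def by linarith
      qed (use x in auto)
      finally show ?case by (simp add: E_def)
    qed
  qed
qed

lemma u_tendsto:
  assumes "(\<xi> \<longlongrightarrow> x) (at p0)" "x \<in> {0<..<b}"
  shows "((\<lambda>p. u p (\<xi> p)) \<longlongrightarrow> U x) (at p0)"
proof -
  obtain C where C: "C \<ge> 0" "\<forall>\<^sub>F p in at p0. \<forall>x\<in>{0..b}.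
    \<bar>u p x - U x\<bar> \<le> C * norm (p - p0) \<and> \<bar>deriv (u p) x - U' x\<bar> \<le> C * norm (p - p0)"
    by (rule profile_lipschitz)
  have "isCont U x" using u_deriv[OF p0] by (rule DERIV_isCont)
  then have 1: "((\<lambda>p. U (\<xi> p)) \<longlongrightarrow> U x) (at p0)" by (rule isCont_tendsto_compose[OF _ assms(1)])
  have ev: "\<forall>\<^sub>F p in at p0. \<xi> p \<in> {0<..<b}"
    using assms by (intro topological_tendstoD[OF assms(1)]) auto
  have "((\<lambda>p. u p (\<xi> p) - U (\<xi> p)) \<longlongrightarrow> 0) (at p0)"
  proof (rule Lim_null_comparison)
    have "((\<lambda>p. C * norm (p - p0)) \<longlongrightarrow> C * 0) (at p0)"
      by (intro tendsto_intros tendsto_norm_zero LIM_zero)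
    then show "((\<lambda>p. C * norm (p - p0)) \<longlongrightarrow> 0) (at p0)" by simp
    show "\<forall>\<^sub>F p in at p0. norm (u p (\<xi> p) - U (\<xi> p)) \<le> C * norm (p - p0)"
      using C(2) ev by eventually_elim auto
  qed
  from tendsto_add[OF this 1] show ?thesis by simp
qed

lemma accel_tendsto:
  assumes "(\<xi> \<longlongrightarrow> x) (at p0)" "x \<in> {0<..<b}"
  shows "((\<lambda>p. accel p (u p (\<xi> p))) \<longlongrightarrow> accel p0 (U x)) (at p0)"
proof -
  have "isCont f (U x)" using f_deriv by (rule DERIV_isCont)
  then show ?thesis unfolding accel_def
    by (intro tendsto_intros u_tendsto[OF assms] isCont_tendsto_compose[of "U x" f])
qed

text \<open>Implicit differentiation presupposes continuity of the period. A nearby wave cannot turn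
  too early, since at its half period it takes the value \<open>up p\<close>, close to
  \<open>up p0\<close>, whereas \<open>U\<close> is still well below. It cannot turn too late, since
  shortly after \<open>T0 / 2\<close> the slope \<open>U'\<close> is strictly negative, and a wave
  has nonnegative slope up to its own half period.\<close>

lemma period_tendsto: "(period \<longlongrightarrow> T0) (at p0)"
proof (rule order_tendstoI)
  obtain C where C: "C \<ge> 0" "\<forall>\<^sub>F p in at p0. \<forall>x\<in>{0..b}.
    \<bar>u p x - U x\<bar> \<le> C * norm (p - p0) \<and> \<bar>deriv (u p) x - U' x\<bar> \<le> C * norm (p - p0)"
    by (rule profile_lipschitz)
  have "((\<lambda>p. C * norm (p - p0)) \<longlongrightarrow> C * 0) (at p0)"
    by (intro tendsto_intros tendsto_norm_zero LIM_zero)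
  then have lim0: "((\<lambda>p. C * norm (p - p0)) \<longlongrightarrow> 0) (at p0)" by simp
  have ltb: "T0 / 2 < b" "0 < T0" using T0_in by auto
  have mono: "U x < U y" if "0 \<le> x" "x < y" "y \<le> T0 / 2" for x y
    using that u'_pos[OF p0] u_deriv[OF p0] u_cont[OF p0]
    by (intro DERIV_pos_imp_increasing_open[OF \<open>x < y\<close>]) (meson dual_order.strict_trans1 dual_order.strict_trans2)+
  { fix a assume a: "a < T0"
    \<comment> \<open>The maximum with \<open>0\<close> covers negative \<open>a\<close>, for which
      \<open>a / 2\<close> would leave the interval where \<open>U\<close> is monotone.\<close>
    define c where "c = max (a / 2) 0"
    have c: "0 \<le> c" "c < T0 / 2" using a ltb by (auto simp: c_def)
    then have "U c < up p0" using mono[of c "T0 / 2"] u_half_period[OF p0] by simp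
    then have "\<forall>\<^sub>F p in at p0. C * norm (p - p0) < (up p0 - U c) / 2"
      by (intro order_tendstoD[OF lim0]) simp
    moreover have "\<forall>\<^sub>F p in at p0. up p0 - (up p0 - U c) / 2 < up p"
      using up_isCont \<open>U c < up p0\<close> by (intro order_tendstoD[of up "up p0"]) (auto simp: isCont_def)
    ultimately show "\<forall>\<^sub>F p in at p0. a < period p"
      using C(2) eventually_params
    proof eventually_elim
      case (elim p)
      show ?case
      proof (rule ccontr)
        assume "\<not> a < period p"
        then have *: "period p / 2 \<le> c" by (auto simp: c_def)
        have pos: "period p > 0" by (rule period_pos[OF elim(4)])
        have "U (period p / 2) \<le> U c"
          using mono[of "period p / 2" c] * c pos by (cases "period p / 2 = c") auto
        moreover have "\<bar>u p (period p / 2) - U (period p / 2)\<bar> \<le> C * norm (p - p0)"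
          using elim(3) * c pos ltb by auto
        ultimately show False
          using elim(1,2) u_half_period[OF elim(4)] by (simp add: field_simps)
      qed
    qed }
  { fix a assume a: "T0 < a"
    have "accel p0 (U (T0 / 2)) < 0" using accel_up_neg[OF p0] u_half_period[OF p0] by simp
    from DERIV_neg_dec_right[OF u_deriv2[OF p0] this] u'_half_period[OF p0]
    obtain d where d: "d > 0" "\<And>h. 0 < h \<Longrightarrow> h < d \<Longrightarrow> U' (T0 / 2 + h) < 0" by auto
    define h where "h = min (d / 2) (min ((a - T0) / 2) (T0 / 2))"
    have h: "0 < h" "h < d" "h \<le> (a - T0) / 2" "h \<le> T0 / 2"
    proof -
      show "0 < h" using d(1) a ltb by (simp add: h_def)
      show "h < d" using d(1) min.cobounded1[of "d / 2"] unfolding h_def by (smt (verit) field_sum_of_halves)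
      show "h \<le> (a - T0) / 2" unfolding h_def by (rule min.coboundedI2) (rule min.cobounded1)
      show "h \<le> T0 / 2" unfolding h_def by (rule min.coboundedI2) (rule min.cobounded2)
    qed
    define c where "c = T0 / 2 + h"
    have c: "U' c < 0" "c \<le> a / 2" "c \<in> {0..b}" "0 < c"
      using d(2)[OF h(1,2)] h ltb T0_in unfolding c_def by (auto simp: field_simps)
    have "\<forall>\<^sub>F p in at p0. C * norm (p - p0) < - U' c"
      by (intro order_tendstoD[OF lim0]) (use c in simp)
    then show "\<forall>\<^sub>F p in at p0. period p < a"
      using C(2) eventually_params
    proof eventually_elim
      case (elim p)
      have "\<bar>deriv (u p) c - U' c\<bar> \<le> C * norm (p - p0)" using elim(2) c by blast
      with elim(1) have neg: "deriv (u p) c < 0" by linarith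
      show ?case
      proof (rule ccontr)
        assume n: "\<not> period p < a"
        show False
        proof (cases "c = period p / 2")
          case True
          from u'_half_period[OF elim(3)] have "deriv (u p) c = 0" unfolding True .
          with neg show False by simp
        next
          case False
          with n c have "c < period p / 2" by simp
          from u'_pos[OF elim(3) c(4) this] neg show False by simp
        qed
      qed
    qed }
qed

definition T' :: "real ^ 3 \<Rightarrow> real" where "T' h = - w' h T0 / g"

text \<open>Differentiation of \<open>u_x(T(p); p) = 0\<close>. The derivative in \<open>x\<close>
  at the zero is the acceleration at \<open>um p0\<close>, namely \<open>g\<close>, which is
  positive because the root is simple.\<close>

lemma period_has_derivative: "(period has_derivative T') (at p0)"
  unfolding T'_def
proof (rule has_derivative_implicit_zero[where z = "\<lambda>p. deriv (u p)" and z' = "\<lambda>p x. accel p (u p x)" and b = b])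
  show "\<forall>\<^sub>F p in at p0. \<forall>x\<in>{0..b}. (deriv (u p) has_real_derivative accel p (u p x)) (at x within {0..b})"
    using eventually_params by eventually_elim (auto intro: has_field_derivative_at_within u_deriv2)
  show "\<And>\<xi>. (\<xi> \<longlongrightarrow> T0) (at p0) \<Longrightarrow> ((\<lambda>p. accel p (u p (\<xi> p))) \<longlongrightarrow> g) (at p0)"
    using accel_tendsto[OF _ T0_in] by (simp add: u_period[OF p0] g_def)
  show "((\<lambda>p. deriv (u p) T0) has_derivative (\<lambda>h. w' h T0)) (at p0)"
    using T0_in by (intro u'_param) auto
  show "\<forall>\<^sub>F p in at p0. deriv (u p) (period p) = 0"
    using eventually_params by eventually_elim (rule u'_period)
qed (use T0_in period_tendsto u'_period[OF p0] g_pos in auto)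

text \<open>The moving upper limit contributes the boundary term
  \<open>\<phi> (um p0) * T' h\<close>, as the profile is back at its minimum after a
  period.\<close>

lemma integral_period_has_derivative:
  fixes \<phi> \<phi>' :: "real \<Rightarrow> real"
  assumes taylor: "\<And>y z. y \<in> J \<Longrightarrow> z \<in> J \<Longrightarrow> \<bar>\<phi> z - \<phi> y - \<phi>' y * (z - y)\<bar> \<le> B * (z - y)\<^sup>2"
    and cont: "continuous_on UNIV \<phi>" "continuous_on UNIV \<phi>'" and "B \<ge> 0"
  shows "((\<lambda>p. integral {0..period p} (\<lambda>t. \<phi> (u p t))) has_derivative
    (\<lambda>h. integral {0..T0} (\<lambda>t. \<phi>' (U t) * w h t) + \<phi> (um p0) * T' h)) (at p0)"
proof (rule has_derivative_diagonal[where z = "\<lambda>p x. integral {0..x} (\<lambda>t. \<phi> (u p t))" and \<tau> = period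
      and z' = "\<lambda>p x. \<phi> (u p x)" and b = b])
  have *: "continuous_on {0..b} (\<lambda>t. \<phi> (u p t))" if "p \<in> \<Omega>" for p
    using continuous_on_compose2[OF cont(1) u_cont[OF that]] by auto
  show "\<forall>\<^sub>F p in at p0. \<forall>x\<in>{0..b}.
      ((\<lambda>x. integral {0..x} (\<lambda>t. \<phi> (u p t))) has_real_derivative \<phi> (u p x)) (at x within {0..b})"
    using eventually_params by eventually_elim (auto intro: integral_has_real_derivative *)
  show "((\<lambda>p. integral {0..T0} (\<lambda>t. \<phi> (u p t))) has_derivative (\<lambda>h. integral {0..T0} (\<lambda>t. \<phi>' (U t) * w h t))) (at p0)"
    using T0_in by (intro profile_integral_param[OF taylor cont \<open>B \<ge> 0\<close>]) auto
  fix \<xi> assume \<xi>: "(\<xi> \<longlongrightarrow> T0) (at p0)"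
  have "isCont \<phi> (U T0)" using cont(1) by (simp add: continuous_on_eq_continuous_at)
  from isCont_tendsto_compose[OF this u_tendsto[OF \<xi> T0_in]]
  show "((\<lambda>p. \<phi> (u p (\<xi> p))) \<longlongrightarrow> \<phi> (um p0)) (at p0)" by (simp add: u_period[OF p0])
qed (use T0_in period_has_derivative in auto)

definition M' :: "real ^ 3 \<Rightarrow> real" where "M' h = integral {0..T0} (w h) + um p0 * T' h"
definition P' :: "real ^ 3 \<Rightarrow> real" where
  "P' h = integral {0..T0} (\<lambda>t. 2 * U t * w h t) + (um p0)\<^sup>2 * T' h"

lemma mass_has_derivative: "(wave_mass period u has_derivative M') (at p0)"
proof -
  have "((\<lambda>p. integral {0..period p} (\<lambda>t. u p t)) has_derivative
      (\<lambda>h. integral {0..T0} (\<lambda>t. 1 * w h t) + um p0 * T' h)) (at p0)"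
    by (rule integral_period_has_derivative[where \<phi> = "\<lambda>y. y" and \<phi>' = "\<lambda>_. 1" and B = 0])
      (auto intro: continuous_intros)
  then show ?thesis unfolding wave_mass_def[abs_def] M'_def[abs_def] by simp
qed

lemma momentum_has_derivative: "(wave_momentum period u has_derivative P') (at p0)"
  unfolding wave_momentum_def[abs_def] P'_def[abs_def]
proof (rule integral_period_has_derivative[where \<phi> = "\<lambda>y. y\<^sup>2" and \<phi>' = "\<lambda>y. 2 * y" and B = 1])
  fix y z :: real
  have "z\<^sup>2 - y\<^sup>2 - 2 * y * (z - y) = (z - y)\<^sup>2" by (simp add: power2_eq_square algebra_simps)
  then show "\<bar>z\<^sup>2 - y\<^sup>2 - 2 * y * (z - y)\<bar> \<le> 1 * (z - y)\<^sup>2" by simp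
qed (auto intro!: continuous_intros)

end

section \<open>Solutions of the spectral problem for small eigenvalues\<close>

lemma has_derivative_vec:
  fixes f :: "'a::real_normed_vector \<Rightarrow> 'b::real_normed_vector ^ 'n"
  assumes "\<And>i. ((\<lambda>x. f x $ i) has_derivative (\<lambda>h. f' h $ i)) (at x within S)"
  shows "(f has_derivative f') (at x within S)"
proof -
  have bl: "bounded_linear (axis i :: 'b \<Rightarrow> 'b ^ 'n)" for i
  proof (rule bounded_linear_intro)
    fix x y :: 'b and r :: real
    show "axis i (x + y) = (axis i x + axis i y :: 'b ^ 'n)" "axis i (r *\<^sub>R x) = (r *\<^sub>R axis i x :: 'b ^ 'n)"
      by (simp_all add: vec_eq_iff axis_def)
    show "norm (axis i x :: 'b ^ 'n) \<le> norm x * 1"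
      unfolding norm_vec_def axis_def using L2_set_le_sum[of UNIV "\<lambda>j. norm (if j = i then x else 0)"]
      by (simp add: if_distrib cong: if_cong)
  qed
  have decomp: "v = (\<Sum>i\<in>UNIV. axis i (v $ i))" for v :: "'b ^ 'n"
    by (simp add: vec_eq_iff axis_def)
  have "((\<lambda>x. \<Sum>i\<in>UNIV. axis i (f x $ i)) has_derivative (\<lambda>h. \<Sum>i\<in>UNIV. axis i (f' h $ i))) (at x within S)"
    by (intro has_derivative_sum bounded_linear.has_derivative[OF bl] assms)
  then show ?thesis by (simp add: decomp[symmetric])
qed

lemma has_vector_derivative_vec3:
  assumes "(a has_vector_derivative a') (at x within S)" "(b has_vector_derivative b') (at x within S)"
    "(c has_vector_derivative c') (at x within S)"
  shows "((\<lambda>x. vector [a x, b x, c x] :: 'b::real_normed_vector ^ 3) has_vector_derivative vector [a', b', c']) (at x within S)"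
  unfolding has_vector_derivative_def
proof (rule has_derivative_vec)
  fix i :: 3
  show "((\<lambda>x. vector [a x, b x, c x] $ i) has_derivative (\<lambda>h. (h *\<^sub>R vector [a', b', c']) $ i)) (at x within S)"
    using assms exhaust_3[of i] unfolding has_vector_derivative_def by auto
qed

lemma norm_vec3_le: "norm (v :: 'b::real_normed_vector ^ 3) \<le> norm (v $ 1) + norm (v $ 2) + norm (v $ 3)"
  unfolding norm_vec_def using L2_set_le_sum[of UNIV "\<lambda>i. norm (v $ i)"] by (simp add: sum_3)

lemma norm_component_le: "norm (v $ i :: 'b::real_normed_vector) \<le> norm (v :: 'b ^ 'n)"
  by (rule Finite_Cartesian_Product.norm_nth_le)

lemma increment_bound:
  fixes z :: "real \<Rightarrow> 'a::real_inner"
  assumes "\<And>x. x \<in> {0..b} \<Longrightarrow> (z has_vector_derivative z' x) (at x within {0..b})"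
    and "\<And>x. x \<in> {0..b} \<Longrightarrow> norm (z' x) \<le> d" and "x \<in> {0..b}"
  shows "norm (z x - z 0) \<le> exp b * (1 + b) * d"
proof -
  have "0 \<le> d" using assms(2)[of x] assms(3) norm_ge_zero order.trans by blast
  have "norm (z x - z 0) \<le> exp ((2 * \<bar>0\<bar> + 1) * b) * (1 + b) * (norm (z 0 - z 0) + d)"
  proof (rule gronwall_norm[where z' = z'])
    fix x assume x: "x \<in> {0..b}"
    show "((\<lambda>x. z x - z 0) has_vector_derivative z' x) (at x within {0..b})"
      using assms(1)[OF x] by (simp add: has_vector_derivative_diff_const)
    show "norm (z' x) \<le> 0 * norm (z x - z 0) + d" using assms(2)[OF x] by simp
  qed fact+
  then show ?thesis by simp
qed

locale wave_evans = wave_variation +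
  fixes \<Phi> :: "real \<Rightarrow> complex \<Rightarrow> complex ^ 3 ^ 3"
  assumes Phi: "is_fundamental_solution (spectral_matrix f U (p0 $ 3)) \<Phi>"
begin

definition Hv :: "complex \<Rightarrow> real \<Rightarrow> complex ^ 3 \<Rightarrow> complex ^ 3" where
  "Hv \<mu> x Y = vector [Y $ 2, Y $ 3, (- \<mu> + of_real (q' x)) * Y $ 1 + of_real (q x) * Y $ 2]"

lemma Hv_diff: "Hv \<mu> x (Y - Z) = Hv \<mu> x Y - Hv \<mu> x Z"
  by (simp add: Hv_def vec_eq_iff forall_3 algebra_simps)

lemma Phi_deriv: "((\<lambda>x. \<Phi> x \<mu> *v y) has_vector_derivative Hv \<mu> x (\<Phi> x \<mu> *v y)) (at x within S)"
  using fundamental_solution_vec(1)[OF Phi] unfolding Hv_def Let_def .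

lemma Phi_0: "\<Phi> 0 \<mu> *v y = y"
  by (rule fundamental_solution_vec(2)[OF Phi])

lemma continuous_bounded:
  assumes "continuous_on UNIV (\<phi> :: real \<Rightarrow> real)"
  obtains B where "B \<ge> 0" "\<And>x. x \<in> {0..b} \<Longrightarrow> \<bar>\<phi> x\<bar> \<le> B"
proof -
  have "compact (\<phi> ` {0..b})"
    by (intro compact_continuous_image continuous_on_subset[OF assms]) auto
  then obtain B where "\<And>x. x \<in> {0..b} \<Longrightarrow> \<bar>\<phi> x\<bar> \<le> B"
    using compact_imp_bounded bounded_iff by (metis (no_types, lifting) imageI real_norm_def)
  then have "\<bar>\<phi> x\<bar> \<le> \<bar>B\<bar>" if "x \<in> {0..b}" for x using that by fastforce
  then show thesis by (intro that[of "\<bar>B\<bar>"]) auto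
qed

lemma q_cont: "continuous_on UNIV q"
  using q_deriv by (rule DERIV_continuous_on)

lemma q'_cont: "continuous_on UNIV q'"
  unfolding q'_def
  by (intro continuous_intros continuous_on_compose2[OF f''_cont u_cont[OF p0]] u'_cont[OF p0]) auto

text \<open>One constant serves all \<open>norm \<mu> \<le> 1\<close>: a trial solution whose
  residual has size \<open>d\<close> is within \<open>K * d\<close> of the true solution with the
  same initial data. Expansions in \<open>\<mu>\<close> thus reduce to computing residuals.\<close>

lemma approximate_solution:
  obtains K where "K \<ge> 0"
    "\<And>\<mu> Ya Ya' d x. norm \<mu> \<le> 1 \<Longrightarrow> 0 \<le> d \<Longrightarrow>
      (\<And>x. x \<in> {0..b} \<Longrightarrow> (Ya has_vector_derivative Ya' x) (at x within {0..b})) \<Longrightarrow>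
      (\<And>x. x \<in> {0..b} \<Longrightarrow> norm (Hv \<mu> x (Ya x) - Ya' x) \<le> d) \<Longrightarrow>
      x \<in> {0..b} \<Longrightarrow> norm (\<Phi> x \<mu> *v Ya 0 - Ya x) \<le> K * d"
proof -
  obtain Q where Q: "Q \<ge> 0" "\<And>x. x \<in> {0..b} \<Longrightarrow> \<bar>q x\<bar> \<le> Q" using continuous_bounded[OF q_cont] by blast
  obtain Q' where Q': "Q' \<ge> 0" "\<And>x. x \<in> {0..b} \<Longrightarrow> \<bar>q' x\<bar> \<le> Q'" using continuous_bounded[OF q'_cont] by blast
  define L where "L = 3 + Q' + Q"
  have Hv_bound: "norm (Hv \<mu> x Y) \<le> L * norm Y" if "norm \<mu> \<le> 1" "x \<in> {0..b}" for \<mu> x Y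
  proof -
    have "norm (Hv \<mu> x Y) \<le> norm (Y $ 2) + norm (Y $ 3) + norm ((- \<mu> + of_real (q' x)) * Y $ 1 + of_real (q x) * Y $ 2)"
      using norm_vec3_le[of "Hv \<mu> x Y"] by (simp add: Hv_def)
    also have "norm ((- \<mu> + of_real (q' x)) * Y $ 1 + of_real (q x) * Y $ 2)
        \<le> norm ((- \<mu> + of_real (q' x)) * Y $ 1) + norm (of_real (q x) * Y $ 2)"
      by (rule norm_triangle_ineq)
    also have "norm ((- \<mu> + of_real (q' x)) * Y $ 1) \<le> (1 + Q') * norm Y"
      unfolding norm_mult
    proof (rule mult_mono[OF _ norm_component_le])
      have "norm (- \<mu> + of_real (q' x)) \<le> norm \<mu> + \<bar>q' x\<bar>"
        using norm_triangle_ineq[of "- \<mu>" "of_real (q' x)"] by simp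
      then show "norm (- \<mu> + of_real (q' x)) \<le> 1 + Q'" using that Q'(2)[OF that(2)] by simp
    qed (use Q' in auto)
    also have "norm (of_real (q x) * Y $ 2) \<le> Q * norm Y"
      unfolding norm_mult by (rule mult_mono[OF _ norm_component_le]) (use Q that in auto)
    finally show ?thesis
      using norm_component_le[of Y 2] norm_component_le[of Y 3] by (simp add: L_def algebra_simps)
  qed
  define K where "K = exp ((2 * \<bar>L\<bar> + 1) * b) * (1 + b)"
  have "norm (\<Phi> x \<mu> *v Ya 0 - Ya x) \<le> K * d"
    if \<mu>: "norm \<mu> \<le> 1" and "0 \<le> d"
      and Ya: "\<And>x. x \<in> {0..b} \<Longrightarrow> (Ya has_vector_derivative Ya' x) (at x within {0..b})"
      and res: "\<And>x. x \<in> {0..b} \<Longrightarrow> norm (Hv \<mu> x (Ya x) - Ya' x) \<le> d"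
      and x: "x \<in> {0..b}" for \<mu> Ya Ya' d x
  proof -
    have "norm (\<Phi> x \<mu> *v Ya 0 - Ya x) \<le> K * (norm (\<Phi> 0 \<mu> *v Ya 0 - Ya 0) + d)"
      unfolding K_def
    proof (rule gronwall_norm[OF _ _ \<open>0 \<le> d\<close> x])
      fix x assume x: "x \<in> {0..b}"
      show "((\<lambda>x. \<Phi> x \<mu> *v Ya 0 - Ya x) has_vector_derivative Hv \<mu> x (\<Phi> x \<mu> *v Ya 0) - Ya' x) (at x within {0..b})"
        by (intro has_vector_derivative_diff Phi_deriv Ya x)
      have "Hv \<mu> x (\<Phi> x \<mu> *v Ya 0) - Ya' x
          = Hv \<mu> x (\<Phi> x \<mu> *v Ya 0 - Ya x) + (Hv \<mu> x (Ya x) - Ya' x)"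
        by (simp add: Hv_diff)
      then show "norm (Hv \<mu> x (\<Phi> x \<mu> *v Ya 0) - Ya' x) \<le> L * norm (\<Phi> x \<mu> *v Ya 0 - Ya x) + d"
        by (simp only:) (rule norm_triangle_mono[OF Hv_bound[OF \<mu> x] res[OF x]])
    qed
    then show ?thesis by (simp add: Phi_0)
  qed
  moreover have "K \<ge> 0" using b_pos by (simp add: K_def)
  ultimately show thesis by (rule that[rotated])
qed

text \<open>The functionals \<open>L[u0] v\<close> and \<open>u0 L[u0] v - u0'' v + u0' v'\<close>, whose derivatives along solutions
  of \<open>(L[u0] v)' = \<mu> v\<close> are \<open>\<mu> v\<close> and \<open>\<mu> u0 v\<close>. They are the linearizations of the local
  conservation laws for mass and momentum.\<close>

definition ell2 :: "real \<Rightarrow> complex ^ 3 \<Rightarrow> complex" where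
  "ell2 x y = - (y $ 3) + of_real (q x) * y $ 1"
definition ell3 :: "real \<Rightarrow> complex ^ 3 \<Rightarrow> complex" where
  "ell3 x y = of_real (U x) * ell2 x y - of_real (accel p0 (U x)) * y $ 1 + of_real (U' x) * y $ 2"

lemma Phi_component_deriv:
  "((\<lambda>x. (\<Phi> x \<mu> *v y) $ i) has_vector_derivative Hv \<mu> x (\<Phi> x \<mu> *v y) $ i) (at x within S)"
  by (rule bounded_linear.has_vector_derivative[OF bounded_linear_vec_nth Phi_deriv])

lemma accel_U_deriv: "((\<lambda>x. accel p0 (U x)) has_real_derivative q x * U' x) (at x within S)"
  unfolding q_def by (rule has_field_derivative_at_within[OF DERIV_chain2[OF accel_deriv u_deriv[OF p0]]])

lemma ell2_deriv:
  "((\<lambda>x. ell2 x (\<Phi> x \<mu> *v y)) has_vector_derivative \<mu> * (\<Phi> x \<mu> *v y) $ 1) (at x within S)"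
proof -
  note d = has_vector_derivative_minus[OF Phi_component_deriv[of \<mu> y 3 x S]]
    has_vector_derivative_mult[OF has_vector_derivative_of_real[OF q_deriv] Phi_component_deriv[of \<mu> y 1 x S]]
  from has_vector_derivative_add[OF d] show ?thesis
    unfolding ell2_def by (simp add: Hv_def algebra_simps)
qed

text \<open>Apart from \<open>U\<close> times the derivative of \<open>ell2\<close>, all terms
  cancel by \<open>accel_U_deriv\<close>, the relation \<open>(u0_xx)_x = q u0_x\<close>, which says
  that the translation mode \<open>u0_x\<close> lies in the kernel of \<open>L[u0]\<close>.\<close>

lemma ell3_deriv:
  "((\<lambda>x. ell3 x (\<Phi> x \<mu> *v y)) has_vector_derivative \<mu> * (of_real (U x) * (\<Phi> x \<mu> *v y) $ 1)) (at x within S)"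
proof -
  note d = has_vector_derivative_mult[OF has_vector_derivative_of_real[OF has_field_derivative_at_within[OF u_deriv[OF p0]]] ell2_deriv[of \<mu> y x S]]
    has_vector_derivative_mult[OF has_vector_derivative_of_real[OF accel_U_deriv] Phi_component_deriv[of \<mu> y 1 x S]]
    has_vector_derivative_mult[OF has_vector_derivative_of_real[OF has_field_derivative_at_within[OF u_deriv2[OF p0]]] Phi_component_deriv[of \<mu> y 2 x S]]
  from has_vector_derivative_add[OF has_vector_derivative_diff[OF d(1,2)] d(3)] show ?thesis
    unfolding ell3_def by (simp add: Hv_def ell2_def algebra_simps)
qed

text \<open>Here a factor \<open>norm \<mu>\<close> is gained: the pointwise error \<open>d\<close>
  of the approximation \<open>a\<close> enters the flux increments only as
  \<open>norm \<mu> * d\<close>. The antiderivatives \<open>A2\<close> and \<open>A3\<close> stand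
  for the integrals of \<open>a\<close> and \<open>U a\<close>.\<close>

lemma conserved_increments:
  obtains K where "K \<ge> 0"
    "\<And>\<mu> y a A2 A3 d. (\<And>x. x \<in> {0..b} \<Longrightarrow> (A2 has_vector_derivative a x) (at x within {0..b})) \<Longrightarrow>
      (\<And>x. x \<in> {0..b} \<Longrightarrow> (A3 has_vector_derivative of_real (U x) * a x) (at x within {0..b})) \<Longrightarrow>
      (\<And>x. x \<in> {0..b} \<Longrightarrow> norm ((\<Phi> x \<mu> *v y) $ 1 - a x) \<le> d) \<Longrightarrow>
      norm (ell2 T0 (\<Phi> T0 \<mu> *v y) - ell2 0 y - \<mu> * (A2 T0 - A2 0)) \<le> K * (norm \<mu> * d) \<and>
      norm (ell3 T0 (\<Phi> T0 \<mu> *v y) - ell3 0 y - \<mu> * (A3 T0 - A3 0)) \<le> K * (norm \<mu> * d)"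
proof -
  obtain R where R: "R \<ge> 0" "\<And>x. x \<in> {0..b} \<Longrightarrow> \<bar>U x\<bar> \<le> R" using continuous_bounded[OF u_cont[OF p0]] by blast
  have T0: "T0 \<in> {0..b}" using T0_in by auto
  define K where "K = exp b * (1 + b) * (1 + R)"
  have e: "exp b * (1 + b) \<ge> 0" using b_pos by simp
  show thesis
  proof (rule that)
    show "K \<ge> 0" unfolding K_def using e R(1) by simp
    fix \<mu> y a A2 A3 d
    assume A2: "\<And>x. x \<in> {0..b} \<Longrightarrow> (A2 has_vector_derivative a x) (at x within {0..b})"
      and A3: "\<And>x. x \<in> {0..b} \<Longrightarrow> (A3 has_vector_derivative of_real (U x) * a x) (at x within {0..b})"
      and d: "\<And>x. x \<in> {0..b} \<Longrightarrow> norm ((\<Phi> x \<mu> *v y) $ 1 - a x) \<le> d"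
    let ?Y = "\<lambda>x. \<Phi> x \<mu> *v y"
    have "0 \<le> d" using d[OF T0] norm_ge_zero order.trans by blast
    have "norm ((ell2 T0 (?Y T0) - \<mu> * A2 T0) - (ell2 0 (?Y 0) - \<mu> * A2 0)) \<le> exp b * (1 + b) * (norm \<mu> * d)"
    proof (rule increment_bound[OF _ _ T0])
      fix x assume x: "x \<in> {0..b}"
      show "((\<lambda>x. ell2 x (?Y x) - \<mu> * A2 x) has_vector_derivative \<mu> * (?Y x $ 1) - \<mu> * a x) (at x within {0..b})"
        by (intro has_vector_derivative_diff ell2_deriv has_vector_derivative_mult_right A2 x)
      show "norm (\<mu> * (?Y x $ 1) - \<mu> * a x) \<le> norm \<mu> * d"
        unfolding right_diff_distrib[symmetric] norm_mult by (intro mult_left_mono d x) auto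
    qed
    moreover have "norm ((ell3 T0 (?Y T0) - \<mu> * A3 T0) - (ell3 0 (?Y 0) - \<mu> * A3 0)) \<le> exp b * (1 + b) * (norm \<mu> * (R * d))"
    proof (rule increment_bound[OF _ _ T0])
      fix x assume x: "x \<in> {0..b}"
      show "((\<lambda>x. ell3 x (?Y x) - \<mu> * A3 x) has_vector_derivative \<mu> * (of_real (U x) * ?Y x $ 1) - \<mu> * (of_real (U x) * a x)) (at x within {0..b})"
        by (intro has_vector_derivative_diff ell3_deriv has_vector_derivative_mult_right A3 x)
      have "norm (of_real (U x) * (?Y x $ 1 - a x)) \<le> R * d"
        unfolding norm_mult by (intro mult_mono d x) (use R x in auto)
      then show "norm (\<mu> * (of_real (U x) * ?Y x $ 1) - \<mu> * (of_real (U x) * a x)) \<le> norm \<mu> * (R * d)"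
        unfolding right_diff_distrib[symmetric] norm_mult[of \<mu>] by (intro mult_left_mono) auto
    qed
    moreover have "exp b * (1 + b) * (norm \<mu> * d) \<le> K * (norm \<mu> * d)"
      "exp b * (1 + b) * (norm \<mu> * (R * d)) \<le> K * (norm \<mu> * d)"
    proof -
      have n: "0 \<le> exp b * (1 + b) * (norm \<mu> * d)" "0 \<le> exp b * (1 + b) * (norm \<mu> * (R * d))"
        using e R(1) \<open>0 \<le> d\<close> by (auto intro!: mult_nonneg_nonneg)
      have "K * (norm \<mu> * d) = exp b * (1 + b) * (norm \<mu> * d) + exp b * (1 + b) * (norm \<mu> * (R * d))"
        by (simp add: K_def algebra_simps)
      with n show "exp b * (1 + b) * (norm \<mu> * d) \<le> K * (norm \<mu> * d)"
        "exp b * (1 + b) * (norm \<mu> * (R * d)) \<le> K * (norm \<mu> * d)" by linarith+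
    qed
    ultimately show "norm (ell2 T0 (?Y T0) - ell2 0 y - \<mu> * (A2 T0 - A2 0)) \<le> K * (norm \<mu> * d) \<and>
      norm (ell3 T0 (?Y T0) - ell3 0 y - \<mu> * (A3 T0 - A3 0)) \<le> K * (norm \<mu> * d)"
      by (simp add: Phi_0 algebra_simps)
  qed
qed

text \<open>The vector \<open>(v, v_x, v_xx)\<close> for \<open>v = w h\<close>, with the second
  derivative replaced by the right-hand side of the variational equation; \<open>yu\<close> is the
  same for \<open>v = u0_x\<close>.\<close>

definition yw :: "real ^ 3 \<Rightarrow> real \<Rightarrow> complex ^ 3" where
  "yw h x = vector [of_real (w h x), of_real (w' h x), of_real (q x * w h x + h $ 1 + h $ 3 * U x)]"
definition yu :: "real \<Rightarrow> complex ^ 3" where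
  "yu x = vector [of_real (U' x), of_real (accel p0 (U x)), of_real (q x * U' x)]"

text \<open>The extra term shows that the speed derivative is only a generalized kernel element:
  \<open>(L[u0] u_c)_x = - u0_x\<close>. It is what makes \<open>u_x - \<mu> u_c\<close> a solution
  up to the residual \<open>\<mu>^2 u_c\<close>.\<close>

lemma yw_deriv:
  assumes x: "x \<in> {0..b}"
  shows "(yw h has_vector_derivative (Hv 0 x (yw h x) + vector [0, 0, of_real (h $ 3 * U' x)])) (at x within {0..b})"
proof -
  have "((\<lambda>x. q x * w h x + h $ 1 + h $ 3 * U x) has_real_derivative
      (q' x * w h x + q x * w' h x) + h $ 3 * U' x) (at x within {0..b})"
    by (auto intro!: derivative_eq_intros q_deriv w_deriv[OF x] has_field_derivative_at_within[OF u_deriv[OF p0]])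
  from has_vector_derivative_vec3[OF has_vector_derivative_of_real[OF w_deriv[OF x, of h]]
      has_vector_derivative_of_real[OF w'_deriv[OF x, of h]] has_vector_derivative_of_real[OF this]]
  have "(yw h has_vector_derivative vector [of_real (w' h x), of_real (q x * w h x + h $ 1 + h $ 3 * U x),
     of_real ((q' x * w h x + q x * w' h x) + h $ 3 * U' x)]) (at x within {0..b})"
    unfolding yw_def[abs_def] .
  also have "vector [of_real (w' h x), of_real (q x * w h x + h $ 1 + h $ 3 * U x),
     of_real ((q' x * w h x + q x * w' h x) + h $ 3 * U' x)] = Hv 0 x (yw h x) + vector [0, 0, of_real (h $ 3 * U' x)]"
    by (simp add: vec_eq_iff forall_3 Hv_def yw_def)
  finally show ?thesis .
qed

lemma yu_deriv: "(yu has_vector_derivative Hv 0 x (yu x)) (at x within {0..b})"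
proof -
  have "((\<lambda>x. q x * U' x) has_real_derivative q' x * U' x + q x * accel p0 (U x)) (at x within {0..b})"
    by (auto intro!: derivative_eq_intros q_deriv has_field_derivative_at_within[OF u_deriv2[OF p0]])
  from has_vector_derivative_vec3[OF has_vector_derivative_of_real[OF has_field_derivative_at_within[OF u_deriv2[OF p0]]]
      has_vector_derivative_of_real[OF accel_U_deriv] has_vector_derivative_of_real[OF this]]
  have "(yu has_vector_derivative vector [of_real (accel p0 (U x)), of_real (q x * U' x),
     of_real (q' x * U' x + q x * accel p0 (U x))]) (at x within {0..b})"
    unfolding yu_def[abs_def] .
  also have "vector [of_real (accel p0 (U x)), of_real (q x * U' x),
     of_real (q' x * U' x + q x * accel p0 (U x))] = Hv 0 x (yu x)"
    by (simp add: vec_eq_iff forall_3 Hv_def yu_def)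
  finally show ?thesis .
qed

text \<open>The formula for \<open>um'\<close> makes the flux coordinates at the turning point
  explicit: \<open>u_a\<close> and \<open>u_E\<close> have \<open>(ell2, ell3)\<close> equal to
  \<open>(-1, 0)\<close> and \<open>(0, 1)\<close>, so they are aligned with the coordinate
  axes.\<close>

lemma ell_yw:
  "ell2 x (yw h x) = - of_real (h $ 1 + h $ 3 * U x)"
  "ell3 0 (yw h 0) = of_real (h $ 2 - h $ 3 * (um p0)\<^sup>2 / 2)"
proof -
  show e2: "ell2 x (yw h x) = - of_real (h $ 1 + h $ 3 * U x)" for x
    by (simp add: ell2_def yw_def)
  have "g * um' h = - (h $ 1 * um p0 + h $ 3 * (um p0)\<^sup>2 / 2 + h $ 2)"
    using g_pos by (simp add: um'_def)
  then have "um p0 * (h $ 1 + h $ 3 * um p0) + g * um' h = - (h $ 2 - h $ 3 * (um p0)\<^sup>2 / 2)"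
    by (simp add: power2_eq_square algebra_simps)
  then have "complex_of_real (um p0 * (h $ 1 + h $ 3 * um p0) + g * um' h) = - of_real (h $ 2 - h $ 3 * (um p0)\<^sup>2 / 2)"
    by (simp only: of_real_minus)
  moreover have "ell3 0 (yw h 0) = - complex_of_real (um p0 * (h $ 1 + h $ 3 * um p0) + g * um' h)"
    unfolding ell3_def e2 by (simp add: yw_def u_0[OF p0] u'_0[OF p0] g_def w_0 algebra_simps)
  ultimately show "ell3 0 (yw h 0) = of_real (h $ 2 - h $ 3 * (um p0)\<^sup>2 / 2)" by simp
qed

lemma ell_yu: "ell2 x (yu x) = 0" "ell3 x (yu x) = 0"
  by (simp_all add: ell3_def ell2_def yu_def)

end

section \<open>Orders of vanishing at the origin\<close>

definition order_le :: "nat \<Rightarrow> (complex \<times> real \<Rightarrow> complex) \<Rightarrow> bool" where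
  "order_le k r \<longleftrightarrow> (\<exists>C. \<forall>\<^sub>F z in nhds (0, 0). norm (r z) \<le> C * (norm (fst z) + \<bar>snd z\<bar>) ^ k)"

text \<open>Equality modulo terms of order \<open>k + 1\<close>. The comparison function
  \<open>a0\<close> has order at least \<open>k\<close> and may vanish to higher order, so no entry
  has to be checked for being nonzero. Orders add under multiplication.\<close>

definition approx :: "nat \<Rightarrow> (complex \<times> real \<Rightarrow> complex) \<Rightarrow> (complex \<times> real \<Rightarrow> complex) \<Rightarrow> bool" where
  "approx k a a0 \<longleftrightarrow> order_le k a0 \<and> order_le (Suc k) (\<lambda>z. a z - a0 z)"

lemma eventually_small: "\<forall>\<^sub>F z in nhds (0 :: complex, 0 :: real). norm (fst z) + \<bar>snd z\<bar> \<le> 1"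
proof -
  have "((\<lambda>z. norm (fst z) + \<bar>snd z\<bar>) \<longlongrightarrow> norm (fst (0 :: complex, 0 :: real)) + \<bar>snd (0 :: complex, 0 :: real)\<bar>)
      (nhds (0 :: complex, 0 :: real))"
    by (intro tendsto_intros filterlim_ident)
  then have "\<forall>\<^sub>F z in nhds (0 :: complex, 0 :: real). norm (fst z) + \<bar>snd z\<bar> < 1"
    by (rule order_tendstoD) simp
  then show ?thesis by (rule eventually_mono) simp
qed

lemma order_leI:
  assumes "\<And>\<mu> \<kappa>. norm \<mu> \<le> 1 \<Longrightarrow> \<bar>\<kappa>\<bar> \<le> 1 \<Longrightarrow> norm (r (\<mu>, \<kappa>)) \<le> C * (norm \<mu> + \<bar>\<kappa>\<bar>) ^ k"
  shows "order_le k r"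
  unfolding order_le_def
proof (intro exI[of _ C])
  show "\<forall>\<^sub>F z in nhds (0, 0). norm (r z) \<le> C * (norm (fst z) + \<bar>snd z\<bar>) ^ k"
    using eventually_small
  proof eventually_elim
    case (elim z)
    have "norm (fst z) \<le> 1" "\<bar>snd z\<bar> \<le> 1"
      using elim norm_ge_zero[of "fst z"] abs_ge_zero[of "snd z"] by linarith+
    then show ?case using assms[of "fst z" "snd z"] by simp
  qed
qed

lemma order_le_nonneg:
  assumes "order_le k r"
  obtains C where "C \<ge> 0" "\<forall>\<^sub>F z in nhds (0, 0). norm (r z) \<le> C * (norm (fst z) + \<bar>snd z\<bar>) ^ k"
proof -
  obtain C where C: "\<forall>\<^sub>F z in nhds (0, 0). norm (r z) \<le> C * (norm (fst z) + \<bar>snd z\<bar>) ^ k"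
    using assms unfolding order_le_def by blast
  have "\<forall>\<^sub>F z in nhds (0, 0). norm (r z) \<le> \<bar>C\<bar> * (norm (fst z) + \<bar>snd z\<bar>) ^ k"
    using C
  proof eventually_elim
    case (elim z)
    also have "C * (norm (fst z) + \<bar>snd z\<bar>) ^ k \<le> \<bar>C\<bar> * (norm (fst z) + \<bar>snd z\<bar>) ^ k"
      by (intro mult_right_mono) auto
    finally show ?case .
  qed
  then show thesis by (intro that[of "\<bar>C\<bar>"]) auto
qed

lemma order_le_Suc: assumes "order_le (Suc k) r" shows "order_le k r"
proof -
  from order_le_nonneg[OF assms] obtain C where C: "C \<ge> 0"
    "\<forall>\<^sub>F z in nhds (0, 0). norm (r z) \<le> C * (norm (fst z) + \<bar>snd z\<bar>) ^ Suc k" .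
  have "\<forall>\<^sub>F z in nhds (0, 0). norm (r z) \<le> C * (norm (fst z) + \<bar>snd z\<bar>) ^ k"
    using C(2) eventually_small
  proof eventually_elim
    case (elim z)
    note elim(1)
    also have "C * (norm (fst z) + \<bar>snd z\<bar>) ^ Suc k \<le> C * (norm (fst z) + \<bar>snd z\<bar>) ^ k"
      using elim(2) C(1) by (intro mult_left_mono power_decreasing) auto
    finally show ?case .
  qed
  then show ?thesis unfolding order_le_def by blast
qed

lemma order_le_add: assumes "order_le k r" "order_le k s" shows "order_le k (\<lambda>z. r z + s z)"
proof -
  from assms obtain C D where
    "\<forall>\<^sub>F z in nhds (0, 0). norm (r z) \<le> C * (norm (fst z) + \<bar>snd z\<bar>) ^ k"
    "\<forall>\<^sub>F z in nhds (0, 0). norm (s z) \<le> D * (norm (fst z) + \<bar>snd z\<bar>) ^ k"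
    unfolding order_le_def by blast
  then have "\<forall>\<^sub>F z in nhds (0, 0). norm (r z + s z) \<le> (C + D) * (norm (fst z) + \<bar>snd z\<bar>) ^ k"
    by eventually_elim (simp add: distrib_right norm_triangle_mono)
  then show ?thesis unfolding order_le_def by blast
qed

lemma order_le_minus: "order_le k r \<Longrightarrow> order_le k (\<lambda>z. - r z)"
  unfolding order_le_def by simp

lemma order_le_diff: "order_le k r \<Longrightarrow> order_le k s \<Longrightarrow> order_le k (\<lambda>z. r z - s z)"
  using order_le_add[OF _ order_le_minus, of k r s] by simp

lemma order_le_mult: assumes "order_le j r" "order_le k s" shows "order_le (j + k) (\<lambda>z. r z * s z)"
proof -
  from order_le_nonneg[OF assms(1)] obtain C where C: "C \<ge> 0"
    "\<forall>\<^sub>F z in nhds (0, 0). norm (r z) \<le> C * (norm (fst z) + \<bar>snd z\<bar>) ^ j" .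
  from order_le_nonneg[OF assms(2)] obtain D where D: "D \<ge> 0"
    "\<forall>\<^sub>F z in nhds (0, 0). norm (s z) \<le> D * (norm (fst z) + \<bar>snd z\<bar>) ^ k" .
  from C(2) D(2) have "\<forall>\<^sub>F z in nhds (0, 0). norm (r z * s z) \<le> (C * D) * (norm (fst z) + \<bar>snd z\<bar>) ^ (j + k)"
  proof eventually_elim
    case (elim z)
    have "norm (r z * s z) \<le> (C * (norm (fst z) + \<bar>snd z\<bar>) ^ j) * (D * (norm (fst z) + \<bar>snd z\<bar>) ^ k)"
      unfolding norm_mult using elim C(1) by (intro mult_mono) auto
    then show ?case by (simp add: power_add mult_ac)
  qed
  then show ?thesis unfolding order_le_def by blast
qed

lemma order_le_const: "order_le 0 (\<lambda>z. c)"
  by (rule order_leI[of _ "norm c"]) simp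

lemma order_le_cmult: "order_le k r \<Longrightarrow> order_le k (\<lambda>z. c * r z)"
  using order_le_mult[OF order_le_const, of k r c] by simp

lemma order_le_fst: "order_le (Suc 0) (\<lambda>z. fst z)"
  by (rule order_leI[of _ 1]) simp

lemma order_le_snd: "order_le (Suc 0) (\<lambda>z. of_real (snd z))"
  by (rule order_leI[of _ 1]) simp

lemma order_le_exp: "order_le (Suc (Suc 0)) (\<lambda>z. exp (\<i> * of_real (snd z)) - (1 + \<i> * of_real (snd z)))"
proof (rule order_leI[of _ 1])
  fix \<mu> :: complex and \<kappa> :: real
  have "norm (exp (\<i> * of_real \<kappa>) - (\<Sum>k\<le>1. (\<i> * of_real \<kappa>) ^ k / fact k)) \<le>
      exp \<bar>Re (\<i> * of_real \<kappa>)\<bar> * (norm (\<i> * complex_of_real \<kappa>)) ^ Suc 1 / fact 1"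
    by (rule Taylor_exp)
  then have "norm (exp (\<i> * of_real \<kappa>) - (1 + \<i> * of_real \<kappa>)) \<le> \<bar>\<kappa>\<bar> ^ 2"
    by (simp add: norm_mult power2_eq_square)
  also have "\<dots> \<le> (norm \<mu> + \<bar>\<kappa>\<bar>) ^ 2" by (intro power_mono) auto
  finally show "norm (exp (\<i> * of_real (snd (\<mu>, \<kappa>))) - (1 + \<i> * of_real (snd (\<mu>, \<kappa>))))
      \<le> 1 * (norm \<mu> + \<bar>\<kappa>\<bar>) ^ Suc (Suc 0)" by (simp add: numeral_2_eq_2)
qed

lemma approx_add: "approx k a a0 \<Longrightarrow> approx k c c0 \<Longrightarrow> approx k (\<lambda>z. a z + c z) (\<lambda>z. a0 z + c0 z)"
  unfolding approx_def using order_le_add[of "Suc k" "\<lambda>z. a z - a0 z" "\<lambda>z. c z - c0 z"]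
  by (auto intro: order_le_add simp: algebra_simps)

lemma approx_diff: "approx k a a0 \<Longrightarrow> approx k c c0 \<Longrightarrow> approx k (\<lambda>z. a z - c z) (\<lambda>z. a0 z - c0 z)"
  unfolding approx_def using order_le_diff[of "Suc k" "\<lambda>z. a z - a0 z" "\<lambda>z. c z - c0 z"]
  by (auto intro: order_le_diff simp: algebra_simps)

lemma approx_mult:
  assumes "approx j a a0" "approx k c c0"
  shows "approx (j + k) (\<lambda>z. a z * c z) (\<lambda>z. a0 z * c0 z)"
proof -
  have o: "order_le j a0" "order_le (Suc j) (\<lambda>z. a z - a0 z)" "order_le k c0" "order_le (Suc k) (\<lambda>z. c z - c0 z)"
    using assms by (auto simp: approx_def)
  have "order_le (Suc (j + k)) (\<lambda>z. (a z - a0 z) * (c z - c0 z))"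
    using order_le_mult[OF o(2) o(4)] by (auto intro: order_le_Suc)
  moreover have "order_le (Suc (j + k)) (\<lambda>z. (a z - a0 z) * c0 z)"
    using order_le_mult[OF o(2) o(3)] by simp
  moreover have "order_le (Suc (j + k)) (\<lambda>z. a0 z * (c z - c0 z))"
    using order_le_mult[OF o(1) o(4)] by simp
  ultimately have "order_le (Suc (j + k))
      (\<lambda>z. (a z - a0 z) * (c z - c0 z) + (a z - a0 z) * c0 z + a0 z * (c z - c0 z))"
    by (intro order_le_add)
  then show ?thesis
    unfolding approx_def using order_le_mult[OF o(1) o(3)] by (simp add: algebra_simps)
qed

text \<open>The orders are additive: row weights \<open>0, 1, 1\<close> plus column weights
  \<open>1, 0, 0\<close>. Every product in the determinant picks each row and each column once, so
  all six have total order \<open>3\<close>.\<close>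

lemma approx_det:
  fixes A A0 :: "complex \<times> real \<Rightarrow> complex ^ 3 ^ 3"
  assumes "approx 1 (\<lambda>z. A z $ 1 $ 1) (\<lambda>z. A0 z $ 1 $ 1)" "approx 0 (\<lambda>z. A z $ 1 $ 2) (\<lambda>z. A0 z $ 1 $ 2)"
    "approx 0 (\<lambda>z. A z $ 1 $ 3) (\<lambda>z. A0 z $ 1 $ 3)"
    "approx 2 (\<lambda>z. A z $ 2 $ 1) (\<lambda>z. A0 z $ 2 $ 1)" "approx 1 (\<lambda>z. A z $ 2 $ 2) (\<lambda>z. A0 z $ 2 $ 2)"
    "approx 1 (\<lambda>z. A z $ 2 $ 3) (\<lambda>z. A0 z $ 2 $ 3)"
    "approx 2 (\<lambda>z. A z $ 3 $ 1) (\<lambda>z. A0 z $ 3 $ 1)" "approx 1 (\<lambda>z. A z $ 3 $ 2) (\<lambda>z. A0 z $ 3 $ 2)"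
    "approx 1 (\<lambda>z. A z $ 3 $ 3) (\<lambda>z. A0 z $ 3 $ 3)"
  shows "approx 3 (\<lambda>z. det (A z)) (\<lambda>z. det (A0 z))"
proof -
  note m = approx_mult[OF approx_mult]
  have "approx 3 (\<lambda>z. A z $ 1 $ 1 * A z $ 2 $ 2 * A z $ 3 $ 3) (\<lambda>z. A0 z $ 1 $ 1 * A0 z $ 2 $ 2 * A0 z $ 3 $ 3)"
    "approx 3 (\<lambda>z. A z $ 1 $ 2 * A z $ 2 $ 3 * A z $ 3 $ 1) (\<lambda>z. A0 z $ 1 $ 2 * A0 z $ 2 $ 3 * A0 z $ 3 $ 1)"
    "approx 3 (\<lambda>z. A z $ 1 $ 3 * A z $ 2 $ 1 * A z $ 3 $ 2) (\<lambda>z. A0 z $ 1 $ 3 * A0 z $ 2 $ 1 * A0 z $ 3 $ 2)"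
    "approx 3 (\<lambda>z. A z $ 1 $ 1 * A z $ 2 $ 3 * A z $ 3 $ 2) (\<lambda>z. A0 z $ 1 $ 1 * A0 z $ 2 $ 3 * A0 z $ 3 $ 2)"
    "approx 3 (\<lambda>z. A z $ 1 $ 2 * A z $ 2 $ 1 * A z $ 3 $ 3) (\<lambda>z. A0 z $ 1 $ 2 * A0 z $ 2 $ 1 * A0 z $ 3 $ 3)"
    "approx 3 (\<lambda>z. A z $ 1 $ 3 * A z $ 2 $ 2 * A z $ 3 $ 1) (\<lambda>z. A0 z $ 1 $ 3 * A0 z $ 2 $ 2 * A0 z $ 3 $ 1)"
    using m[OF assms(1,5,9)] m[OF assms(2,6,7)] m[OF assms(3,4,8)]
      m[OF assms(1,6,8)] m[OF assms(2,4,9)] m[OF assms(3,5,7)] by (simp_all add: numeral_3_eq_3)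
  then show ?thesis unfolding det_3 by (intro approx_add approx_diff)
qed

lemma order_le_imp_bigo:
  assumes "order_le 4 r"
  shows "r \<in> O[nhds (0, 0)](\<lambda>(\<mu>, \<kappa>). of_real (norm \<mu> ^ 4 + \<kappa> ^ 4))"
proof -
  from order_le_nonneg[OF assms] obtain C where C: "C \<ge> 0"
    "\<forall>\<^sub>F z in nhds (0, 0). norm (r z) \<le> C * (norm (fst z) + \<bar>snd z\<bar>) ^ 4" .
  \<comment> \<open>The constant \<open>8\<close> comes from applying
    \<open>(s + t)^2 \<le> 2 (s^2 + t^2)\<close> twice, the first bound being squared.\<close>
  have four: "(x + y) ^ 4 \<le> 8 * (x ^ 4 + y ^ 4)" for x y :: real
  proof -
    have sq: "(s + t)\<^sup>2 \<le> 2 * (s\<^sup>2 + t\<^sup>2)" for s t :: real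
      using sum_squares_bound[of s t] by (simp add: power2_sum)
    have "((x + y)\<^sup>2)\<^sup>2 \<le> (2 * (x\<^sup>2 + y\<^sup>2))\<^sup>2" by (intro power_mono sq) auto
    also have "\<dots> \<le> 4 * (2 * ((x\<^sup>2)\<^sup>2 + (y\<^sup>2)\<^sup>2))"
    proof -
      have "(2 * s)\<^sup>2 = 4 * s\<^sup>2" for s :: real by simp
      then show ?thesis by (simp only:) (intro mult_left_mono sq; simp)
    qed
    finally show ?thesis by simp
  qed
  show ?thesis
  proof (rule bigoI[of _ "C * 8"])
    show "\<forall>\<^sub>F z in nhds (0, 0). norm (r z) \<le> (C * 8) * norm (case z of (\<mu>, \<kappa>) \<Rightarrow> complex_of_real (norm \<mu> ^ 4 + \<kappa> ^ 4))"
      using C(2)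
    proof eventually_elim
      case (elim z)
      note elim
      also have "C * (norm (fst z) + \<bar>snd z\<bar>) ^ 4 \<le> C * (8 * (norm (fst z) ^ 4 + \<bar>snd z\<bar> ^ 4))"
        by (intro mult_left_mono four C)
      also have "\<dots> = (C * 8) * norm (case z of (\<mu>, \<kappa>) \<Rightarrow> complex_of_real (norm \<mu> ^ 4 + \<kappa> ^ 4))"
      proof -
        have "norm (complex_of_real (norm (fst z) ^ 4 + snd z ^ 4)) = norm (fst z) ^ 4 + snd z ^ 4"
          unfolding norm_of_real by (rule abs_of_nonneg) (simp add: zero_le_even_power)
        then show ?thesis by (simp add: split_def power_even_abs)
      qed
      finally show ?case .
    qed
  qed
qed

section \<open>Leading part of the Evans function\<close>

context wave_evans
begin

text \<open>The integrals over the fixed period: \<open>wint\<close> is the derivative of the mass,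
  and \<open>Uwint\<close> half that of the momentum, without the boundary terms in
  \<open>T'\<close>.\<close>

definition wint :: "real ^ 3 \<Rightarrow> real" where "wint h = integral {0..T0} (w h)"
definition Uwint :: "real ^ 3 \<Rightarrow> real" where "Uwint h = integral {0..T0} (\<lambda>t. U t * w h t)"

lemma w_bounded:
  obtains W where "W \<ge> 0" "\<And>x. x \<in> {0..b} \<Longrightarrow> \<bar>w h x\<bar> \<le> W"
proof -
  have "compact (w h ` {0..b})" by (intro compact_continuous_image w_cont) auto
  then obtain B where "\<And>x. x \<in> {0..b} \<Longrightarrow> \<bar>w h x\<bar> \<le> B"
    using compact_imp_bounded bounded_iff by (metis (no_types, lifting) imageI real_norm_def)
  then have "\<bar>w h x\<bar> \<le> \<bar>B\<bar>" if "x \<in> {0..b}" for x using that by fastforce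
  then show thesis by (intro that[of "\<bar>B\<bar>"]) auto
qed

lemma w_integral_deriv:
  assumes "x \<in> {0..b}"
  shows "((\<lambda>x. integral {0..x} (w h)) has_real_derivative w h x) (at x within {0..b})"
    "((\<lambda>x. integral {0..x} (\<lambda>t. U t * w h t)) has_real_derivative U x * w h x) (at x within {0..b})"
  by (intro integral_has_real_derivative continuous_intros w_cont u_cont[OF p0] assms)+

lemma ell_T0: "ell2 T0 y = ell2 0 y" "ell3 T0 y = ell3 0 y"
  by (simp_all add: ell2_def ell3_def q_def u_0[OF p0] u'_0[OF p0] u_period[OF p0] u'_period[OF p0])

text \<open>Without a speed component \<open>w h\<close> solves the problem at
  \<open>\<mu> = 0\<close> exactly, so the residual is \<open>- \<mu> w\<close> and the pointwise
  error \<open>O(\<mu>)\<close>. Multiplied by the factor of the conservation laws, this determines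
  the flux increments up to \<open>O(\<mu>^2)\<close>.\<close>

lemma yw_solution_expansion:
  assumes h: "h $ 3 = 0"
  obtains C where
    "\<And>\<mu>. norm \<mu> \<le> 1 \<Longrightarrow> norm ((\<Phi> T0 \<mu> *v yw h 0) $ 2 - of_real (w' h T0)) \<le> C * norm \<mu>"
    "\<And>\<mu>. norm \<mu> \<le> 1 \<Longrightarrow> norm (ell2 0 (\<Phi> T0 \<mu> *v yw h 0) - ell2 0 (yw h 0) - \<mu> * of_real (wint h)) \<le> C * (norm \<mu>)\<^sup>2"
    "\<And>\<mu>. norm \<mu> \<le> 1 \<Longrightarrow> norm (ell3 0 (\<Phi> T0 \<mu> *v yw h 0) - ell3 0 (yw h 0) - \<mu> * of_real (Uwint h)) \<le> C * (norm \<mu>)\<^sup>2"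
proof -
  obtain W where W: "W \<ge> 0" "\<And>x. x \<in> {0..b} \<Longrightarrow> \<bar>w h x\<bar> \<le> W" using w_bounded by blast
  from approximate_solution obtain K where K: "K \<ge> 0"
    "\<And>\<mu> Ya Ya' d x. norm \<mu> \<le> 1 \<Longrightarrow> 0 \<le> d \<Longrightarrow>
      (\<And>x. x \<in> {0..b} \<Longrightarrow> (Ya has_vector_derivative Ya' x) (at x within {0..b})) \<Longrightarrow>
      (\<And>x. x \<in> {0..b} \<Longrightarrow> norm (Hv \<mu> x (Ya x) - Ya' x) \<le> d) \<Longrightarrow>
      x \<in> {0..b} \<Longrightarrow> norm (\<Phi> x \<mu> *v Ya 0 - Ya x) \<le> K * d" by blast
  from conserved_increments obtain K2 where K2: "K2 \<ge> 0"
    "\<And>\<mu> y a A2 A3 d. (\<And>x. x \<in> {0..b} \<Longrightarrow> (A2 has_vector_derivative a x) (at x within {0..b})) \<Longrightarrow>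
      (\<And>x. x \<in> {0..b} \<Longrightarrow> (A3 has_vector_derivative of_real (U x) * a x) (at x within {0..b})) \<Longrightarrow>
      (\<And>x. x \<in> {0..b} \<Longrightarrow> norm ((\<Phi> x \<mu> *v y) $ 1 - a x) \<le> d) \<Longrightarrow>
      norm (ell2 T0 (\<Phi> T0 \<mu> *v y) - ell2 0 y - \<mu> * (A2 T0 - A2 0)) \<le> K2 * (norm \<mu> * d) \<and>
      norm (ell3 T0 (\<Phi> T0 \<mu> *v y) - ell3 0 y - \<mu> * (A3 T0 - A3 0)) \<le> K2 * (norm \<mu> * d)" by blast
  define C where "C = K * W + K2 * (K * W)"
  have C: "K * W \<le> C" "K2 * (K * W) \<le> C" using W K(1) K2(1) by (simp_all add: C_def)
  have T0: "T0 \<in> {0..b}" using T0_in by auto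
  have err: "norm (\<Phi> x \<mu> *v yw h 0 - yw h x) \<le> K * (norm \<mu> * W)" if \<mu>: "norm \<mu> \<le> 1" and x: "x \<in> {0..b}" for \<mu> x
  proof (rule K(2)[OF \<mu> _ yw_deriv _ x])
    fix x assume x: "x \<in> {0..b}"
    have "Hv \<mu> x (yw h x) - (Hv 0 x (yw h x) + vector [0, 0, of_real (h $ 3 * U' x)])
        = vector [0, 0, - \<mu> * of_real (w h x)]"
      by (simp add: vec_eq_iff forall_3 Hv_def yw_def h algebra_simps)
    also have "norm \<dots> \<le> norm (- \<mu> * of_real (w h x))"
      using norm_vec3_le[of "vector [0, 0, - \<mu> * of_real (w h x)] :: complex ^ 3"] by simp
    also have "\<dots> \<le> norm \<mu> * W" using W(2)[OF x] by (simp add: norm_mult mult_left_mono)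
    finally show "norm (Hv \<mu> x (yw h x) - (Hv 0 x (yw h x) + vector [0, 0, of_real (h $ 3 * U' x)])) \<le> norm \<mu> * W" .
  qed (use W in auto)
  have comp: "norm ((\<Phi> x \<mu> *v yw h 0) $ i - yw h x $ i) \<le> K * (norm \<mu> * W)" if "norm \<mu> \<le> 1" "x \<in> {0..b}" for \<mu> x i
    using order.trans[OF norm_component_le err[OF that], of i] by simp
  show thesis
  proof (rule that[of C])
    fix \<mu> :: complex assume \<mu>: "norm \<mu> \<le> 1"
    have "norm ((\<Phi> T0 \<mu> *v yw h 0) $ 2 - of_real (w' h T0)) \<le> (K * W) * norm \<mu>"
      using comp[OF \<mu> T0, of 2] by (simp add: yw_def mult_ac)
    also have "\<dots> \<le> C * norm \<mu>" using C by (intro mult_right_mono) auto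
    finally show "norm ((\<Phi> T0 \<mu> *v yw h 0) $ 2 - of_real (w' h T0)) \<le> C * norm \<mu>" .
    have *: "norm (ell2 T0 (\<Phi> T0 \<mu> *v yw h 0) - ell2 0 (yw h 0) - \<mu> * (of_real (integral {0..T0} (w h)) - of_real (integral {0..0} (w h))))
          \<le> K2 * (norm \<mu> * (K * (norm \<mu> * W))) \<and>
      norm (ell3 T0 (\<Phi> T0 \<mu> *v yw h 0) - ell3 0 (yw h 0) - \<mu> * (of_real (integral {0..T0} (\<lambda>t. U t * w h t)) - of_real (integral {0..0} (\<lambda>t. U t * w h t))))
          \<le> K2 * (norm \<mu> * (K * (norm \<mu> * W)))"
    proof (rule K2(2)[of _ "\<lambda>x. of_real (w h x)"])
      fix x assume x: "x \<in> {0..b}"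
      show "((\<lambda>x. complex_of_real (integral {0..x} (w h))) has_vector_derivative of_real (w h x)) (at x within {0..b})"
        by (intro has_vector_derivative_of_real w_integral_deriv x)
      show "((\<lambda>x. complex_of_real (integral {0..x} (\<lambda>t. U t * w h t))) has_vector_derivative of_real (U x) * of_real (w h x)) (at x within {0..b})"
        unfolding of_real_mult[symmetric] by (intro has_vector_derivative_of_real w_integral_deriv x)
      show "norm ((\<Phi> x \<mu> *v yw h 0) $ 1 - of_real (w h x)) \<le> K * (norm \<mu> * W)"
        using comp[OF \<mu> x, of 1] by (simp add: yw_def)
    qed
    moreover have "K2 * (norm \<mu> * (K * (norm \<mu> * W))) \<le> C * (norm \<mu>)\<^sup>2"
      using mult_right_mono[OF C(2), of "(norm \<mu>)\<^sup>2"] by (simp add: power2_eq_square mult_ac)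
    ultimately show
      "norm (ell2 0 (\<Phi> T0 \<mu> *v yw h 0) - ell2 0 (yw h 0) - \<mu> * of_real (wint h)) \<le> C * (norm \<mu>)\<^sup>2"
      "norm (ell3 0 (\<Phi> T0 \<mu> *v yw h 0) - ell3 0 (yw h 0) - \<mu> * of_real (Uwint h)) \<le> C * (norm \<mu>)\<^sup>2"
      unfolding ell_T0 wint_def Uwint_def by simp_all
  qed
qed

text \<open>The trial solution \<open>u_x - \<mu> u_c\<close> has residual \<open>\<mu>^2 w\<close>,
  since the term \<open>\<mu> u_x\<close> is cancelled by the generalized kernel relation of
  \<open>u_c\<close>. The flux increments are therefore known up to
  \<open>O(\<mu>^3)\<close>.\<close>

lemma yu_solution_expansion:
  assumes h: "h $ 1 = 0" "h $ 3 = 1"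
  obtains C where
    "\<And>\<mu>. norm \<mu> \<le> 1 \<Longrightarrow> norm ((\<Phi> T0 \<mu> *v (yu 0 - \<mu> *s yw h 0)) $ 2 - (of_real g - \<mu> * of_real (w' h T0))) \<le> C * (norm \<mu>)\<^sup>2"
    "\<And>\<mu>. norm \<mu> \<le> 1 \<Longrightarrow> norm (ell2 0 (\<Phi> T0 \<mu> *v (yu 0 - \<mu> *s yw h 0)) - ell2 0 (yu 0 - \<mu> *s yw h 0) + \<mu>\<^sup>2 * of_real (wint h)) \<le> C * (norm \<mu>) ^ 3"
    "\<And>\<mu>. norm \<mu> \<le> 1 \<Longrightarrow> norm (ell3 0 (\<Phi> T0 \<mu> *v (yu 0 - \<mu> *s yw h 0)) - ell3 0 (yu 0 - \<mu> *s yw h 0) + \<mu>\<^sup>2 * of_real (Uwint h)) \<le> C * (norm \<mu>) ^ 3"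
proof -
  obtain W where W: "W \<ge> 0" "\<And>x. x \<in> {0..b} \<Longrightarrow> \<bar>w h x\<bar> \<le> W" using w_bounded by blast
  from approximate_solution obtain K where K: "K \<ge> 0"
    "\<And>\<mu> Ya Ya' d x. norm \<mu> \<le> 1 \<Longrightarrow> 0 \<le> d \<Longrightarrow>
      (\<And>x. x \<in> {0..b} \<Longrightarrow> (Ya has_vector_derivative Ya' x) (at x within {0..b})) \<Longrightarrow>
      (\<And>x. x \<in> {0..b} \<Longrightarrow> norm (Hv \<mu> x (Ya x) - Ya' x) \<le> d) \<Longrightarrow>
      x \<in> {0..b} \<Longrightarrow> norm (\<Phi> x \<mu> *v Ya 0 - Ya x) \<le> K * d" by blast
  from conserved_increments obtain K2 where K2: "K2 \<ge> 0"
    "\<And>\<mu> y a A2 A3 d. (\<And>x. x \<in> {0..b} \<Longrightarrow> (A2 has_vector_derivative a x) (at x within {0..b})) \<Longrightarrow>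
      (\<And>x. x \<in> {0..b} \<Longrightarrow> (A3 has_vector_derivative of_real (U x) * a x) (at x within {0..b})) \<Longrightarrow>
      (\<And>x. x \<in> {0..b} \<Longrightarrow> norm ((\<Phi> x \<mu> *v y) $ 1 - a x) \<le> d) \<Longrightarrow>
      norm (ell2 T0 (\<Phi> T0 \<mu> *v y) - ell2 0 y - \<mu> * (A2 T0 - A2 0)) \<le> K2 * (norm \<mu> * d) \<and>
      norm (ell3 T0 (\<Phi> T0 \<mu> *v y) - ell3 0 y - \<mu> * (A3 T0 - A3 0)) \<le> K2 * (norm \<mu> * d)" by blast
  define C where "C = K * W + K2 * (K * W)"
  have C: "K * W \<le> C" "K2 * (K * W) \<le> C" using W K(1) K2(1) by (simp_all add: C_def)
  have T0: "T0 \<in> {0..b}" using T0_in by auto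
  define ya where "ya \<mu> x = yu x - \<mu> *s yw h x" for \<mu> x
  have bl: "bounded_linear (\<lambda>y::complex^3. \<mu> *s y)" for \<mu>
    unfolding linear_conv_bounded_linear[symmetric]
    by (rule linearI) (simp_all add: vec_eq_iff algebra_simps)
  have dya: "(ya \<mu> has_vector_derivative (Hv 0 x (yu x) - \<mu> *s (Hv 0 x (yw h x) + vector [0, 0, of_real (h $ 3 * U' x)])))
      (at x within {0..b})" if "x \<in> {0..b}" for \<mu> x
    unfolding ya_def[abs_def]
    by (intro has_vector_derivative_diff yu_deriv bounded_linear.has_vector_derivative[OF bl] yw_deriv that)
  have err: "norm (\<Phi> x \<mu> *v ya \<mu> 0 - ya \<mu> x) \<le> K * ((norm \<mu>)\<^sup>2 * W)" if \<mu>: "norm \<mu> \<le> 1" and x: "x \<in> {0..b}" for \<mu> x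
  proof (rule K(2)[OF \<mu> _ dya _ x])
    fix x assume x: "x \<in> {0..b}"
    have "Hv \<mu> x (ya \<mu> x) - (Hv 0 x (yu x) - \<mu> *s (Hv 0 x (yw h x) + vector [0, 0, of_real (h $ 3 * U' x)]))
        = vector [0, 0, \<mu>\<^sup>2 * of_real (w h x)]"
      by (simp add: vec_eq_iff forall_3 Hv_def ya_def yw_def yu_def h power2_eq_square algebra_simps)
    also have "norm \<dots> \<le> norm (\<mu>\<^sup>2 * of_real (w h x))"
      using norm_vec3_le[of "vector [0, 0, \<mu>\<^sup>2 * of_real (w h x)] :: complex ^ 3"] by simp
    also have "\<dots> \<le> (norm \<mu>)\<^sup>2 * W" using W(2)[OF x] by (simp add: norm_mult norm_power mult_left_mono)
    finally show "norm (Hv \<mu> x (ya \<mu> x) - (Hv 0 x (yu x) - \<mu> *s (Hv 0 x (yw h x) + vector [0, 0, of_real (h $ 3 * U' x)])))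
      \<le> (norm \<mu>)\<^sup>2 * W" .
  qed (use W in auto)
  have comp: "norm ((\<Phi> x \<mu> *v ya \<mu> 0) $ i - ya \<mu> x $ i) \<le> K * ((norm \<mu>)\<^sup>2 * W)" if "norm \<mu> \<le> 1" "x \<in> {0..b}" for \<mu> x i
    using order.trans[OF norm_component_le err[OF that], of i] by simp
  show thesis
  proof (rule that[of C], unfold ya_def[symmetric])
    fix \<mu> :: complex assume \<mu>: "norm \<mu> \<le> 1"
    have "norm ((\<Phi> T0 \<mu> *v ya \<mu> 0) $ 2 - (of_real g - \<mu> * of_real (w' h T0))) \<le> (K * W) * (norm \<mu>)\<^sup>2"
      using comp[OF \<mu> T0, of 2] by (simp add: ya_def yw_def yu_def u_period[OF p0] g_def mult_ac)
    also have "\<dots> \<le> C * (norm \<mu>)\<^sup>2" using C by (intro mult_right_mono) auto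
    finally show "norm ((\<Phi> T0 \<mu> *v ya \<mu> 0) $ 2 - (of_real g - \<mu> * of_real (w' h T0))) \<le> C * (norm \<mu>)\<^sup>2" .
    define A2 where "A2 x = complex_of_real (U x) - \<mu> * of_real (integral {0..x} (w h))" for x
    define A3 where "A3 x = complex_of_real ((U x)\<^sup>2 / 2) - \<mu> * of_real (integral {0..x} (\<lambda>t. U t * w h t))" for x
    have *: "norm (ell2 T0 (\<Phi> T0 \<mu> *v ya \<mu> 0) - ell2 0 (ya \<mu> 0) - \<mu> * (A2 T0 - A2 0))
          \<le> K2 * (norm \<mu> * (K * ((norm \<mu>)\<^sup>2 * W))) \<and>
      norm (ell3 T0 (\<Phi> T0 \<mu> *v ya \<mu> 0) - ell3 0 (ya \<mu> 0) - \<mu> * (A3 T0 - A3 0))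
          \<le> K2 * (norm \<mu> * (K * ((norm \<mu>)\<^sup>2 * W)))"
    proof (rule K2(2)[of _ "\<lambda>x. of_real (U' x) - \<mu> * of_real (w h x)"])
      fix x assume x: "x \<in> {0..b}"
      have dU: "(U has_real_derivative U' x) (at x within {0..b})"
        by (rule has_field_derivative_at_within[OF u_deriv[OF p0]])
      then show "(A2 has_vector_derivative of_real (U' x) - \<mu> * of_real (w h x)) (at x within {0..b})"
        unfolding A2_def[abs_def]
        by (intro has_vector_derivative_diff has_vector_derivative_mult_right has_vector_derivative_of_real w_integral_deriv x)
      have dU2: "((\<lambda>x. (U x)\<^sup>2 / 2) has_real_derivative U x * U' x) (at x within {0..b})"
        by (auto intro!: derivative_eq_intros dU)
      have "(A3 has_vector_derivative of_real (U x * U' x) - \<mu> * of_real (U x * w h x)) (at x within {0..b})"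
        unfolding A3_def[abs_def]
        by (intro has_vector_derivative_diff has_vector_derivative_mult_right has_vector_derivative_of_real w_integral_deriv x dU2)
      then show "(A3 has_vector_derivative of_real (U x) * (of_real (U' x) - \<mu> * of_real (w h x))) (at x within {0..b})"
        by (simp add: algebra_simps)
      show "norm ((\<Phi> x \<mu> *v ya \<mu> 0) $ 1 - (of_real (U' x) - \<mu> * of_real (w h x))) \<le> K * ((norm \<mu>)\<^sup>2 * W)"
        using comp[OF \<mu> x, of 1] by (simp add: ya_def yw_def yu_def)
    qed
    moreover have "K2 * (norm \<mu> * (K * ((norm \<mu>)\<^sup>2 * W))) \<le> C * (norm \<mu>) ^ 3"
      using mult_right_mono[OF C(2), of "(norm \<mu>) ^ 3"] by (simp add: power2_eq_square power3_eq_cube mult_ac)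
    \<comment> \<open>The parts \<open>U\<close> and \<open>U^2 / 2\<close> of the antiderivatives
      return to their initial values after a period; this removes the first-order term and makes the
      increments quadratic in \<open>\<mu>\<close>.\<close>
    moreover have "\<mu> * (A2 T0 - A2 0) = - (\<mu>\<^sup>2 * of_real (wint h))" "\<mu> * (A3 T0 - A3 0) = - (\<mu>\<^sup>2 * of_real (Uwint h))"
      by (simp_all add: A2_def A3_def wint_def Uwint_def u_period[OF p0] u_0[OF p0] power2_eq_square)
    ultimately show
      "norm (ell2 0 (\<Phi> T0 \<mu> *v ya \<mu> 0) - ell2 0 (ya \<mu> 0) + \<mu>\<^sup>2 * of_real (wint h)) \<le> C * (norm \<mu>) ^ 3"
      "norm (ell3 0 (\<Phi> T0 \<mu> *v ya \<mu> 0) - ell3 0 (ya \<mu> 0) + \<mu>\<^sup>2 * of_real (Uwint h)) \<le> C * (norm \<mu>) ^ 3"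
      unfolding ell_T0 by simp_all
  qed
qed

text \<open>The factor \<open>1 / g\<close> turns the increment \<open>w' h T0\<close> of
  \<open>v_x\<close> into \<open>- T' h\<close> and normalizes the determinant to
  \<open>1\<close>.\<close>

definition Lmat :: "complex ^ 3 ^ 3" where
  "Lmat = vector [vector [0, of_real (1 / g), 0], vector [of_real (q 0), 0, - 1],
     vector [of_real (um p0 * q 0 - g), 0, - of_real (um p0)]]"

lemma Lmat_vec: "(Lmat *v y) $ 1 = y $ 2 / of_real g" "(Lmat *v y) $ 2 = ell2 0 y" "(Lmat *v y) $ 3 = ell3 0 y"
  by (simp_all add: Lmat_def matrix_vector_mult_def sum_3 ell2_def ell3_def u_0[OF p0] u'_0[OF p0] g_def[symmetric]
      divide_inverse algebra_simps)

lemma det_Lmat: "det Lmat = 1"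
  using g_pos by (simp add: det_3 Lmat_def field_simps)

text \<open>The columns of \<open>Xmat\<close> are the initial data of \<open>u_x - \<mu> u_c\<close>, \<open>u_a\<close> and \<open>u_E\<close>. The rows of \<open>Lmat\<close> are
  \<open>v_x / u0''(0)\<close>, \<open>ell2\<close> and \<open>ell3\<close>, whose coefficients agree at the two ends of the period.\<close>

definition Xmat :: "complex \<Rightarrow> complex ^ 3 ^ 3" where
  "Xmat \<mu> = transpose (vector [yu 0 - \<mu> *s yw (axis 3 1) 0, yw (axis 1 1) 0, yw (axis 2 1) 0])"

lemma column_Xmat:
  "column 1 (Xmat \<mu>) = yu 0 - \<mu> *s yw (axis 3 1) 0" "column 2 (Xmat \<mu>) = yw (axis 1 1) 0"
  "column 3 (Xmat \<mu>) = yw (axis 2 1) 0"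
  by (simp_all add: vec_eq_iff column_def Xmat_def transpose_def)

lemma matrix_product_entry:
  fixes A B X :: "complex ^ 3 ^ 3"
  shows "(B ** X) $ i $ j = (B *v column j X) $ i"
    "(B ** (A - mat e) ** X) $ i $ j = (B *v (A *v column j X)) $ i - e * (B *v column j X) $ i"
proof -
  show *: "(B ** X) $ i $ j = (B *v column j X) $ i" for B X :: "complex ^ 3 ^ 3"
    by (simp add: matrix_matrix_mult_def matrix_vector_mult_def column_def)
  have "(A - mat e) *v y = A *v y - e *s y" for y
    by (simp add: vec_eq_iff forall_3 matrix_vector_mult_def sum_3 mat_def algebra_simps)
  then show "(B ** (A - mat e) ** X) $ i $ j = (B *v (A *v column j X)) $ i - e * (B *v column j X) $ i"
    unfolding * matrix_vector_mul_assoc[symmetric]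
    by (simp add: matrix_vector_mult_diff_distrib vector_scalar_commute)
qed

lemma ell_smult: "ell2 x (y - \<mu> *s z) = ell2 x y - \<mu> * ell2 x z" "ell3 x (y - \<mu> *s z) = ell3 x y - \<mu> * ell3 x z"
  by (simp_all add: ell2_def ell3_def algebra_simps)

lemma ell_Xmat:
  "ell2 0 (column 1 (Xmat \<mu>)) = \<mu> * of_real (um p0)" "ell3 0 (column 1 (Xmat \<mu>)) = \<mu> * of_real ((um p0)\<^sup>2 / 2)"
  "ell2 0 (column 2 (Xmat \<mu>)) = - 1" "ell3 0 (column 2 (Xmat \<mu>)) = 0"
  "ell2 0 (column 3 (Xmat \<mu>)) = 0" "ell3 0 (column 3 (Xmat \<mu>)) = 1"
  "column 1 (Xmat \<mu>) $ 2 = of_real g" "column 2 (Xmat \<mu>) $ 2 = 0" "column 3 (Xmat \<mu>) $ 2 = 0"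
  unfolding column_Xmat ell_smult ell_yw ell_yu
  by (simp_all add: axis_def u_0[OF p0] yu_def yw_def w'_0 g_def)

text \<open>In the coordinates of \<open>Lmat\<close> the initial data form a lower triangular
  matrix with diagonal \<open>1, -1, 1\<close>, whatever the value of \<open>\<mu>\<close>.\<close>

lemma det_Xmat: "det (Xmat \<mu>) = - 1"
proof -
  have "det (Lmat ** Xmat \<mu>) = - 1"
    unfolding det_3 matrix_product_entry(1) Lmat_vec ell_Xmat using g_pos by simp
  then show ?thesis by (simp add: det_mul det_Lmat)
qed

definition Nmat :: "complex \<times> real \<Rightarrow> complex ^ 3 ^ 3" where
  "Nmat z = Lmat ** (\<Phi> T0 (fst z) - mat (exp (\<i> * of_real (snd z)))) ** Xmat (fst z)"

lemma evans_Nmat: "evans_function \<Phi> T0 (fst z) (snd z) = - det (Nmat z)"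
  by (simp add: evans_function_def Nmat_def det_mul det_Lmat det_Xmat)

text \<open>The terms in \<open>\<kappa> \<mu>\<close> arise because the fluxes of
  \<open>u_x - \<mu> u_c\<close> start at \<open>\<mu> um\<close> and \<open>\<mu> um^2 / 2\<close>
  and are multiplied by \<open>1 - exp (\<i> \<kappa>)\<close>. The sign of
  \<open>\<i> \<kappa>\<close> differs in the middle entry since \<open>ell2\<close> of
  \<open>u_a\<close> is \<open>-1\<close>.\<close>

definition Nlead :: "complex \<times> real \<Rightarrow> complex ^ 3 ^ 3" where
  "Nlead z = vector [
     vector [fst z * of_real (T' (axis 3 1)) - \<i> * of_real (snd z), of_real (- T' (axis 1 1)), of_real (- T' (axis 2 1))],
     vector [- \<i> * of_real (snd z) * fst z * of_real (um p0) - (fst z)\<^sup>2 * of_real (wint (axis 3 1)),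
       fst z * of_real (wint (axis 1 1)) + \<i> * of_real (snd z), fst z * of_real (wint (axis 2 1))],
     vector [- \<i> * of_real (snd z) * fst z * of_real ((um p0)\<^sup>2 / 2) - (fst z)\<^sup>2 * of_real (Uwint (axis 3 1)),
       fst z * of_real (Uwint (axis 1 1)), fst z * of_real (Uwint (axis 2 1)) - \<i> * of_real (snd z)]]"

text \<open>Each entry differs from its leading part by the error of a solution expansion and a
  multiple of the remainder \<open>e\<close> of the exponential; both have one order more than the
  entry itself.\<close>

lemma Nmat_approx: "approx 3 (\<lambda>z. det (Nmat z)) (\<lambda>z. det (Nlead z))"
proof -
  define e where "e z = exp (\<i> * complex_of_real (snd z)) - (1 + \<i> * of_real (snd z))" for z :: "complex \<times> real"
  have e: "order_le 2 e" using order_le_exp unfolding e_def[abs_def] by (simp add: numeral_2_eq_2)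
  have exp_e: "exp (\<i> * complex_of_real (snd z)) = 1 + \<i> * of_real (snd z) + e z" for z :: "complex \<times> real"
    by (simp add: e_def)
  have ik: "order_le 1 (\<lambda>z. \<i> * of_real (snd z))"
    using order_le_cmult[OF order_le_snd, of \<i>] by simp
  have m: "order_le 1 (\<lambda>z. fst z * c)" for c
    using order_le_cmult[OF order_le_fst, of c] by (simp add: mult.commute)
  have m2: "order_le 2 (\<lambda>z. (fst z)\<^sup>2 * c)" for c
    using order_le_cmult[OF order_le_mult[OF order_le_fst order_le_fst], of c]
    by (simp add: mult.commute power2_eq_square numeral_2_eq_2)
  have ikm: "order_le 2 (\<lambda>z. - \<i> * of_real (snd z) * fst z * c)" for c
    using order_le_mult[OF ik m[of "- c"]] by (simp add: mult_ac numeral_2_eq_2)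
  have bound: "order_le k r" if "\<And>\<mu> \<kappa>. norm \<mu> \<le> 1 \<Longrightarrow> norm (r (\<mu>, \<kappa>)) \<le> C * norm \<mu> ^ k" for k r C
  proof (rule order_leI[of _ "\<bar>C\<bar>"])
    fix \<mu> :: complex and \<kappa> :: real assume "norm \<mu> \<le> 1"
    then have "norm (r (\<mu>, \<kappa>)) \<le> C * norm \<mu> ^ k" by (rule that)
    also have "\<dots> \<le> \<bar>C\<bar> * (norm \<mu> + \<bar>\<kappa>\<bar>) ^ k" by (intro mult_mono power_mono) auto
    finally show "norm (r (\<mu>, \<kappa>)) \<le> \<bar>C\<bar> * (norm \<mu> + \<bar>\<kappa>\<bar>) ^ k" .
  qed
  have ywN: "order_le 1 (\<lambda>z. (\<Phi> T0 (fst z) *v yw h 0) $ 2 - of_real (w' h T0))"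
    "order_le 2 (\<lambda>z. ell2 0 (\<Phi> T0 (fst z) *v yw h 0) - ell2 0 (yw h 0) - fst z * of_real (wint h))"
    "order_le 2 (\<lambda>z. ell3 0 (\<Phi> T0 (fst z) *v yw h 0) - ell3 0 (yw h 0) - fst z * of_real (Uwint h))"
    if "h $ 3 = 0" for h
  proof -
    from yw_solution_expansion[OF that] obtain C where C:
      "\<And>\<mu>. norm \<mu> \<le> 1 \<Longrightarrow> norm ((\<Phi> T0 \<mu> *v yw h 0) $ 2 - of_real (w' h T0)) \<le> C * norm \<mu>"
      "\<And>\<mu>. norm \<mu> \<le> 1 \<Longrightarrow> norm (ell2 0 (\<Phi> T0 \<mu> *v yw h 0) - ell2 0 (yw h 0) - \<mu> * of_real (wint h)) \<le> C * (norm \<mu>)\<^sup>2"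
      "\<And>\<mu>. norm \<mu> \<le> 1 \<Longrightarrow> norm (ell3 0 (\<Phi> T0 \<mu> *v yw h 0) - ell3 0 (yw h 0) - \<mu> * of_real (Uwint h)) \<le> C * (norm \<mu>)\<^sup>2"
      by blast
    show "order_le 1 (\<lambda>z. (\<Phi> T0 (fst z) *v yw h 0) $ 2 - of_real (w' h T0))"
      by (rule bound[of _ C]) (use C(1) in simp)
    show "order_le 2 (\<lambda>z. ell2 0 (\<Phi> T0 (fst z) *v yw h 0) - ell2 0 (yw h 0) - fst z * of_real (wint h))"
      by (rule bound[of _ C]) (use C(2) in simp)
    show "order_le 2 (\<lambda>z. ell3 0 (\<Phi> T0 (fst z) *v yw h 0) - ell3 0 (yw h 0) - fst z * of_real (Uwint h))"
      by (rule bound[of _ C]) (use C(3) in simp)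
  qed
  let ?h = "axis 3 1 :: real ^ 3"
  have yuN: "order_le 2 (\<lambda>z. (\<Phi> T0 (fst z) *v column 1 (Xmat (fst z))) $ 2 - (of_real g - fst z * of_real (w' ?h T0)))"
    "order_le 3 (\<lambda>z. ell2 0 (\<Phi> T0 (fst z) *v column 1 (Xmat (fst z))) - ell2 0 (column 1 (Xmat (fst z))) + (fst z)\<^sup>2 * of_real (wint ?h))"
    "order_le 3 (\<lambda>z. ell3 0 (\<Phi> T0 (fst z) *v column 1 (Xmat (fst z))) - ell3 0 (column 1 (Xmat (fst z))) + (fst z)\<^sup>2 * of_real (Uwint ?h))"
  proof -
    have h: "?h $ 1 = 0" "?h $ 3 = 1" by (simp_all add: axis_def)
    from yu_solution_expansion[OF h] obtain C where C:
      "\<And>\<mu>. norm \<mu> \<le> 1 \<Longrightarrow> norm ((\<Phi> T0 \<mu> *v column 1 (Xmat \<mu>)) $ 2 - (of_real g - \<mu> * of_real (w' ?h T0))) \<le> C * (norm \<mu>)\<^sup>2"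
      "\<And>\<mu>. norm \<mu> \<le> 1 \<Longrightarrow> norm (ell2 0 (\<Phi> T0 \<mu> *v column 1 (Xmat \<mu>)) - ell2 0 (column 1 (Xmat \<mu>)) + \<mu>\<^sup>2 * of_real (wint ?h)) \<le> C * (norm \<mu>) ^ 3"
      "\<And>\<mu>. norm \<mu> \<le> 1 \<Longrightarrow> norm (ell3 0 (\<Phi> T0 \<mu> *v column 1 (Xmat \<mu>)) - ell3 0 (column 1 (Xmat \<mu>)) + \<mu>\<^sup>2 * of_real (Uwint ?h)) \<le> C * (norm \<mu>) ^ 3"
      unfolding column_Xmat by blast
    show "order_le 2 (\<lambda>z. (\<Phi> T0 (fst z) *v column 1 (Xmat (fst z))) $ 2 - (of_real g - fst z * of_real (w' ?h T0)))"
      by (rule bound[of _ C]) (use C(1) in simp)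
    show "order_le 3 (\<lambda>z. ell2 0 (\<Phi> T0 (fst z) *v column 1 (Xmat (fst z))) - ell2 0 (column 1 (Xmat (fst z))) + (fst z)\<^sup>2 * of_real (wint ?h))"
      by (rule bound[of _ C]) (use C(2) in simp)
    show "order_le 3 (\<lambda>z. ell3 0 (\<Phi> T0 (fst z) *v column 1 (Xmat (fst z))) - ell3 0 (column 1 (Xmat (fst z))) + (fst z)\<^sup>2 * of_real (Uwint ?h))"
      by (rule bound[of _ C]) (use C(3) in simp)
  qed
  have ax: "(axis 1 1 :: real ^ 3) $ 3 = 0" "(axis 2 1 :: real ^ 3) $ 3 = 0" by (simp_all add: axis_def)
  note ey = ell_Xmat(3-6,8,9)[unfolded column_Xmat]
  have g: "complex_of_real g \<noteq> 0" using g_pos by simp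
  have T': "complex_of_real (T' h) = - (of_real (w' h T0) / of_real g)" for h
    by (simp add: T'_def)
  have N: "Nmat z $ i $ j = (Lmat *v (\<Phi> T0 (fst z) *v column j (Xmat (fst z)))) $ i
      - exp (\<i> * of_real (snd z)) * (Lmat *v column j (Xmat (fst z))) $ i" for z i j
    unfolding Nmat_def by (rule matrix_product_entry)
  have me: "order_le 3 (\<lambda>z. fst z * c * e z)" for c
    using order_le_mult[OF m e] by (simp add: numeral_3_eq_3 numeral_2_eq_2)
  have row1: "approx 1 (\<lambda>z. Nmat z $ 1 $ 1) (\<lambda>z. Nlead z $ 1 $ 1)"
    "approx 0 (\<lambda>z. Nmat z $ 1 $ 2) (\<lambda>z. Nlead z $ 1 $ 2)"
    "approx 0 (\<lambda>z. Nmat z $ 1 $ 3) (\<lambda>z. Nlead z $ 1 $ 3)"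
  proof -
    have "order_le 2 (\<lambda>z. (1 / of_real g) * ((\<Phi> T0 (fst z) *v column 1 (Xmat (fst z))) $ 2 - (of_real g - fst z * of_real (w' ?h T0))) - e z)"
      by (intro order_le_diff order_le_cmult yuN e)
    also have "(\<lambda>z. (1 / of_real g) * ((\<Phi> T0 (fst z) *v column 1 (Xmat (fst z))) $ 2 - (of_real g - fst z * of_real (w' ?h T0))) - e z)
        = (\<lambda>z. Nmat z $ 1 $ 1 - Nlead z $ 1 $ 1)"
      using g by (simp add: fun_eq_iff N Lmat_vec ell_Xmat Nlead_def exp_e T' field_simps)
    finally show "approx 1 (\<lambda>z. Nmat z $ 1 $ 1) (\<lambda>z. Nlead z $ 1 $ 1)"
      unfolding approx_def by (simp add: Nlead_def order_le_diff m ik[simplified] numeral_2_eq_2 m[simplified])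
    have "order_le 1 (\<lambda>z. (1 / of_real g) * ((\<Phi> T0 (fst z) *v yw (axis 1 1) 0) $ 2 - of_real (w' (axis 1 1) T0)))"
      by (intro order_le_cmult ywN ax)
    also have "(\<lambda>z. (1 / of_real g) * ((\<Phi> T0 (fst z) *v yw (axis 1 1) 0) $ 2 - of_real (w' (axis 1 1) T0)))
        = (\<lambda>z. Nmat z $ 1 $ 2 - Nlead z $ 1 $ 2)"
      using g by (simp add: fun_eq_iff N Lmat_vec Nlead_def T' column_Xmat(2) ey field_simps)
    finally show "approx 0 (\<lambda>z. Nmat z $ 1 $ 2) (\<lambda>z. Nlead z $ 1 $ 2)"
      unfolding approx_def by (simp add: Nlead_def order_le_const)
    have "order_le 1 (\<lambda>z. (1 / of_real g) * ((\<Phi> T0 (fst z) *v yw (axis 2 1) 0) $ 2 - of_real (w' (axis 2 1) T0)))"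
      by (intro order_le_cmult ywN ax)
    also have "(\<lambda>z. (1 / of_real g) * ((\<Phi> T0 (fst z) *v yw (axis 2 1) 0) $ 2 - of_real (w' (axis 2 1) T0)))
        = (\<lambda>z. Nmat z $ 1 $ 3 - Nlead z $ 1 $ 3)"
      using g by (simp add: fun_eq_iff N Lmat_vec Nlead_def T' column_Xmat(3) ey field_simps)
    finally show "approx 0 (\<lambda>z. Nmat z $ 1 $ 3) (\<lambda>z. Nlead z $ 1 $ 3)"
      unfolding approx_def by (simp add: Nlead_def order_le_const)
  qed
  have row2: "approx 2 (\<lambda>z. Nmat z $ 2 $ 1) (\<lambda>z. Nlead z $ 2 $ 1)"
    "approx 1 (\<lambda>z. Nmat z $ 2 $ 2) (\<lambda>z. Nlead z $ 2 $ 2)"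
    "approx 1 (\<lambda>z. Nmat z $ 2 $ 3) (\<lambda>z. Nlead z $ 2 $ 3)"
  proof -
    \<comment> \<open>The quadratic remainder \<open>e\<close> would be too large for an entry of
      order two; it is multiplied by the initial flux \<open>\<mu> um\<close>, which brings it to
      order three.\<close>
    from order_le_diff[OF yuN(2) me[of "of_real (um p0)"]]
    have "order_le 3 (\<lambda>z. Nmat z $ 2 $ 1 - Nlead z $ 2 $ 1)"
      by (simp add: N Lmat_vec ell_Xmat Nlead_def exp_e algebra_simps)
    then show "approx 2 (\<lambda>z. Nmat z $ 2 $ 1) (\<lambda>z. Nlead z $ 2 $ 1)"
      unfolding approx_def using order_le_diff[OF ikm m2] by (simp add: Nlead_def numeral_3_eq_3 numeral_2_eq_2)
    from order_le_add[OF ywN(2)[OF ax(1)] e]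
    have "order_le 2 (\<lambda>z. Nmat z $ 2 $ 2 - Nlead z $ 2 $ 2)"
      by (simp add: N Lmat_vec Nlead_def exp_e column_Xmat(2) ey algebra_simps)
    then show "approx 1 (\<lambda>z. Nmat z $ 2 $ 2) (\<lambda>z. Nlead z $ 2 $ 2)"
      unfolding approx_def using order_le_add[OF m ik] by (simp add: Nlead_def numeral_2_eq_2)
    from ywN(2)[OF ax(2)]
    have "order_le 2 (\<lambda>z. Nmat z $ 2 $ 3 - Nlead z $ 2 $ 3)"
      by (simp add: N Lmat_vec Nlead_def exp_e column_Xmat(3) ey algebra_simps)
    then show "approx 1 (\<lambda>z. Nmat z $ 2 $ 3) (\<lambda>z. Nlead z $ 2 $ 3)"
      unfolding approx_def using m by (simp add: Nlead_def numeral_2_eq_2)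
  qed
  have row3: "approx 2 (\<lambda>z. Nmat z $ 3 $ 1) (\<lambda>z. Nlead z $ 3 $ 1)"
    "approx 1 (\<lambda>z. Nmat z $ 3 $ 2) (\<lambda>z. Nlead z $ 3 $ 2)"
    "approx 1 (\<lambda>z. Nmat z $ 3 $ 3) (\<lambda>z. Nlead z $ 3 $ 3)"
  proof -
    note order_le_diff[OF yuN(3) me[of "of_real ((um p0)\<^sup>2 / 2)"]]
    also have "(\<lambda>z. ell3 0 (\<Phi> T0 (fst z) *v column 1 (Xmat (fst z))) - ell3 0 (column 1 (Xmat (fst z)))
        + (fst z)\<^sup>2 * of_real (Uwint ?h) - fst z * of_real ((um p0)\<^sup>2 / 2) * e z)
        = (\<lambda>z. Nmat z $ 3 $ 1 - Nlead z $ 3 $ 1)"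
      by (simp add: fun_eq_iff N Lmat_vec ell_Xmat Nlead_def exp_e field_simps)
    finally have "order_le 3 (\<lambda>z. Nmat z $ 3 $ 1 - Nlead z $ 3 $ 1)" .
    then show "approx 2 (\<lambda>z. Nmat z $ 3 $ 1) (\<lambda>z. Nlead z $ 3 $ 1)"
      unfolding approx_def using order_le_diff[OF ikm[of "of_real ((um p0)\<^sup>2 / 2)"] m2]
      by (simp add: Nlead_def numeral_3_eq_3 numeral_2_eq_2)
    from ywN(3)[OF ax(1)]
    have "order_le 2 (\<lambda>z. Nmat z $ 3 $ 2 - Nlead z $ 3 $ 2)"
      by (simp add: N Lmat_vec Nlead_def exp_e column_Xmat(2) ey algebra_simps)
    then show "approx 1 (\<lambda>z. Nmat z $ 3 $ 2) (\<lambda>z. Nlead z $ 3 $ 2)"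
      unfolding approx_def using m by (simp add: Nlead_def numeral_2_eq_2)
    from order_le_diff[OF ywN(3)[OF ax(2)] e]
    have "order_le 2 (\<lambda>z. Nmat z $ 3 $ 3 - Nlead z $ 3 $ 3)"
      by (simp add: N Lmat_vec Nlead_def exp_e column_Xmat(3) ey algebra_simps)
    then show "approx 1 (\<lambda>z. Nmat z $ 3 $ 3) (\<lambda>z. Nlead z $ 3 $ 3)"
      unfolding approx_def using order_le_diff[OF m ik] by (simp add: Nlead_def numeral_2_eq_2)
  qed
  show ?thesis by (rule approx_det[OF row1 row2 row3])
qed

lemma mass_momentum_derivative: "M' h = wint h + um p0 * T' h" "P' h = 2 * Uwint h + (um p0)\<^sup>2 * T' h"
proof -
  have "(\<lambda>t. 2 * U t * w h t) = (\<lambda>t. 2 * (U t * w h t))" by (simp add: mult.assoc)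
  then show "M' h = wint h + um p0 * T' h" "P' h = 2 * Uwint h + (um p0)\<^sup>2 * T' h"
    by (simp_all add: M'_def P'_def wint_def Uwint_def)
qed

end

section \<open>Jacobians of the modulation system and comparison of determinants\<close>

lemma jacobian_entry:
  fixes G :: "real ^ 'n \<Rightarrow> real ^ 'm"
  assumes "(G has_derivative G') (at q)"
  shows "jacobian G (at q) $ i $ j = G' (axis j 1) $ i"
  by (simp add: jacobian_def frechet_derivative_at[OF assms, symmetric] matrix_def)

lemma speed_shift_deriv:
  "(speed_shift c0 has_derivative (\<lambda>h. vector [h $ 1, h $ 2, - h $ 3])) (at q)"
proof (rule has_derivative_vec)
  fix i :: 3
  have lin: "((\<lambda>q. q $ j) has_derivative (\<lambda>h. h $ j)) (at q)" for j and q :: "real ^ 3"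
    by (intro bounded_linear_imp_has_derivative bounded_linear_vec_nth)
  show "((\<lambda>q. speed_shift c0 q $ i) has_derivative (\<lambda>h. vector [h $ 1, h $ 2, - h $ 3] $ i)) (at q)"
    using exhaust_3[of i] by (auto simp: speed_shift_def intro!: derivative_eq_intros lin)
qed

text \<open>The terms in \<open>c\<close> and \<open>d\<close> are multiples of the last row and
  drop out; what remains are the row factors \<open>- \<omega>\<close>, \<open>- 2 \<omega>\<close>
  and \<open>\<omega>^2\<close>.\<close>

lemma det_row_operations:
  fixes \<omega> c d :: complex
  shows "det (vector [
      vector [- \<omega> * x1 + c * a1, - \<omega> * x2 + c * a2, - \<omega> * x3 + c * a3],
      vector [- 2 * \<omega> * y1 + d * a1, - 2 * \<omega> * y2 + d * a2, - 2 * \<omega> * y3 + d * a3],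
      vector [\<omega>\<^sup>2 * a1, \<omega>\<^sup>2 * a2, \<omega>\<^sup>2 * a3]] :: complex ^ 3 ^ 3)
    = 2 * \<omega> ^ 4 * det (vector [vector [x1, x2, x3], vector [y1, y2, y3], vector [a1, a2, a3]] :: complex ^ 3 ^ 3)"
  unfolding det_3 vector_3 by (simp add: algebra_simps power2_eq_square power4_eq_xxxx)

text \<open>A polynomial identity in which \<open>Wi\<close>, \<open>Vi\<close>, \<open>Ti\<close>
  stand for the values of \<open>wint\<close>, \<open>Uwint\<close>, \<open>T'\<close> on the axes,
  \<open>v\<close> and \<open>r\<close> for \<open>um p0\<close> and half its square,
  \<open>m\<close> and \<open>p\<close> for mass and momentum, and \<open>k\<close> for
  \<open>\<i> \<kappa>\<close>. On the left is the modulation matrix with \<open>\<mu>\<close>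
  negated, on the right \<open>Nlead\<close>.\<close>

lemma modulation_det_identity:
  fixes \<mu> k \<omega> m p v r :: complex
  shows "det (vector [
      vector [- \<mu> * ((W1 + v * T1) * \<omega> - m * T1 * \<omega>\<^sup>2) - k * \<omega>, - \<mu> * ((W2 + v * T2) * \<omega> - m * T2 * \<omega>\<^sup>2),
        \<mu> * ((W3 + v * T3) * \<omega> - m * T3 * \<omega>\<^sup>2) + k * \<omega> * m * \<omega>],
      vector [- \<mu> * ((2 * V1 + 2 * r * T1) * \<omega> - p * T1 * \<omega>\<^sup>2),
        - \<mu> * ((2 * V2 + 2 * r * T2) * \<omega> - p * T2 * \<omega>\<^sup>2) + 2 * k * \<omega>,
        \<mu> * ((2 * V3 + 2 * r * T3) * \<omega> - p * T3 * \<omega>\<^sup>2) + k * \<omega> * p * \<omega>],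
      vector [\<mu> * T1 * \<omega>\<^sup>2, \<mu> * T2 * \<omega>\<^sup>2, - \<mu> * T3 * \<omega>\<^sup>2 + k * \<omega> * \<omega>]] :: complex ^ 3 ^ 3)
    = - 2 * \<omega> ^ 4 * det (vector [
      vector [\<mu> * T3 - k, - T1, - T2],
      vector [- k * \<mu> * v - \<mu>\<^sup>2 * W3, \<mu> * W1 + k, \<mu> * W2],
      vector [- k * \<mu> * r - \<mu>\<^sup>2 * V3, \<mu> * V1, \<mu> * V2 - k]] :: complex ^ 3 ^ 3)"
proof -
  \<comment> \<open>A factor \<open>\<mu>\<close> moves from the first column to the first row,
    whose sign is changed; then rows and columns are permuted cyclically. As a polynomial identity
    this includes \<open>\<mu> = 0\<close>.\<close>
  have "det (vector [
      vector [\<mu> * T3 - k, - T1, - T2],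
      vector [- k * \<mu> * v - \<mu>\<^sup>2 * W3, \<mu> * W1 + k, \<mu> * W2],
      vector [- k * \<mu> * r - \<mu>\<^sup>2 * V3, \<mu> * V1, \<mu> * V2 - k]] :: complex ^ 3 ^ 3)
    = - det (vector [
      vector [\<mu> * W1 + k, \<mu> * W2, - \<mu> * W3 - v * k],
      vector [\<mu> * V1, \<mu> * V2 - k, - \<mu> * V3 - r * k],
      vector [\<mu> * T1, \<mu> * T2, - \<mu> * T3 + k]] :: complex ^ 3 ^ 3)"
    unfolding det_3 vector_3 by (simp add: algebra_simps power2_eq_square)
  then show ?thesis
    \<comment> \<open>The multiples of the period row absorb both the boundary terms in
      \<open>v\<close>, \<open>r\<close> and the quotient-rule terms in \<open>m\<close>,
      \<open>p\<close>. In the third column they also cancel \<open>v k\<close> and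
      \<open>r k\<close> and produce the flux entries with \<open>m\<close> and
      \<open>p\<close>.\<close>
    using det_row_operations[of \<omega> "\<mu> * W1 + k" "m * \<omega>\<^sup>2 - v * \<omega>" "\<mu> * T1" "\<mu> * W2" "\<mu> * T2"
        "- \<mu> * W3 - v * k" "- \<mu> * T3 + k" "\<mu> * V1" "p * \<omega>\<^sup>2 - 2 * r * \<omega>" "\<mu> * V2 - k" "- \<mu> * V3 - r * k"]
    by (simp add: algebra_simps power2_eq_square)
qed

context wave_evans
begin

text \<open>The Jacobians are computed by the chain and product rules at \<open>s = 0\<close>; all
  that is left of the wave are the derivatives of period, mass and momentum, and these reduce to the
  entries of \<open>Nlead\<close>.\<close>

lemma modulation_det_eq:
  assumes q0: "speed_shift c0 q0 = p0" "q0 $ 3 = 0"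
  shows "modulation_det c0 period (wave_mass period u) (wave_momentum period u) (- \<mu>) \<kappa> q0
    = - 2 * of_real (1 / T0) ^ 4 * det (Nlead (\<mu>, \<kappa>))"
proof -
  let ?M = "wave_mass period u" and ?P = "wave_momentum period u"
  define \<sigma> :: "real ^ 3 \<Rightarrow> real ^ 3" where "\<sigma> h = vector [h $ 1, h $ 2, - h $ 3]" for h
  define \<omega> where "\<omega> = 1 / T0"
  have T0: "T0 \<noteq> 0" using T0_in by auto
  have comp: "((\<lambda>q. G (speed_shift c0 q)) has_derivative (\<lambda>h. G' (\<sigma> h))) (at q0)"
    if "(G has_derivative G') (at p0)" for G G' :: "real ^ 3 \<Rightarrow> real"
    using has_derivative_compose[OF speed_shift_deriv[of c0 q0], of G G'] that unfolding q0 \<sigma>_def by simp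
  note dT = comp[OF period_has_derivative] and dM = comp[OF mass_has_derivative] and dP = comp[OF momentum_has_derivative]
  have d\<omega>: "((\<lambda>q. 1 / period (speed_shift c0 q)) has_derivative (\<lambda>h. - T' (\<sigma> h) * \<omega>\<^sup>2)) (at q0)"
    using has_derivative_divide[OF has_derivative_const[of 1] dT] T0
    by (simp add: q0 \<omega>_def power2_eq_square divide_inverse mult_ac)
  have prod: "((\<lambda>q. G (speed_shift c0 q) * (1 / period (speed_shift c0 q))) has_derivative
      (\<lambda>h. G' (\<sigma> h) * \<omega> - G p0 * T' (\<sigma> h) * \<omega>\<^sup>2)) (at q0)"
    if "((\<lambda>q. G (speed_shift c0 q)) has_derivative (\<lambda>h. G' (\<sigma> h))) (at q0)" for G G'
    using has_derivative_mult[OF that d\<omega>] by (simp add: q0 \<omega>_def algebra_simps)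
  \<comment> \<open>The coordinate \<open>s\<close> vanishes at \<open>q0\<close>, so the derivative
    of \<open>G\<close> does not survive in the product rule.\<close>
  have s_prod: "((\<lambda>q. q $ 3 * G q) has_derivative (\<lambda>h. h $ 3 * G q0)) (at q0)"
    if "(G has_derivative G') (at q0)" for G G' :: "real ^ 3 \<Rightarrow> real"
    using has_derivative_mult[OF bounded_linear_imp_has_derivative[OF bounded_linear_vec_nth] that, of 3]
    by (simp add: q0)
  have lin: "((\<lambda>q. q $ j) has_derivative (\<lambda>h. h $ j)) (at q0)" for j
    by (intro bounded_linear_imp_has_derivative bounded_linear_vec_nth)
  have density: "(modulation_density c0 period ?M ?P has_derivative
      (\<lambda>h. vector [M' (\<sigma> h) * \<omega> - ?M p0 * T' (\<sigma> h) * \<omega>\<^sup>2, P' (\<sigma> h) * \<omega> - ?P p0 * T' (\<sigma> h) * \<omega>\<^sup>2,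
        - T' (\<sigma> h) * \<omega>\<^sup>2])) (at q0)"
  proof (rule has_derivative_vec)
    fix i :: 3
    show "((\<lambda>q. modulation_density c0 period ?M ?P q $ i) has_derivative
      (\<lambda>h. vector [M' (\<sigma> h) * \<omega> - ?M p0 * T' (\<sigma> h) * \<omega>\<^sup>2, P' (\<sigma> h) * \<omega> - ?P p0 * T' (\<sigma> h) * \<omega>\<^sup>2,
        - T' (\<sigma> h) * \<omega>\<^sup>2] $ i)) (at q0)"
      using exhaust_3[of i] prod[OF dM] prod[OF dP] d\<omega> by (auto simp: modulation_density_def Let_def)
  qed
  have flux: "(modulation_flux c0 period ?M ?P has_derivative
      (\<lambda>h. vector [h $ 1 - h $ 3 * (?M p0 * \<omega>), - (h $ 3 * (?P p0 * \<omega>)) - 2 * h $ 2, - (h $ 3 * \<omega>)])) (at q0)"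
  proof (rule has_derivative_vec)
    fix i :: 3
    have 1: "((\<lambda>q. q $ 1 - q $ 3 * (?M (speed_shift c0 q) * (1 / period (speed_shift c0 q)))) has_derivative
        (\<lambda>h. h $ 1 - h $ 3 * (?M p0 * \<omega>))) (at q0)"
      using has_derivative_diff[OF lin s_prod[OF prod[OF dM]]] by (simp add: q0 \<omega>_def)
    have 2: "((\<lambda>q. - (q $ 3 * (?P (speed_shift c0 q) * (1 / period (speed_shift c0 q)))) - 2 * q $ 2) has_derivative
        (\<lambda>h. - (h $ 3 * (?P p0 * \<omega>)) - 2 * h $ 2)) (at q0)"
      using has_derivative_diff[OF has_derivative_minus[OF s_prod[OF prod[OF dP]]] has_derivative_mult_right[OF lin, of 2 2]]
      by (simp add: q0 \<omega>_def)
    have 3: "((\<lambda>q. - (q $ 3 * (1 / period (speed_shift c0 q)))) has_derivative (\<lambda>h. - (h $ 3 * \<omega>))) (at q0)"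
      using has_derivative_minus[OF s_prod[OF d\<omega>]] by (simp add: q0 \<omega>_def)
    show "((\<lambda>q. modulation_flux c0 period ?M ?P q $ i) has_derivative
      (\<lambda>h. vector [h $ 1 - h $ 3 * (?M p0 * \<omega>), - (h $ 3 * (?P p0 * \<omega>)) - 2 * h $ 2, - (h $ 3 * \<omega>)] $ i)) (at q0)"
      using exhaust_3[of i] 1 2 3 by (auto simp: modulation_flux_def Let_def mult.assoc)
  qed
  \<comment> \<open>Because \<open>c = c0 - s\<close>, the third axis changes sign, and with it the
    third column of the density Jacobian.\<close>
  have \<sigma>: "\<sigma> (axis 1 1) = axis 1 1" "\<sigma> (axis 2 1) = axis 2 1" "\<sigma> (axis 3 1) = - axis 3 1"
    by (simp_all add: \<sigma>_def vec_eq_iff forall_3 axis_def)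
  have neg: "T' (- h) = - T' h" "M' (- h) = - M' h" "P' (- h) = - P' h" for h
    using linear_neg[OF has_derivative_linear[OF period_has_derivative]]
      linear_neg[OF has_derivative_linear[OF mass_has_derivative]]
      linear_neg[OF has_derivative_linear[OF momentum_has_derivative]] by auto
  have neg': "wint (- h) = - wint h" "Uwint (- h) = - Uwint h" for h
    using neg[of h] unfolding mass_momentum_derivative by simp_all
  define k where "k = \<i> * complex_of_real \<kappa>"
  have "modulation_det c0 period ?M ?P (- \<mu>) \<kappa> q0 = det (vector [
      vector [- \<mu> * ((of_real (wint (axis 1 1)) + of_real (um p0) * of_real (T' (axis 1 1))) * of_real \<omega> - of_real (?M p0) * of_real (T' (axis 1 1)) * (of_real \<omega>)\<^sup>2) - k * of_real \<omega>,
        - \<mu> * ((of_real (wint (axis 2 1)) + of_real (um p0) * of_real (T' (axis 2 1))) * of_real \<omega> - of_real (?M p0) * of_real (T' (axis 2 1)) * (of_real \<omega>)\<^sup>2),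
        \<mu> * ((of_real (wint (axis 3 1)) + of_real (um p0) * of_real (T' (axis 3 1))) * of_real \<omega> - of_real (?M p0) * of_real (T' (axis 3 1)) * (of_real \<omega>)\<^sup>2) + k * of_real \<omega> * of_real (?M p0) * of_real \<omega>],
      vector [- \<mu> * ((2 * of_real (Uwint (axis 1 1)) + 2 * of_real ((um p0)\<^sup>2 / 2) * of_real (T' (axis 1 1))) * of_real \<omega> - of_real (?P p0) * of_real (T' (axis 1 1)) * (of_real \<omega>)\<^sup>2),
        - \<mu> * ((2 * of_real (Uwint (axis 2 1)) + 2 * of_real ((um p0)\<^sup>2 / 2) * of_real (T' (axis 2 1))) * of_real \<omega> - of_real (?P p0) * of_real (T' (axis 2 1)) * (of_real \<omega>)\<^sup>2) + 2 * k * of_real \<omega>,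
        \<mu> * ((2 * of_real (Uwint (axis 3 1)) + 2 * of_real ((um p0)\<^sup>2 / 2) * of_real (T' (axis 3 1))) * of_real \<omega> - of_real (?P p0) * of_real (T' (axis 3 1)) * (of_real \<omega>)\<^sup>2) + k * of_real \<omega> * of_real (?P p0) * of_real \<omega>],
      vector [\<mu> * of_real (T' (axis 1 1)) * (of_real \<omega>)\<^sup>2, \<mu> * of_real (T' (axis 2 1)) * (of_real \<omega>)\<^sup>2,
        - \<mu> * of_real (T' (axis 3 1)) * (of_real \<omega>)\<^sup>2 + k * of_real \<omega> * of_real \<omega>]] :: complex ^ 3 ^ 3)"
  proof -
    have ax: "axis i (1 :: real) $ j = (if i = j then 1 else 0)" for i j :: 3
      by (simp add: axis_def)
    have \<kappa>: "\<i> * of_real \<kappa> / of_real (period (speed_shift c0 q0)) = k * of_real \<omega>"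
      by (simp add: k_def \<omega>_def q0)
    have three: "(1 :: 3) \<noteq> 2" "(1 :: 3) \<noteq> 3" "(2 :: 3) \<noteq> 1" "(2 :: 3) \<noteq> 3" "(3 :: 3) \<noteq> 1" "(3 :: 3) \<noteq> 2"
      by simp_all
    show ?thesis
      unfolding modulation_det_def \<kappa> jacobian_entry[OF density] jacobian_entry[OF flux]
      by (rule arg_cong[where f = det])
        (simp add: vec_eq_iff forall_3 \<sigma> neg neg' mass_momentum_derivative ax three algebra_simps)
  qed
  also have "\<dots> = - 2 * of_real \<omega> ^ 4 * det (Nlead (\<mu>, \<kappa>))"
    unfolding modulation_det_identity Nlead_def k_def by (simp add: mult_ac)
  finally show ?thesis by (simp only: \<omega>_def)
qed

text \<open>Both determinants carry a minus sign relative to \<open>Nmat\<close> and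
  \<open>Nlead\<close>: one is the determinant of \<open>Xmat\<close>, the other comes from the
  matrix identity. They cancel, and the constant is the reciprocal of
  \<open>2 / T0^4\<close>.\<close>

lemma evans_modulation:
  assumes q0: "speed_shift c0 q0 = p0" "q0 $ 3 = 0"
  shows "(\<lambda>(\<mu>, \<kappa>). evans_function \<Phi> T0 \<mu> \<kappa> - of_real (T0 ^ 4 / 2) *
      modulation_det c0 period (wave_mass period u) (wave_momentum period u) (- \<mu>) \<kappa> q0)
    \<in> O[nhds (0, 0)](\<lambda>(\<mu>, \<kappa>). of_real (norm \<mu> ^ 4 + \<kappa> ^ 4))"
proof (rule order_le_imp_bigo)
  have T0: "complex_of_real T0 \<noteq> 0" using T0_in by auto
  have "(\<lambda>(\<mu>, \<kappa>). evans_function \<Phi> T0 \<mu> \<kappa> - of_real (T0 ^ 4 / 2) *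
      modulation_det c0 period (wave_mass period u) (wave_momentum period u) (- \<mu>) \<kappa> q0)
    = (\<lambda>z. - (det (Nmat z) - det (Nlead z)))"
  proof
    fix z :: "complex \<times> real"
    have "of_real (T0 ^ 4 / 2) * (- 2 * of_real (1 / T0) ^ 4 * det (Nlead z)) = - det (Nlead z)"
      using T0 by (simp add: power_divide)
    then show "(case z of (\<mu>, \<kappa>) \<Rightarrow> evans_function \<Phi> T0 \<mu> \<kappa> - of_real (T0 ^ 4 / 2) *
      modulation_det c0 period (wave_mass period u) (wave_momentum period u) (- \<mu>) \<kappa> q0)
      = - (det (Nmat z) - det (Nlead z))"
      by (cases z) (simp add: evans_Nmat[of z, simplified] modulation_det_eq[OF q0] evans_Nmat[of "(_, _)", simplified])
  qed
  moreover have "order_le 4 (\<lambda>z. - (det (Nmat z) - det (Nlead z)))"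
    using Nmat_approx unfolding approx_def by (intro order_le_minus) (simp add: eval_nat_numeral)
  ultimately show "order_le 4 (\<lambda>(\<mu>, \<kappa>). evans_function \<Phi> T0 \<mu> \<kappa> - of_real (T0 ^ 4 / 2) *
      modulation_det c0 period (wave_mass period u) (wave_momentum period u) (- \<mu>) \<kappa> q0)"
    by simp
qed

end

theorem theorem2:
  fixes f F :: "real \<Rightarrow> real"
    and \<Omega> :: "(real ^ 3) set"
    and um up T M P :: "real ^ 3 \<Rightarrow> real"
    and u :: "real ^ 3 \<Rightarrow> real \<Rightarrow> real"
    and a0 E0 c0 :: real
    and p0 q0 :: "real ^ 3"
    and \<Phi> :: "real \<Rightarrow> complex \<Rightarrow> complex ^ 3 ^ 3"
  assumes f_smooth: "Ck 2 f"
    and F_deriv: "\<And>y. (F has_real_derivative f y) (at y)"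
    and F_zero: "F 0 = 0"
    and family: "wave_family f F \<Omega> um up u"
    and p0: "p0 = vector [a0, E0, c0]" "p0 \<in> \<Omega>"
    and q0: "q0 = vector [a0, E0, 0]"
    and T: "T = wave_period F um up"
    and M: "M = wave_mass T u"
    and P: "P = wave_momentum T u"
    and jac: "det (jacobian (\<lambda>p. vector [T p, M p, P p] :: real ^ 3) (at p0)) \<noteq> 0"
    and nonsing: "nonsingular_differential (profile_space \<Omega> u) (wave_class c0 u) q0"
    and Phi: "is_fundamental_solution (spectral_matrix f (u p0) c0) \<Phi>"
  shows "\<exists>\<Gamma>0::complex. \<Gamma>0 \<noteq> 0 \<and>
    (\<lambda>(\<mu>, \<kappa>). evans_function \<Phi> (T p0) \<mu> \<kappa> - \<Gamma>0 * modulation_det c0 T M P (- \<mu>) \<kappa> q0)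
      \<in> O[nhds (0, 0)](\<lambda>(\<mu>, \<kappa>). of_real (norm \<mu> ^ 4 + \<kappa> ^ 4))"
proof -
  have p03: "p0 $ 3 = c0" and shift: "speed_shift c0 q0 = p0" "q0 $ 3 = 0"
    by (simp_all add: speed_shift_def q0 p0)
  note Phi' = Phi[folded p03]
  interpret wave_setting f F \<Omega> um up u
    by unfold_locales (rule f_smooth F_deriv family)+
  interpret wave_point f F \<Omega> um up u p0
    by unfold_locales (rule p0(2))
  from variational_solution[OF Phi'] obtain w w' where ww':
    "\<And>h x. x \<in> {0..b} \<Longrightarrow> (w h has_real_derivative w' h x) (at x within {0..b})"
    "\<And>h x. x \<in> {0..b} \<Longrightarrow> (w' h has_real_derivative q x * w h x + h $ 1 + h $ 3 * U x) (at x within {0..b})"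
    "\<And>h. w h 0 = um' h" "\<And>h. w' h 0 = 0"
    "\<And>x. linear (\<lambda>h. w h x)" "\<And>x. linear (\<lambda>h. w' h x)"
    by blast
  interpret wave_evans f F \<Omega> um up u p0 w w' \<Phi>
    by (intro wave_evans.intro wave_variation.intro wave_variation_axioms.intro wave_evans_axioms.intro
        wave_point_axioms ww' Phi')
  have T_eq: "T = period" by (simp add: fun_eq_iff T period_def)
  from evans_modulation[OF shift]
  have "(\<lambda>(\<mu>, \<kappa>). evans_function \<Phi> (T p0) \<mu> \<kappa> - of_real (T p0 ^ 4 / 2) * modulation_det c0 T M P (- \<mu>) \<kappa> q0)
      \<in> O[nhds (0, 0)](\<lambda>(\<mu>, \<kappa>). of_real (norm \<mu> ^ 4 + \<kappa> ^ 4))"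
    unfolding M P T_eq .
  moreover have "complex_of_real (T p0 ^ 4 / 2) \<noteq> 0"
    using T0_in by (simp add: T_eq)
  ultimately show ?thesis by blast
qed

end
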